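(* Let $A, A_0, B, B_0$ be the linear $3$-uniform hypergraphs defined in the context. Each of them contains a wicket as a subgraph, and the following two assertions hold. (1) For every $c>0$ there is an $n_0$ such that for all $n\ge n_0$ every linear $3$-uniform hypergraph on $n$ vertices with at least $cn^2$ edges contains a subgraph isomorphic to $A$ or to $A_0$. (2) For every $c>0$ there is an $n_0$ such that for all $n\ge n_0$ every linear $3$-uniform hypergraph on $n$ vertices with at least $cn^2$ edges contains a subgraph isomorphic to $B$ or to $B_0$.
   Context: A $3$-uniform hypergraph is a hypergraph all of whose edges have exactly three vertices. It is linear if any two distinct edges have at most one vertex in common. Subgraphs are not necessarily induced. The wicket is the linear $3$-uniform hypergraph with nine vertices $p_{ij}$ ($1\le i,j\le 3$) and five edges: $\{p_{i1},p_{i2},p_{i3}\}$ for $i=1,2,3$ and $\{p_{1j},p_{2j},p_{3j}\}$ for $j=1,2$. First hypergraph. $A$ has the $14$ distinct vertices $a_1,a_3,b_1,b_3,u_1,u_3,v_1,v_3,x,x',x'',y,y',z$ and the nine edges $\{a_1,v_3,x\}$, $\{v_1,a_3,x\}$, $\{v_1,v_3,y\}$, $\{a_1,u_3,x'\}$, $\{u_1,a_3,x'\}$, $\{u_1,u_3,y'\}$, $\{b_1,u_3,x''\}$, $\{v_1,b_3,x''\}$, $\{v_1,u_3,z\}$. $A_0$ is the hypergraph with $13$ vertices and nine edges obtained from $A$ by identifying $y$ and $y'$. Second hypergraph. $B$ has the $13$ distinct vertices $w_1',w_1'',w_3',w_3'',v_1',v_1'',v_3',v_3'',x_1,x_2,y_1,y_2,y_3$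 and the nine edges $\{v_1',w_3'',x_1\}$, $\{w_1'',w_3',x_1\}$, $\{w_1',v_3'',x_1\}$, $\{w_1',w_3'',x_2\}$, $\{v_1'',w_3',x_2\}$, $\{w_1'',v_3',x_2\}$, $\{w_1'',w_3'',y_1\}$, $\{v_1'',w_3'',y_2\}$, $\{w_1'',v_3'',y_3\}$. $B_0$ is the hypergraph with $12$ vertices and nine edges obtained from $B$ by identifying $y_2$ and $y_3$. *)

theory Defs
  imports Complex_Main
begin

record 'a hypergraph =
  verts :: "'a set"
  edges :: "'a set set"

definition uniform3 :: "'a hypergraph \<Rightarrow> bool" where
  "uniform3 G \<longleftrightarrow> finite (verts G) \<and> (\<forall>e\<in>edges G. e \<subseteq> verts G \<and> card e = 3)"

definition linear3 :: "'a hypergraph \<Rightarrow> bool" where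
  "linear3 G \<longleftrightarrow> uniform3 G \<and> (\<forall>e\<in>edges G. \<forall>f\<in>edges G. e \<noteq> f \<longrightarrow> card (e \<inter> f) \<le> 1)"

definition subgraph :: "'a hypergraph \<Rightarrow> 'a hypergraph \<Rightarrow> bool" where
  "subgraph H G \<longleftrightarrow> verts H \<subseteq> verts G \<and> edges H \<subseteq> edges G"

definition isomorphic :: "'a hypergraph \<Rightarrow> 'b hypergraph \<Rightarrow> bool" where
  "isomorphic F H \<longleftrightarrow> (\<exists>f. bij_betw f (verts F) (verts H) \<and> edges H = (`) f ` edges F)"

definition contains :: "'b hypergraph \<Rightarrow> 'a hypergraph \<Rightarrow> bool" where
  "contains G F \<longleftrightarrow> (\<exists>H. subgraph H G \<and> isomorphic F H)"

definition identify :: "'a \<Rightarrow> 'a \<Rightarrow> 'a hypergraph \<Rightarrow> 'a hypergraph" where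
  "identify v w G =
    (let q = (\<lambda>u. if u = w then v else u)
     in \<lparr>verts = q ` verts G, edges = (`) q ` edges G\<rparr>)"

text \<open>The pair \<open>(i, j)\<close> is the vertex \<open>p\<^sub>i\<^sub>j\<close>.\<close>

definition wicket :: "(nat \<times> nat) hypergraph" where
  "wicket =
    \<lparr>verts = {1..3} \<times> {1..3},
     edges = {{(i, 1), (i, 2), (i, 3)} |i. i \<in> {1..3}} \<union> {{(1, j), (2, j), (3, j)} |j. j \<in> {1..2}}\<rparr>"

datatype A_vertex =
    A_a1 | A_a3 | A_b1 | A_b3 | A_u1 | A_u3 | A_v1 | A_v3
  | A_x | A_x' | A_x'' | A_y | A_y' | A_z

definition hyp_A :: "A_vertex hypergraph" where
  "hyp_A =
    \<lparr>verts = UNIV,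
     edges =
       {{A_a1, A_v3, A_x}, {A_v1, A_a3, A_x}, {A_v1, A_v3, A_y},
        {A_a1, A_u3, A_x'}, {A_u1, A_a3, A_x'}, {A_u1, A_u3, A_y'},
        {A_b1, A_u3, A_x''}, {A_v1, A_b3, A_x''}, {A_v1, A_u3, A_z}}\<rparr>"

definition hyp_A0 :: "A_vertex hypergraph" where
  "hyp_A0 = identify A_y A_y' hyp_A"

datatype B_vertex =
    B_w1' | B_w1'' | B_w3' | B_w3'' | B_v1' | B_v1'' | B_v3' | B_v3''
  | B_x1 | B_x2 | B_y1 | B_y2 | B_y3

definition hyp_B :: "B_vertex hypergraph" where
  "hyp_B =
    \<lparr>verts = UNIV,
     edges =
       {{B_v1', B_w3'', B_x1}, {B_w1'', B_w3', B_x1}, {B_w1', B_v3'', B_x1},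
        {B_w1', B_w3'', B_x2}, {B_v1'', B_w3', B_x2}, {B_w1'', B_v3', B_x2},
        {B_w1'', B_w3'', B_y1}, {B_v1'', B_w3'', B_y2}, {B_w1'', B_v3'', B_y3}}\<rparr>"

definition hyp_B0 :: "B_vertex hypergraph" where
  "hyp_B0 = identify B_y2 B_y3 hyp_B"

lemma A_UNIV:
  "(UNIV :: A_vertex set) =
    {A_a1, A_a3, A_b1, A_b3, A_u1, A_u3, A_v1, A_v3, A_x, A_x', A_x'', A_y, A_y', A_z}"
  using A_vertex.exhaust by blast

lemma B_UNIV:
  "(UNIV :: B_vertex set) =
    {B_w1', B_w1'', B_w3', B_w3'', B_v1', B_v1'', B_v3', B_v3'', B_x1, B_x2, B_y1, B_y2, B_y3}"
  using B_vertex.exhaust by blast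

lemma verts_A0: "verts hyp_A0 = UNIV - {A_y'}"
  by (auto simp: hyp_A0_def hyp_A_def identify_def Let_def)

lemma verts_B0: "verts hyp_B0 = UNIV - {B_y3}"
  by (auto simp: hyp_B0_def hyp_B_def identify_def Let_def)

lemma card_verts:
  "card (verts hyp_A) = 14" "card (verts hyp_A0) = 13"
  "card (verts hyp_B) = 13" "card (verts hyp_B0) = 12"
  by (simp_all add: verts_A0 verts_B0 hyp_A_def hyp_B_def A_UNIV B_UNIV)

lemma card_edges:
  "card (edges hyp_A) = 9" "card (edges hyp_A0) = 9"
  "card (edges hyp_B) = 9" "card (edges hyp_B0) = 9"
  by (simp_all add: hyp_A0_def hyp_A_def hyp_B0_def hyp_B_def identify_def set_eq_subset)

lemma edges_wicket:
  "edges wicket =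
    {{(1, 1), (1, 2), (1, 3)}, {(2, 1), (2, 2), (2, 3)}, {(3, 1), (3, 2), (3, 3)},
     {(1, 1), (2, 1), (3, 1)}, {(1, 2), (2, 2), (3, 2)}}"
proof -
  have "{1..3} = {1, 2, 3 :: nat}" "{1..2} = {1, 2 :: nat}" by auto
  then show ?thesis
    unfolding wicket_def by (simp add: setcompr_eq_image Collect_disj_eq insert_commute)
qed

lemma linear3_wicket: "linear3 wicket"
  unfolding linear3_def uniform3_def edges_wicket by (simp add: wicket_def)

lemma linear3_A: "linear3 hyp_A"
  by (simp add: linear3_def uniform3_def hyp_A_def A_UNIV)

lemma linear3_A0: "linear3 hyp_A0"
  by (simp add: linear3_def uniform3_def verts_A0 A_UNIV) (simp add: hyp_A0_def hyp_A_def identify_def)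

lemma linear3_B: "linear3 hyp_B"
  by (simp add: linear3_def uniform3_def hyp_B_def B_UNIV)

lemma linear3_B0: "linear3 hyp_B0"
  by (simp add: linear3_def uniform3_def verts_B0 B_UNIV) (simp add: hyp_B0_def hyp_B_def identify_def)

end

theory Submission
  imports Defs "HOL-Library.FuncSet"
begin

text \<open>
  Call the edges of a linear 3-uniform hypergraph lines.  A \<^emph>\<open>cell\<close> is a quadruple
  \<open>(v\<^sub>1, v\<^sub>3, a\<^sub>1, a\<^sub>3)\<close> for which there are lines \<open>{v\<^sub>1, a\<^sub>3, x}\<close>, \<open>{a\<^sub>1, v\<^sub>3, x}\<close>, \<open>{v\<^sub>1, v\<^sub>3, y}\<close>: a triangle
  \<open>v\<^sub>1, v\<^sub>3, x\<close> of pairwise collinear points together with the third points on its sides.  By linearity any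
  three corners of a cell determine the fourth.  Suppose that a quadruple \<open>(q, s, p, r)\<close> is not a cell, but
  that each of its four faces extends to a cell.  These four cells are made of exactly nine
  lines, which form the hypergraph \<open>B\<close>, or \<open>B\<^sub>0\<close> if two of the vertices coincide (lemma \<open>contains_B\<close>).
  Two of the four cells, the line through \<open>q\<close> and \<open>s\<close>, and one more triangle over \<open>q\<close> and \<open>s\<close> form
  \<open>A\<close> or \<open>A\<^sub>0\<close> (lemma \<open>contains_A\<close>).  So one such quadruple settles both assertions.

  Quadruples of this kind exist because of the removal phenomenon for tetrahedra in 3-graphs (theorem
  \<open>tetrahedron_lemma\<close>): of the order of \<open>n\<^sup>3\<close> quadruples on \<open>n\<close> points, any three of whose coordinates
  determine the fourth, produce of the order of \<open>n\<^sup>4\<close> quadruples all of whose faces are faces of given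
  ones.  Since there are at most \<open>n\<^sup>3\<close> cells, most of these are not cells.  That a dense linear
  system has of the order of \<open>n\<^sup>3\<close> cells is the corresponding statement for triangles, which follows from the
  one for tetrahedra by twisting with a Latin square (lemma \<open>card_triangles\<close>).  A random colouring of the
  vertices with six colours, one for each role in a cell, rules out coincidences between vertices in
  different roles.

  The tetrahedron lemma is proved by regularity.  The cube \<open>X\<^sup>4\<close> is partitioned by sets that
  depend on two coordinates and by sets that depend on one.  There are a coarse family \<open>\<A>\<close> and
  a finer one \<open>\<A>'\<close> (lemma \<open>strong_regularity\<close>) such that: the pair sets of \<open>\<A>\<close> are regular
  bipartite graphs on the boxes cut out by its single-coordinate sets; each of the four face 3-graphs
  is indistinguishable, by sets of pairs, from its average on the atoms of \<open>\<A>'\<close>, up to an error that is tiny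
  in terms of the complexity of \<open>\<A>\<close>; and these averages are close in mean square to the averages for \<open>\<A>\<close>.
  A generic given quadruple selects a box and six graphs of \<open>\<A>\<close> in which everything is dense and
  regular (lemma \<open>generic_point\<close>).  The tetrahedra of these graphs are numerous, and at most of
  them the four averages are bounded below (lemma \<open>card_regular_box\<close>); by uniformity, a
  product of averages counts actual tetrahedra (lemma \<open>card_high_average_le\<close>).
\<close>

section \<open>Averaging over the atoms of a finite family of sets\<close>

definition atom :: "'o set \<Rightarrow> 'o set set \<Rightarrow> 'o \<Rightarrow> 'o set" where
  "atom \<Omega> \<C> w = {w' \<in> \<Omega>. \<forall>A\<in>\<C>. w' \<in> A \<longleftrightarrow> w \<in> A}"

definition cexp :: "'o set \<Rightarrow> 'o set set \<Rightarrow> ('o \<Rightarrow> real) \<Rightarrow> 'o \<Rightarrow> real" where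
  "cexp \<Omega> \<C> f w = (\<Sum>w'\<in>atom \<Omega> \<C> w. f w') / card (atom \<Omega> \<C> w)"

definition energy :: "'o set \<Rightarrow> 'o set set \<Rightarrow> ('o \<Rightarrow> real) \<Rightarrow> real" where
  "energy \<Omega> \<C> f = (\<Sum>w\<in>\<Omega>. (cexp \<Omega> \<C> f w)\<^sup>2)"

lemma atom_subset: "atom \<Omega> \<C> w \<subseteq> \<Omega>"
  by (auto simp: atom_def)

lemma atom_self: "w \<in> \<Omega> \<Longrightarrow> w \<in> atom \<Omega> \<C> w"
  by (auto simp: atom_def)

lemma atom_eq: "w' \<in> atom \<Omega> \<C> w \<Longrightarrow> atom \<Omega> \<C> w' = atom \<Omega> \<C> w"
  by (auto simp: atom_def)

lemma atom_sym: "w' \<in> atom \<Omega> \<C> w \<Longrightarrow> w \<in> \<Omega> \<Longrightarrow> w \<in> atom \<Omega> \<C> w'"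
  by (auto simp: atom_def)

lemma atom_mono: "\<C> \<subseteq> \<D> \<Longrightarrow> atom \<Omega> \<D> w \<subseteq> atom \<Omega> \<C> w"
  by (auto simp: atom_def)

lemma finite_atom: "finite \<Omega> \<Longrightarrow> finite (atom \<Omega> \<C> w)"
  by (metis atom_subset finite_subset)

lemma card_atom_pos: "finite \<Omega> \<Longrightarrow> w \<in> \<Omega> \<Longrightarrow> card (atom \<Omega> \<C> w) > 0"
  by (metis atom_self card_gt_0_iff empty_iff finite_atom)

lemma cexp_const: "w' \<in> atom \<Omega> \<C> w \<Longrightarrow> cexp \<Omega> \<C> f w' = cexp \<Omega> \<C> f w"
  by (simp add: cexp_def atom_eq)

lemma sum_cexp_mult:
  assumes fin: "finite \<Omega>"
    and g: "\<And>w w'. w \<in> \<Omega> \<Longrightarrow> w' \<in> atom \<Omega> \<C> w \<Longrightarrow> g w' = g w"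
  shows "(\<Sum>w\<in>\<Omega>. cexp \<Omega> \<C> f w * g w) = (\<Sum>w\<in>\<Omega>. f w * g w)"
proof -
  let ?a = "atom \<Omega> \<C>"
  have ind: "(\<Sum>w'\<in>?a w. h w') = (\<Sum>w'\<in>\<Omega>. if w' \<in> ?a w then h w' else 0)" for w and h :: "_ \<Rightarrow> real"
    using fin by (simp add: sum.inter_restrict[symmetric] Int_absorb1 atom_subset)
  have "(\<Sum>w\<in>\<Omega>. cexp \<Omega> \<C> f w * g w)
      = (\<Sum>w\<in>\<Omega>. \<Sum>w'\<in>\<Omega>. if w' \<in> ?a w then f w' * g w / card (?a w) else 0)"
    by (intro sum.cong refl)
      (simp add: cexp_def ind[symmetric] sum_divide_distrib sum_distrib_right)
  also have "\<dots> = (\<Sum>w'\<in>\<Omega>. \<Sum>w\<in>\<Omega>. if w' \<in> ?a w then f w' * g w / card (?a w) else 0)"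
    by (rule sum.swap)
  also have "\<dots> = (\<Sum>w'\<in>\<Omega>. \<Sum>w\<in>\<Omega>. if w \<in> ?a w' then f w' * g w' / card (?a w') else 0)"
  proof (intro sum.cong refl)
    fix w w' assume w: "w \<in> \<Omega>" "w' \<in> \<Omega>"
    show "(if w' \<in> ?a w then f w' * g w / card (?a w) else 0)
        = (if w \<in> ?a w' then f w' * g w' / card (?a w') else 0)"
    proof (cases "w' \<in> ?a w")
      case True
      then show ?thesis using w g[OF w(1) True] atom_eq[OF True] atom_sym[OF True w(1)] by simp
    next
      case False
      then have "w \<notin> ?a w'" using w atom_sym by metis
      then show ?thesis using False by simp
    qed
  qed
  also have "\<dots> = (\<Sum>w'\<in>\<Omega>. f w' * g w')"
    using fin card_atom_pos[OF fin] by (intro sum.cong refl) (simp add: ind[symmetric])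
  finally show ?thesis .
qed

lemma sum_cexp: "finite \<Omega> \<Longrightarrow> (\<Sum>w\<in>\<Omega>. cexp \<Omega> \<C> f w) = (\<Sum>w\<in>\<Omega>. f w)"
  using sum_cexp_mult[of \<Omega> \<C> "\<lambda>_. 1" f] by simp

lemma cexp_bounds:
  assumes "finite \<Omega>" "w \<in> \<Omega>" "\<And>w. w \<in> \<Omega> \<Longrightarrow> 0 \<le> f w" "\<And>w. w \<in> \<Omega> \<Longrightarrow> f w \<le> 1"
  shows "0 \<le> cexp \<Omega> \<C> f w" "cexp \<Omega> \<C> f w \<le> 1"
proof -
  have s: "w' \<in> \<Omega>" if "w' \<in> atom \<Omega> \<C> w" for w' using that by (auto simp: atom_def)
  show "0 \<le> cexp \<Omega> \<C> f w"
    unfolding cexp_def using assms(3) s by (intro divide_nonneg_nonneg sum_nonneg) auto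
  have "(\<Sum>w'\<in>atom \<Omega> \<C> w. f w') \<le> (\<Sum>w'\<in>atom \<Omega> \<C> w. 1)"
    using assms(4) s by (intro sum_mono) auto
  then show "cexp \<Omega> \<C> f w \<le> 1"
    unfolding cexp_def using card_atom_pos[OF assms(1,2)] by (simp add: divide_le_eq)
qed

lemma energy_le:
  assumes "finite \<Omega>" "\<And>w. w \<in> \<Omega> \<Longrightarrow> 0 \<le> f w" "\<And>w. w \<in> \<Omega> \<Longrightarrow> f w \<le> 1"
  shows "energy \<Omega> \<C> f \<le> card \<Omega>"
proof -
  have "energy \<Omega> \<C> f \<le> (\<Sum>w\<in>\<Omega>. 1)"
    unfolding energy_def
    using cexp_bounds[OF assms(1) _ assms(2,3)] by (intro sum_mono) (simp add: power_le_one)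
  then show ?thesis by simp
qed

text \<open>Pythagoras: averaging over atoms is an orthogonal projection.\<close>

lemma energy_diff:
  assumes fin: "finite \<Omega>" and sub: "\<C> \<subseteq> \<D>"
  shows "energy \<Omega> \<D> f - energy \<Omega> \<C> f = (\<Sum>w\<in>\<Omega>. (cexp \<Omega> \<D> f w - cexp \<Omega> \<C> f w)\<^sup>2)"
proof -
  let ?c = "cexp \<Omega> \<C> f" and ?d = "cexp \<Omega> \<D> f"
  have "(\<Sum>w\<in>\<Omega>. ?d w * ?c w) = (\<Sum>w\<in>\<Omega>. f w * ?c w)"
    using atom_mono[OF sub] by (intro sum_cexp_mult fin) (metis cexp_const subsetD)
  also have "\<dots> = (\<Sum>w\<in>\<Omega>. ?c w * ?c w)"
    by (intro sum_cexp_mult[symmetric] fin) (rule cexp_const)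
  finally show ?thesis
    by (simp add: energy_def power2_eq_square algebra_simps sum.distrib sum_subtractf
        flip: sum_distrib_left)
qed

lemma energy_mono:
  assumes "finite \<Omega>" "\<C> \<subseteq> \<D>"
  shows "energy \<Omega> \<C> f \<le> energy \<Omega> \<D> f"
proof -
  have "energy \<Omega> \<D> f - energy \<Omega> \<C> f \<ge> 0"
    unfolding energy_diff[OF assms] by (rule sum_nonneg) simp
  then show ?thesis by simp
qed

text \<open>A bounded function on the finer atoms that correlates with \<open>f\<close> beyond its average on the coarse atoms
  is seen by the finer average, hence by the energy.\<close>

lemma energy_increment:
  fixes \<eta> :: real
  assumes fin: "finite \<Omega>" and sub: "\<C> \<subseteq> \<D>"
    and g: "\<And>w w'. w \<in> \<Omega> \<Longrightarrow> w' \<in> atom \<Omega> \<D> w \<Longrightarrow> g w' = g w"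
    and g1: "\<And>w. w \<in> \<Omega> \<Longrightarrow> \<bar>g w\<bar> \<le> 1"
    and big: "\<bar>\<Sum>w\<in>\<Omega>. (f w - cexp \<Omega> \<C> f w) * g w\<bar> \<ge> \<eta> * card \<Omega>" and \<eta>: "\<eta> \<ge> 0"
  shows "energy \<Omega> \<D> f \<ge> energy \<Omega> \<C> f + \<eta>\<^sup>2 * card \<Omega>"
proof -
  define u where "u w = cexp \<Omega> \<D> f w - cexp \<Omega> \<C> f w" for w
  obtain s :: real where s: "\<bar>s\<bar> = 1" "\<bar>\<Sum>w\<in>\<Omega>. u w * g w\<bar> = s * (\<Sum>w\<in>\<Omega>. u w * g w)"
    using that[of 1] that[of "-1"] by (cases "(\<Sum>w\<in>\<Omega>. u w * g w) \<ge> 0") auto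
  have "(\<Sum>w\<in>\<Omega>. u w * g w) = (\<Sum>w\<in>\<Omega>. (f w - cexp \<Omega> \<C> f w) * g w)"
    using sum_cexp_mult[OF fin g, where f=f] by (simp add: u_def left_diff_distrib sum_subtractf)
  then have "\<eta> * card \<Omega> \<le> s * (\<Sum>w\<in>\<Omega>. u w * g w)"
    using big s(2) by simp
  then have "2 * \<eta> * (\<eta> * card \<Omega>) \<le> 2 * \<eta> * (s * (\<Sum>w\<in>\<Omega>. u w * g w))"
    using \<eta> by (intro mult_left_mono) auto
  also have "\<dots> = (\<Sum>w\<in>\<Omega>. 2 * \<eta> * (s * (u w * g w)))"
    by (simp add: sum_distrib_left)
  \<comment> \<open>The arithmetic-geometric mean inequality replaces Cauchy-Schwarz here.\<close>
  also have "\<dots> \<le> (\<Sum>w\<in>\<Omega>. (u w)\<^sup>2 + \<eta>\<^sup>2)"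
  proof (rule sum_mono)
    fix w assume w: "w \<in> \<Omega>"
    have "(s * g w)\<^sup>2 \<le> 1"
      using g1[OF w] s(1) by (simp add: abs_square_le_1 abs_mult)
    then have "\<eta>\<^sup>2 * (s * g w)\<^sup>2 \<le> \<eta>\<^sup>2 * 1" by (intro mult_left_mono) auto
    moreover have "0 \<le> (u w - \<eta> * (s * g w))\<^sup>2" by simp
    ultimately show "2 * \<eta> * (s * (u w * g w)) \<le> (u w)\<^sup>2 + \<eta>\<^sup>2"
      by (simp add: power2_diff power_mult_distrib algebra_simps)
  qed
  also have "\<dots> = (\<Sum>w\<in>\<Omega>. (u w)\<^sup>2) + \<eta>\<^sup>2 * card \<Omega>"
    by (simp add: sum.distrib)
  finally show ?thesis
    using energy_diff[OF fin sub, where f=f] by (simp add: u_def power2_eq_square)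
qed

lemma card_atoms_le:
  assumes "finite \<C>"
  shows "finite (atom \<Omega> \<C> ` \<Omega>)" "card (atom \<Omega> \<C> ` \<Omega>) \<le> 2 ^ card \<C>"
proof -
  have "atom \<Omega> \<C> ` \<Omega> \<subseteq> (\<lambda>L. {w'\<in>\<Omega>. \<forall>A\<in>\<C>. w' \<in> A \<longleftrightarrow> A \<in> L}) ` Pow \<C>" (is "_ \<subseteq> ?g ` _")
  proof
    fix T assume "T \<in> atom \<Omega> \<C> ` \<Omega>"
    then obtain w where "T = atom \<Omega> \<C> w" by blast
    then have "T = ?g {A\<in>\<C>. w \<in> A}" by (auto simp: atom_def)
    then show "T \<in> ?g ` Pow \<C>" by blast
  qed
  moreover have "card (?g ` Pow \<C>) \<le> 2 ^ card \<C>"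
    using card_image_le[of "Pow \<C>" ?g] assms by (simp add: card_Pow)
  moreover have fin: "finite (?g ` Pow \<C>)" using assms by simp
  ultimately show "finite (atom \<Omega> \<C> ` \<Omega>)" "card (atom \<Omega> \<C> ` \<Omega>) \<le> 2 ^ card \<C>"
    by (auto intro: finite_subset order_trans[OF card_mono[OF fin]])
qed

lemma sum_indicator_card:
  assumes "finite \<Omega>" shows "(\<Sum>w\<in>\<Omega>. of_bool (w \<in> B)) = (card (\<Omega> \<inter> B) :: real)"
  using assms by (simp add: sum.If_cases of_bool_def)

lemma cexp_indicator:
  assumes "finite \<Omega>"
  shows "cexp \<Omega> \<C> (\<lambda>w. of_bool (w \<in> B)) w = card (atom \<Omega> \<C> w \<inter> B) / card (atom \<Omega> \<C> w)"
  using sum_indicator_card[OF finite_atom[OF assms]] by (simp add: cexp_def)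

text \<open>Each of the at most \<open>2 ^ card \<P>\<close> atoms of \<open>\<P>\<close> contributes at most the proportion \<open>\<theta>\<close> of every cell
  of \<open>\<C>\<close> to the exceptional set.\<close>

lemma card_sparse_atoms:
  fixes \<theta> :: real
  assumes fin: "finite \<Omega>" and finP: "finite \<P>" and \<theta>: "\<theta> \<ge> 0"
  shows "card {w\<in>\<Omega>. card (atom \<Omega> \<C> w \<inter> atom \<Omega> \<P> w) < \<theta> * card (atom \<Omega> \<C> w)}
          \<le> 2 ^ card \<P> * \<theta> * card \<Omega>"
proof -
  define S where "S = {w\<in>\<Omega>. card (atom \<Omega> \<C> w \<inter> atom \<Omega> \<P> w) < \<theta> * card (atom \<Omega> \<C> w)}"
  have one: "card (S \<inter> U) \<le> \<theta> * card \<Omega>" if U: "U \<in> atom \<Omega> \<P> ` \<Omega>" for U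
  proof -
    have "\<Omega> \<inter> (S \<inter> U) = S \<inter> U" by (auto simp: S_def)
    then have "real (card (S \<inter> U)) = (\<Sum>w\<in>\<Omega>. of_bool (w \<in> S \<inter> U))"
      using sum_indicator_card[OF fin, of "S \<inter> U"] by simp
    also have "\<dots> = (\<Sum>w\<in>\<Omega>. cexp \<Omega> \<C> (\<lambda>w. of_bool (w \<in> S \<inter> U)) w)"
      by (rule sum_cexp[OF fin, symmetric])
    also have "\<dots> \<le> (\<Sum>w\<in>\<Omega>. \<theta>)"
    proof (rule sum_mono)
      fix w assume w: "w \<in> \<Omega>"
      let ?a = "atom \<Omega> \<C> w"
      have "card (?a \<inter> (S \<inter> U)) \<le> \<theta> * card ?a"
      proof (cases "?a \<inter> (S \<inter> U) = {}")
        case True then show ?thesis using \<theta> by simp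
      next
        case False
        then obtain v where v: "v \<in> ?a" "v \<in> S" "v \<in> U" by blast
        have "atom \<Omega> \<P> v = U" using U v(3) atom_eq[of v \<Omega> \<P>] by blast
        moreover have "atom \<Omega> \<C> v = ?a" using v(1) by (rule atom_eq)
        ultimately have "card (?a \<inter> U) < \<theta> * card ?a" using v(2) by (simp add: S_def)
        moreover have "card (?a \<inter> (S \<inter> U)) \<le> card (?a \<inter> U)"
          using finite_atom[OF fin, of \<C> w] by (intro card_mono) auto
        ultimately show ?thesis by linarith
      qed
      then show "cexp \<Omega> \<C> (\<lambda>w. of_bool (w \<in> S \<inter> U)) w \<le> \<theta>"
        unfolding cexp_indicator[OF fin] using card_atom_pos[OF fin w, of \<C>]
        by (simp only: divide_le_eq) simp
    qed
    finally show ?thesis by (simp add: mult.commute)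
  qed
  have "S = (\<Union>U\<in>atom \<Omega> \<P> ` \<Omega>. S \<inter> U)"
    using atom_self[of _ \<Omega> \<P>] by (auto simp: S_def)
  then have "card S \<le> (\<Sum>U\<in>atom \<Omega> \<P> ` \<Omega>. card (S \<inter> U))"
    by (rule ord_eq_le_trans[OF arg_cong[where f=card]
          card_UN_le[OF card_atoms_le(1)[OF finP]]])
  then have "card S \<le> (\<Sum>U\<in>atom \<Omega> \<P> ` \<Omega>. real (card (S \<inter> U)))"
    by (simp flip: of_nat_sum)
  also have "\<dots> \<le> (\<Sum>U\<in>atom \<Omega> \<P> ` \<Omega>. \<theta> * card \<Omega>)" using one by (intro sum_mono) auto
  also have "\<dots> = real (card (atom \<Omega> \<P> ` \<Omega>)) * (\<theta> * card \<Omega>)" by simp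
  also have "\<dots> \<le> real (2 ^ card \<P>) * (\<theta> * card \<Omega>)"
    using card_atoms_le(2)[OF finP, of \<Omega>] \<theta> by (intro mult_right_mono of_nat_mono) auto
  finally show ?thesis by (simp add: mult.assoc S_def)
qed

text \<open>The pigeonhole behind every regularity statement: a bounded quantity cannot grow by \<open>\<delta>\<close> at each
  failure for ever.  The ambient object \<open>t\<close> is quantified inside because the resulting bound must not
  depend on it; it will be the vertex set together with the sets to be regularised.\<close>

lemma increment_iteration:
  fixes \<Phi> :: "'t \<Rightarrow> 's \<Rightarrow> real" and size :: "'s \<Rightarrow> nat"
  assumes \<delta>: "\<delta> > 0"
    and nonneg: "\<And>t s. I t s \<Longrightarrow> 0 \<le> \<Phi> t s" and bound: "\<And>t s. I t s \<Longrightarrow> \<Phi> t s \<le> C"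
    and refl: "\<And>s. R s s" and trans: "\<And>s s' s''. R s s' \<Longrightarrow> R s' s'' \<Longrightarrow> R s s''"
    and step: "\<And>m. \<exists>M. \<forall>t s. I t s \<and> size s \<le> m \<and> \<not> good t s \<longrightarrow>
                 (\<exists>s'. I t s' \<and> R s s' \<and> size s' \<le> M \<and> \<Phi> t s' \<ge> \<Phi> t s + \<delta>)"
  shows "\<exists>M. \<forall>t s. I t s \<and> size s \<le> m \<longrightarrow> (\<exists>s'. I t s' \<and> R s s' \<and> size s' \<le> M \<and> good t s')"
proof -
  have main: "\<exists>M. \<forall>t s. I t s \<and> size s \<le> m \<and> \<Phi> t s \<ge> C - real j * \<delta> \<longrightarrow>
          (\<exists>s'. I t s' \<and> R s s' \<and> size s' \<le> M \<and> good t s')" for j m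
  proof (induction j arbitrary: m)
    case 0
    obtain M where M: "\<And>t s. I t s \<and> size s \<le> m \<and> \<not> good t s \<Longrightarrow>
                 (\<exists>s'. I t s' \<and> R s s' \<and> size s' \<le> M \<and> \<Phi> t s' \<ge> \<Phi> t s + \<delta>)"
      using step by meson
    have "good t s" if "I t s" "size s \<le> m" "\<Phi> t s \<ge> C" for t s
    proof (rule ccontr)
      assume "\<not> good t s"
      with M that obtain s' where "I t s'" "\<Phi> t s' \<ge> \<Phi> t s + \<delta>" by blast
      with bound[of t s'] that \<delta> show False by linarith
    qed
    then have "\<forall>t s. I t s \<and> size s \<le> m \<and> \<Phi> t s \<ge> C - real 0 * \<delta> \<longrightarrow>
          (\<exists>s'. I t s' \<and> R s s' \<and> size s' \<le> m \<and> good t s')"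
      using refl by auto
    then show ?case ..
  next
    case (Suc j)
    obtain M where M: "\<And>t s. I t s \<and> size s \<le> m \<and> \<not> good t s \<Longrightarrow>
                 (\<exists>s'. I t s' \<and> R s s' \<and> size s' \<le> M \<and> \<Phi> t s' \<ge> \<Phi> t s + \<delta>)"
      using step by meson
    obtain N where N: "\<And>t s. I t s \<and> size s \<le> M \<and> \<Phi> t s \<ge> C - real j * \<delta> \<Longrightarrow>
          (\<exists>s'. I t s' \<and> R s s' \<and> size s' \<le> N \<and> good t s')"
      using Suc.IH[of M] by meson
    have "\<exists>s'. I t s' \<and> R s s' \<and> size s' \<le> max m N \<and> good t s'"
      if s: "I t s" "size s \<le> m" "\<Phi> t s \<ge> C - real (Suc j) * \<delta>" for t s
    proof (cases "good t s")
      case True then show ?thesis using s refl by (intro exI[of _ s]) auto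
    next
      case False
      with M s obtain s' where s': "I t s'" "R s s'" "size s' \<le> M" "\<Phi> t s' \<ge> \<Phi> t s + \<delta>" by blast
      have "\<Phi> t s' \<ge> C - real j * \<delta>" using s(3) s'(4) by (simp add: algebra_simps)
      then obtain s'' where "I t s''" "R s' s''" "size s'' \<le> N" "good t s''"
        using N s' by blast
      then show ?thesis using trans s'(2) by (metis le_max_iff_disj)
    qed
    then show ?case by blast
  qed
  obtain j where "C \<le> real j * \<delta>"
    using \<delta> by (metis pos_divide_le_eq real_arch_simple)
  then have low: "\<Phi> t s \<ge> C - real j * \<delta>" if "I t s" for t s
    using nonneg[OF that] by linarith
  obtain M where "\<forall>t s. I t s \<and> size s \<le> m \<and> \<Phi> t s \<ge> C - real j * \<delta> \<longrightarrow>
          (\<exists>s'. I t s' \<and> R s s' \<and> size s' \<le> M \<and> good t s')"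
    using main[of m j] by (rule exE)
  with low show ?thesis by (intro exI[of _ M]) blast
qed

section \<open>Sets in a finite cube that depend on few coordinates\<close>

definition mix :: "nat set \<Rightarrow> (nat \<Rightarrow> 'a) \<Rightarrow> (nat \<Rightarrow> 'a) \<Rightarrow> nat \<Rightarrow> 'a" where
  "mix e w z = (\<lambda>i. if i \<in> e then w i else z i)"

locale cube =
  fixes D :: "nat set" and X :: "'a set"
  assumes finD: "finite D" and finX: "finite X"
begin

definition \<Omega> :: "(nat \<Rightarrow> 'a) set" where
  "\<Omega> = D \<rightarrow>\<^sub>E X"

definition dep :: "nat set \<Rightarrow> (nat \<Rightarrow> 'a) set \<Rightarrow> bool" where
  "dep e A \<longleftrightarrow> (\<forall>w\<in>\<Omega>. \<forall>w'\<in>\<Omega>. (\<forall>i\<in>e. w i = w' i) \<longrightarrow> (w \<in> A \<longleftrightarrow> w' \<in> A))"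

lemma fin: "finite \<Omega>"
  unfolding \<Omega>_def using finD finX by (simp add: finite_PiE)

lemma card_\<Omega>: "card \<Omega> = card X ^ card D"
  unfolding \<Omega>_def using finD by (simp add: card_PiE)

lemma depI:
  "(\<And>w w'. w \<in> \<Omega> \<Longrightarrow> w' \<in> \<Omega> \<Longrightarrow> (\<And>i. i \<in> e \<Longrightarrow> w i = w' i) \<Longrightarrow> w \<in> A \<Longrightarrow> w' \<in> A) \<Longrightarrow> dep e A"
  unfolding dep_def by metis

lemma depD: "dep e A \<Longrightarrow> w \<in> \<Omega> \<Longrightarrow> w' \<in> \<Omega> \<Longrightarrow> (\<And>i. i \<in> e \<Longrightarrow> w i = w' i) \<Longrightarrow> w \<in> A \<longleftrightarrow> w' \<in> A"
  unfolding dep_def by blast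

lemma dep_mono: "dep e A \<Longrightarrow> e \<subseteq> e' \<Longrightarrow> dep e' A"
  unfolding dep_def by blast

lemma dep_Inter: "(\<And>l. l \<in> L \<Longrightarrow> dep e (A l)) \<Longrightarrow> dep e {w. \<forall>l\<in>L. w \<in> A l}"
  unfolding dep_def by blast

lemma dep_Int: "dep e A \<Longrightarrow> dep e B \<Longrightarrow> dep e (A \<inter> B)"
  unfolding dep_def by blast

lemma dep_UNIV: "dep e UNIV"
  unfolding dep_def by blast

lemma mix_in: "w \<in> \<Omega> \<Longrightarrow> z \<in> \<Omega> \<Longrightarrow> mix e w z \<in> \<Omega>"
  by (auto simp: \<Omega>_def mix_def PiE_iff extensional_def)

lemma mix_dep_iff:
  assumes "w \<in> \<Omega>" "z \<in> \<Omega>"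
  shows "dep e A \<Longrightarrow> mix e w z \<in> A \<longleftrightarrow> w \<in> A" "dep (D - e) B \<Longrightarrow> mix e w z \<in> B \<longleftrightarrow> z \<in> B"
  using depD[OF _ mix_in[OF assms] assms(1), of e A e] depD[OF _ mix_in[OF assms] assms(2), of "D - e" B e]
  by (simp_all add: mix_def)

lemma dep_mix:
  assumes "dep s A" "z \<in> \<Omega>" shows "dep (s \<inter> e) {w \<in> \<Omega>. mix e w z \<in> A}"
proof (rule depI)
  fix w w' assume w: "w \<in> \<Omega>" "w' \<in> \<Omega>" and eq: "\<And>i. i \<in> s \<inter> e \<Longrightarrow> w i = w' i"
    and "w \<in> {w \<in> \<Omega>. mix e w z \<in> A}"
  then show "w' \<in> {w \<in> \<Omega>. mix e w z \<in> A}"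
    using depD[OF assms(1) mix_in[OF w(1) assms(2)] mix_in[OF w(2) assms(2)], of e e]
    by (auto simp: mix_def)
qed

text \<open>Resampling the coordinates outside \<open>e\<close> preserves the uniform distribution.  The reason is that
  exchanging these coordinates between two points is an involution of \<open>\<Omega> \<times> \<Omega>\<close>.\<close>

lemma sum_mix:
  fixes \<phi> :: "(nat \<Rightarrow> 'a) \<Rightarrow> real"
  shows "(\<Sum>z\<in>\<Omega>. \<Sum>w\<in>\<Omega>. \<phi> (mix e w z)) = card \<Omega> * (\<Sum>w\<in>\<Omega>. \<phi> w)"
proof -
  have inv: "mix e (mix e w z) (mix e z w) = w" for w z :: "nat \<Rightarrow> 'a"
    by (auto simp: mix_def)
  have "(\<Sum>z\<in>\<Omega>. \<Sum>w\<in>\<Omega>. \<phi> (mix e w z)) = (\<Sum>(z, w)\<in>\<Omega> \<times> \<Omega>. \<phi> (mix e w z))"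
    by (rule sum.cartesian_product)
  also have "\<dots> = (\<Sum>(z, w)\<in>\<Omega> \<times> \<Omega>. \<phi> w)"
    by (rule sum.reindex_bij_witness[where i = "\<lambda>(z, w). (mix e z w, mix e w z)"
          and j = "\<lambda>(z, w). (mix e z w, mix e w z)"])
      (auto simp: inv mix_in)
  also have "\<dots> = card \<Omega> * (\<Sum>w\<in>\<Omega>. \<phi> w)"
    by (simp flip: sum.cartesian_product)
  finally show ?thesis .
qed

lemma card_eq_sum: "real (card {w\<in>\<Omega>. P w}) = (\<Sum>w\<in>\<Omega>. of_bool (P w))"
  using sum_indicator_card[OF fin, of "{w. P w}"] by (simp add: Int_def)

text \<open>Disjoint sets of coordinates are independent.\<close>

lemma indep:
  assumes A: "dep e A" and B: "dep (D - e) B"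
  shows "real (card {w\<in>\<Omega>. w \<in> A \<and> w \<in> B}) * card \<Omega> = real (card {w\<in>\<Omega>. w \<in> A}) * card {w\<in>\<Omega>. w \<in> B}"
proof -
  have A': "mix e w z \<in> A \<longleftrightarrow> w \<in> A" and B': "mix e w z \<in> B \<longleftrightarrow> z \<in> B" if "w \<in> \<Omega>" "z \<in> \<Omega>" for w z
    using mix_dep_iff[OF that] A B by auto
  have "real (card {w\<in>\<Omega>. w \<in> A \<and> w \<in> B}) * card \<Omega> = (\<Sum>z\<in>\<Omega>. \<Sum>w\<in>\<Omega>. of_bool (mix e w z \<in> A \<and> mix e w z \<in> B))"
    unfolding card_eq_sum sum_mix[of "\<lambda>w. of_bool (w \<in> A \<and> w \<in> B)"] by simp
  also have "\<dots> = (\<Sum>z\<in>\<Omega>. \<Sum>w\<in>\<Omega>. of_bool (w \<in> A) * of_bool (z \<in> B))"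
    by (intro sum.cong refl) (simp add: A' B')
  also have "\<dots> = real (card {w\<in>\<Omega>. w \<in> A}) * card {w\<in>\<Omega>. w \<in> B}"
    unfolding card_eq_sum sum_product by (rule sum.swap)
  finally show ?thesis .
qed

text \<open>A bound for correlations with sets on the coordinates in \<open>e\<close> also bounds the correlations with
  sets that involve further coordinates: fix these coordinates and average.  The set \<open>Z\<close> records that
  only some of the fibres contribute.\<close>

lemma fibre_bound:
  fixes \<kappa> :: real
  assumes \<psi>: "\<And>w w'. w \<in> \<Omega> \<Longrightarrow> w' \<in> \<Omega> \<Longrightarrow> (\<And>i. i \<in> e \<Longrightarrow> w i = w' i) \<Longrightarrow> \<psi> w = \<psi> w'"
    and bound: "\<And>A'. (\<And>j. j \<in> J \<Longrightarrow> dep (s j \<inter> e) (A' j)) \<Longrightarrow>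
                 \<bar>\<Sum>w\<in>\<Omega>. \<psi> w * of_bool (\<forall>j\<in>J. w \<in> A' j)\<bar> \<le> \<kappa>"
    and A: "\<And>j. j \<in> J \<Longrightarrow> dep (s j) (A j)" and Z: "dep (D - e) Z"
  shows "\<bar>\<Sum>w\<in>\<Omega>. \<psi> w * of_bool ((\<forall>j\<in>J. w \<in> A j) \<and> w \<in> Z)\<bar> * card \<Omega> \<le> \<kappa> * card {w\<in>\<Omega>. w \<in> Z}"
proof -
  have Z': "mix e w z \<in> Z \<longleftrightarrow> z \<in> Z" and \<psi>': "\<psi> (mix e w z) = \<psi> w" if "w \<in> \<Omega>" "z \<in> \<Omega>" for w z
    using mix_dep_iff(2)[OF that Z] \<psi>[OF mix_in[OF that] that(1), of e] by (simp_all add: mix_def)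
  let ?S = "\<lambda>z. \<Sum>w\<in>\<Omega>. \<psi> w * of_bool (\<forall>j\<in>J. w \<in> {w\<in>\<Omega>. mix e w z \<in> A j})"
  have "(\<Sum>w\<in>\<Omega>. \<psi> w * of_bool ((\<forall>j\<in>J. w \<in> A j) \<and> w \<in> Z)) * card \<Omega>
     = (\<Sum>z\<in>\<Omega>. \<Sum>w\<in>\<Omega>. \<psi> (mix e w z) * of_bool ((\<forall>j\<in>J. mix e w z \<in> A j) \<and> mix e w z \<in> Z))"
    using sum_mix[of "\<lambda>w. \<psi> w * of_bool ((\<forall>j\<in>J. w \<in> A j) \<and> w \<in> Z)" e] by simp
  also have "\<dots> = (\<Sum>z\<in>\<Omega>. of_bool (z \<in> Z) * ?S z)"
    unfolding sum_distrib_left by (intro sum.cong refl) (auto simp: Z' \<psi>')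
  finally have "(\<Sum>w\<in>\<Omega>. \<psi> w * of_bool ((\<forall>j\<in>J. w \<in> A j) \<and> w \<in> Z)) * card \<Omega>
     = (\<Sum>z\<in>\<Omega>. of_bool (z \<in> Z) * ?S z)" .
  from arg_cong[OF this, of abs]
  have eq: "\<bar>\<Sum>w\<in>\<Omega>. \<psi> w * of_bool ((\<forall>j\<in>J. w \<in> A j) \<and> w \<in> Z)\<bar> * card \<Omega>
     = \<bar>\<Sum>z\<in>\<Omega>. of_bool (z \<in> Z) * ?S z\<bar>"
    by (simp only: abs_mult abs_of_nat)
  have "\<bar>\<Sum>z\<in>\<Omega>. of_bool (z \<in> Z) * ?S z\<bar> \<le> (\<Sum>z\<in>\<Omega>. \<bar>of_bool (z \<in> Z) * ?S z\<bar>)"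
    by (rule sum_abs)
  also have "\<dots> \<le> (\<Sum>z\<in>\<Omega>. of_bool (z \<in> Z) * \<kappa>)"
  proof (rule sum_mono)
    fix z assume z: "z \<in> \<Omega>"
    have "\<bar>?S z\<bar> \<le> \<kappa>" using A z by (intro bound dep_mix)
    then show "\<bar>of_bool (z \<in> Z) * ?S z\<bar> \<le> of_bool (z \<in> Z) * \<kappa>" by auto
  qed
  also have "\<dots> = \<kappa> * card {w\<in>\<Omega>. w \<in> Z}"
    unfolding card_eq_sum by (simp add: sum_distrib_left mult.commute)
  finally show ?thesis unfolding eq .
qed

text \<open>Moving coordinate \<open>k\<close> spreads the points of \<open>F \<inter> B\<close> over disjoint fibres that stay inside \<open>B\<close>.  This
  is how a bound on the measure of \<open>B\<close> says something about \<open>F\<close>, whose own measure tends to \<open>0\<close>.\<close>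

lemma card_Int_determined:
  assumes F: "F \<subseteq> \<Omega>" and k: "k \<in> D"
    and det: "\<And>w w'. w \<in> F \<Longrightarrow> w' \<in> F \<Longrightarrow> (\<And>i. i \<in> D - {k} \<Longrightarrow> w i = w' i) \<Longrightarrow> w = w'"
    and B: "dep (D - {k}) B"
  shows "card (F \<inter> B) * card X \<le> card {w\<in>\<Omega>. w \<in> B}"
proof -
  let ?g = "\<lambda>(w, x). w(k := x)"
  have "inj_on ?g ((F \<inter> B) \<times> X)"
  proof (rule inj_onI, clarify)
    fix w x w' x' assume w: "w \<in> F" "w' \<in> F" and eq: "w(k := x) = w'(k := x')"
    have "w i = w' i" if "i \<in> D - {k}" for i
      using fun_cong[OF eq, of i] that by simp
    then have "w = w'" using det w by blast
    moreover have "x = x'" using fun_cong[OF eq, of k] by simp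
    ultimately show "w = w' \<and> x = x'" ..
  qed
  moreover have "?g ` ((F \<inter> B) \<times> X) \<subseteq> {w\<in>\<Omega>. w \<in> B}"
  proof clarify
    fix w x assume w: "w \<in> F" "w \<in> B" and x: "x \<in> X"
    have "w \<in> \<Omega>" using w F by blast
    then have u: "w(k := x) \<in> \<Omega>" using x k by (auto simp: \<Omega>_def PiE_iff extensional_def)
    have "w \<in> B \<longleftrightarrow> w(k := x) \<in> B" using B \<open>w \<in> \<Omega>\<close> u by (rule depD) auto
    then show "w(k := x) \<in> \<Omega> \<and> w(k := x) \<in> B" using u w by blast
  qed
  ultimately have "card ((F \<inter> B) \<times> X) \<le> card {w\<in>\<Omega>. w \<in> B}"
    using fin by (intro card_inj_on_le) auto
  then show ?thesis by (simp add: card_cartesian_product)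
qed

section \<open>Counting in a regular box\<close>

text \<open>The box is cut out by sets \<open>J i\<close> on single coordinates, and for a pair \<open>e\<close> of coordinates \<open>U e\<close>
  plays the part of a bipartite graph; \<open>C e\<close> is the part of the cube seen by this graph.  Regularity is
  meant in the cut norm, relative to the measure of \<open>C e\<close>.\<close>

definition regular :: "nat set \<Rightarrow> real \<Rightarrow> (nat \<Rightarrow> 'a) set \<Rightarrow> (nat \<Rightarrow> 'a) set \<Rightarrow> bool" where
  "regular e \<epsilon> C U \<longleftrightarrow> (\<forall>A. (\<forall>l\<in>e. dep {l} (A l)) \<longrightarrow>
     \<bar>\<Sum>w\<in>\<Omega>. of_bool (w \<in> C) * (of_bool (w \<in> U) - card (C \<inter> U) / card C) * of_bool (\<forall>l\<in>e. w \<in> A l)\<bar>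
       \<le> \<epsilon> * real (card C))"

text \<open>Regularity is a statement about sets on the two coordinates of \<open>e\<close> separately.  In a count over the
  whole box, the constraints that involve only one of these coordinates become such sets once the
  remaining coordinates are fixed.\<close>

lemma regular_count_step:
  fixes \<epsilon> :: real
  assumes J: "\<And>i. i \<in> D \<Longrightarrow> dep {i} (J i)" and e: "e \<subseteq> D"
    and C: "C = {w\<in>\<Omega>. \<forall>i\<in>e. w \<in> J i}" and Q: "Q = {w\<in>\<Omega>. \<forall>i\<in>D. w \<in> J i}"
    and U: "dep e U" and reg: "regular e \<epsilon> C U"
    and A: "\<And>l. l \<in> e \<Longrightarrow> dep (D - (e - {l})) (A l)"
  shows "\<bar>real (card {w\<in>Q. (\<forall>l\<in>e. w \<in> A l) \<and> w \<in> U}) - card (C \<inter> U) / card C * card {w\<in>Q. \<forall>l\<in>e. w \<in> A l}\<bar>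
          \<le> \<epsilon> * card Q"
proof (cases "\<Omega> = {}")
  case True
  then show ?thesis by (simp add: Q)
next
  case False
  then have pos: "card \<Omega> > 0" using fin by (simp add: card_gt_0_iff)
  define d where "d = card (C \<inter> U) / card C"
  define \<psi> where "\<psi> w = of_bool (w \<in> C) * (of_bool (w \<in> U) - d)" for w
  define Z where "Z = {w. \<forall>i\<in>D - e. w \<in> J i}"
  have depC: "dep e {w. \<forall>i\<in>e. w \<in> J i}" using J e by (intro dep_Inter dep_mono[OF J]) auto
  have depZ: "dep (D - e) Z" unfolding Z_def by (intro dep_Inter dep_mono[OF J]) auto
  have QCZ: "Q = {w\<in>\<Omega>. w \<in> {w. \<forall>i\<in>e. w \<in> J i} \<and> w \<in> Z}" using e by (auto simp: Q Z_def)
  have main: "\<bar>\<Sum>w\<in>\<Omega>. \<psi> w * of_bool ((\<forall>l\<in>e. w \<in> A l) \<and> w \<in> Z)\<bar> * card \<Omega> \<le> (\<epsilon> * card C) * card {w\<in>\<Omega>. w \<in> Z}"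
  proof (rule fibre_bound[where e=e and s = "\<lambda>l. D - (e - {l})"])
    fix w w' assume w: "w \<in> \<Omega>" "w' \<in> \<Omega>" "\<And>i. i \<in> e \<Longrightarrow> w i = w' i"
    have "w \<in> U \<longleftrightarrow> w' \<in> U" "w \<in> C \<longleftrightarrow> w' \<in> C"
      using depD[OF U w] depD[OF depC w] w(1,2) by (auto simp: C)
    then show "\<psi> w = \<psi> w'" by (simp add: \<psi>_def)
  next
    fix A' assume "\<And>l. l \<in> e \<Longrightarrow> dep ((D - (e - {l})) \<inter> e) (A' l)"
    moreover have "(D - (e - {l})) \<inter> e = {l}" if "l \<in> e" for l using that e by blast
    ultimately show "\<bar>\<Sum>w\<in>\<Omega>. \<psi> w * of_bool (\<forall>l\<in>e. w \<in> A' l)\<bar> \<le> \<epsilon> * card C"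
      using reg unfolding regular_def \<psi>_def d_def by simp
  qed (use A depZ in auto)
  have "real (card C) * card {w\<in>\<Omega>. w \<in> Z} = real (card Q) * card \<Omega>"
    using indep[OF depC depZ] unfolding QCZ C by simp
  then have "\<bar>\<Sum>w\<in>\<Omega>. \<psi> w * of_bool ((\<forall>l\<in>e. w \<in> A l) \<and> w \<in> Z)\<bar> * card \<Omega> \<le> (\<epsilon> * card Q) * card \<Omega>"
    using main by (simp add: mult.assoc)
  then have "\<bar>\<Sum>w\<in>\<Omega>. \<psi> w * of_bool ((\<forall>l\<in>e. w \<in> A l) \<and> w \<in> Z)\<bar> \<le> \<epsilon> * card Q"
    using pos by simp
  moreover have "(\<Sum>w\<in>\<Omega>. \<psi> w * of_bool ((\<forall>l\<in>e. w \<in> A l) \<and> w \<in> Z))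
      = (\<Sum>w\<in>\<Omega>. of_bool (w \<in> Q \<and> (\<forall>l\<in>e. w \<in> A l) \<and> w \<in> U)) - d * (\<Sum>w\<in>\<Omega>. of_bool (w \<in> Q \<and> (\<forall>l\<in>e. w \<in> A l)))"
    unfolding sum_distrib_left sum_subtractf[symmetric]
    by (intro sum.cong refl) (auto simp: \<psi>_def QCZ C)
  moreover have "{w\<in>\<Omega>. w \<in> Q \<and> P w} = {w\<in>Q. P w}" for P by (auto simp: Q)
  ultimately show ?thesis by (simp add: d_def flip: card_eq_sum)
qed

text \<open>The counting lemma, with a weight \<open>W\<close>.  The edges in \<open>E\<close> are replaced by their densities one by one.
  At each step every other constraint avoids one of the two ends of the edge; for \<open>W\<close> this is the
  last assumption, which leaves room for a \<open>W\<close> that depends jointly on three coordinates.\<close>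

lemma regular_count:
  fixes \<epsilon> :: real and d :: "nat set \<Rightarrow> real"
  assumes J: "\<And>i. i \<in> D \<Longrightarrow> dep {i} (J i)"
    and C: "\<And>e. C e = {w\<in>\<Omega>. \<forall>i\<in>e. w \<in> J i}" and Q: "Q = {w\<in>\<Omega>. \<forall>i\<in>D. w \<in> J i}"
    and d: "\<And>e. d e = card (C e \<inter> U e) / card (C e)" and "finite E"
    and E: "\<And>e. e \<in> E \<Longrightarrow> e \<subseteq> D \<and> card e = 2 \<and> dep e (U e) \<and> regular e \<epsilon> (C e) (U e)"
    and W: "\<And>e. e \<in> E \<Longrightarrow> \<exists>l\<in>e. dep (D - {l}) W"
  shows "\<bar>real (card {w\<in>Q. w \<in> W \<and> (\<forall>e\<in>E. w \<in> U e)}) - (\<Prod>e\<in>E. d e) * card {w\<in>Q. w \<in> W}\<bar>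
          \<le> card E * \<epsilon> * card Q"
  using \<open>finite E\<close> E W
proof (induction E)
  case empty
  then show ?case by simp
next
  case (insert e E)
  note [simp] = insert.hyps
  let ?N = "\<lambda>E. real (card {w\<in>Q. w \<in> W \<and> (\<forall>e\<in>E. w \<in> U e)})"
  have e: "e \<subseteq> D" "card e = 2" "dep e (U e)" "regular e \<epsilon> (C e) (U e)" using insert.prems(1) by auto
  obtain l where l: "l \<in> e" "dep (D - {l}) W" using insert.prems(2) by blast
  obtain l' where l': "e = {l, l'}" "l \<noteq> l'" 
    using e(2) l(1) by (auto simp: card_2_iff insert_commute)
  \<comment> \<open>An edge other than \<open>e\<close> misses \<open>l\<close> or \<open>l'\<close>, so every constraint can be charged to one end of \<open>e\<close>.\<close>
  define A where "A i = (if i = l then {w. \<forall>e'\<in>{e'\<in>E. l \<in> e'}. w \<in> U e'}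
                          else W \<inter> {w. \<forall>e'\<in>{e'\<in>E. l \<notin> e'}. w \<in> U e'})" for i
  have "dep (D - {l'}) (A l)"
  proof -
    have "dep (D - {l'}) (U e')" if "e' \<in> E" "l \<in> e'" for e'
    proof -
      have "e' \<subseteq> D" "card e' = 2" "dep e' (U e')" using insert.prems(1) that by auto
      moreover have "l' \<notin> e'"
      proof
        assume "l' \<in> e'"
        then have "e \<subseteq> e'" using that l' by blast
        then have "e = e'" using \<open>card e' = 2\<close> e(2) by (intro card_subset_eq) (auto intro: card_ge_0_finite)
        then show False using that insert.hyps by blast
      qed
      ultimately show ?thesis by (auto intro: dep_mono)
    qed
    then show ?thesis
      using dep_Inter[of "{e'\<in>E. l \<in> e'}" "D - {l'}" U] by (simp add: A_def)
  qed
  moreover have "dep (D - {l}) (A l')"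
  proof -
    have "dep (D - {l}) (U e')" if "e' \<in> E" "l \<notin> e'" for e'
      using insert.prems(1)[of e'] that by (auto intro: dep_mono)
    then show ?thesis
      using dep_Int[OF l(2) dep_Inter[of "{e'\<in>E. l \<notin> e'}" "D - {l}" U]] l' by (simp add: A_def)
  qed
  ultimately have A: "dep (D - (e - {i})) (A i)" if "i \<in> e" for i
    using that l' by (auto simp: insert_Diff_if)
  have sets: "{w\<in>Q. (\<forall>i\<in>e. w \<in> A i)} = {w\<in>Q. w \<in> W \<and> (\<forall>e\<in>E. w \<in> U e)}"
    "{w\<in>Q. (\<forall>i\<in>e. w \<in> A i) \<and> w \<in> U e} = {w\<in>Q. w \<in> W \<and> (\<forall>e\<in>insert e E. w \<in> U e)}"
    using l' by (auto simp: A_def)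
  have step: "\<bar>?N (insert e E) - d e * ?N E\<bar> \<le> \<epsilon> * card Q"
    using regular_count_step[OF J e(1) C Q e(3,4) A] by (simp add: sets d)
  have IH: "\<bar>?N E - (\<Prod>e\<in>E. d e) * card {w\<in>Q. w \<in> W}\<bar> \<le> card E * \<epsilon> * card Q"
    using insert by auto
  have d01: "0 \<le> d e" "d e \<le> 1"
    using card_mono[of "C e" "C e \<inter> U e"] fin by (auto simp: d C divide_le_eq)
  have "\<bar>d e * ?N E - d e * ((\<Prod>e\<in>E. d e) * card {w\<in>Q. w \<in> W})\<bar> = d e * \<bar>?N E - (\<Prod>e\<in>E. d e) * card {w\<in>Q. w \<in> W}\<bar>"
    using d01 by (simp add: abs_mult flip: right_diff_distrib)
  also have "\<dots> \<le> \<bar>?N E - (\<Prod>e\<in>E. d e) * card {w\<in>Q. w \<in> W}\<bar>"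
    using d01 by (intro mult_left_le_one_le) auto
  finally have "\<bar>?N (insert e E) - d e * ((\<Prod>e\<in>E. d e) * card {w\<in>Q. w \<in> W})\<bar> \<le> \<epsilon> * card Q + card E * \<epsilon> * card Q"
    using step IH by linarith
  then show ?case by (simp add: algebra_simps)
qed

end

section \<open>Regularising by refinement\<close>

text \<open>A state is a finite collection of pairs \<open>(e, A)\<close>, where \<open>A\<close> depends on the coordinates in \<open>e\<close>
  only.  The declared support \<open>e\<close> is kept because a set may depend on fewer coordinates.\<close>

definition fam :: "(nat set \<times> 'o set) set \<Rightarrow> nat set \<Rightarrow> 'o set set" where
  "fam \<A> e = {A. \<exists>e'\<subseteq>e. (e', A) \<in> \<A>}"

definition sing :: "(nat set \<times> 'o set) set \<Rightarrow> nat set \<Rightarrow> 'o set set" where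
  "sing \<A> e = {A. \<exists>i\<in>e. ({i}, A) \<in> \<A>}"

definition pairs :: "(nat set \<times> 'o set) set \<Rightarrow> nat set \<Rightarrow> 'o set set" where
  "pairs \<A> e = {A. (e, A) \<in> \<A>}"

lemma finite_families:
  assumes "finite \<A>"
  shows "finite (fam \<A> e)" "card (fam \<A> e) \<le> card \<A>" "finite (sing \<A> e)" "card (sing \<A> e) \<le> card \<A>"
    "finite (pairs \<A> e)" "card (pairs \<A> e) \<le> card \<A>"
proof -
  have *: "finite \<B> \<and> card \<B> \<le> card \<A>" if "\<B> \<subseteq> snd ` \<A>" for \<B>
    using finite_subset[OF that] card_mono[OF _ that] card_image_le[OF assms, of snd] assms by auto
  have "fam \<A> e \<subseteq> snd ` \<A>" "sing \<A> e \<subseteq> snd ` \<A>" "pairs \<A> e \<subseteq> snd ` \<A>"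
    unfolding fam_def sing_def pairs_def by (auto intro: rev_image_eqI)
  then show "finite (fam \<A> e)" "card (fam \<A> e) \<le> card \<A>" "finite (sing \<A> e)" "card (sing \<A> e) \<le> card \<A>"
    "finite (pairs \<A> e)" "card (pairs \<A> e) \<le> card \<A>"
    using *[of "fam \<A> e"] *[of "sing \<A> e"] *[of "pairs \<A> e"] by simp_all
qed

lemma families_mono:
  assumes "\<A> \<subseteq> \<B>" shows "fam \<A> e \<subseteq> fam \<B> e" "sing \<A> e \<subseteq> sing \<B> e"
  using assms by (auto simp: fam_def sing_def)

context cube
begin

definition valid :: "(nat set \<times> (nat \<Rightarrow> 'a) set) set \<Rightarrow> bool" where
  "valid \<A> \<longleftrightarrow> finite \<A> \<and> (\<forall>(e, A)\<in>\<A>. e \<subseteq> D \<and> (card e = 1 \<or> card e = 2) \<and> dep e A)"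

lemma dep_atom: "(\<And>A. A \<in> \<C> \<Longrightarrow> dep e A) \<Longrightarrow> dep e (atom \<Omega> \<C> w)"
  by (rule depI) (auto simp: atom_def dest: depD)

definition irregular :: "nat set \<Rightarrow> real \<Rightarrow> (nat set \<times> (nat \<Rightarrow> 'a) set) set \<Rightarrow> (nat \<Rightarrow> 'a) set \<Rightarrow> (nat \<Rightarrow> 'a) set" where
  "irregular e \<epsilon> \<A> U = {w\<in>\<Omega>. \<not> regular e \<epsilon> (atom \<Omega> (sing \<A> e) w) U}"

text \<open>The witnesses of irregularity for the individual cells, with the right signs, add up to one bounded
  function that correlates with \<open>U\<close>.  All of them are added at once, which is why the bound on the
  number of new sets is exponential.\<close>

lemma irregular_increment:
  fixes \<epsilon> \<gamma> :: real
  assumes v: "valid \<A>" and e: "e \<subseteq> D" "card e = 2" and \<epsilon>: "\<epsilon> > 0" and \<gamma>: "\<gamma> > 0"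
    and irr: "card (irregular e \<epsilon> \<A> U) > \<gamma> * card \<Omega>"
  shows "\<exists>\<A>'. valid \<A>' \<and> \<A> \<subseteq> \<A>' \<and> (\<forall>(e', A)\<in>\<A>' - \<A>. card e' = 1) \<and> card \<A>' \<le> card \<A> + 2 * 2 ^ card \<A> \<and>
           energy \<Omega> (sing \<A>' e) (\<lambda>w. of_bool (w \<in> U)) \<ge> energy \<Omega> (sing \<A> e) (\<lambda>w. of_bool (w \<in> U)) + (\<epsilon> * \<gamma>)\<^sup>2 * card \<Omega>"
proof -
  let ?f = "\<lambda>w. of_bool (w \<in> U) :: real"
  let ?a = "atom \<Omega> (sing \<A> e)"
  have finA: "finite \<A>" using v by (simp add: valid_def)
  define I where "I = {C \<in> ?a ` \<Omega>. \<not> regular e \<epsilon> C U}"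
  have finI: "finite I" unfolding I_def using fin by simp
  have cardI: "card I \<le> 2 ^ card \<A>"
  proof -
    have "card I \<le> card (?a ` \<Omega>)" unfolding I_def using fin by (intro card_mono) auto
    also have "\<dots> \<le> 2 ^ card (sing \<A> e)" by (rule card_atoms_le(2)[OF finite_families(3)[OF finA]])
    also have "\<dots> \<le> 2 ^ card \<A>" using finite_families(4)[OF finA] by (intro power_increasing) auto
    finally show ?thesis .
  qed
  have fin_e: "finite e" using e(2) by (simp add: card_ge_0_finite)
  define \<sigma> where "\<sigma> C A = (\<Sum>w\<in>\<Omega>. of_bool (w \<in> C) * (of_bool (w \<in> U) - card (C \<inter> U) / card C) * of_bool (\<forall>l\<in>e. w \<in> A l))"
    for C and A :: "nat \<Rightarrow> (nat \<Rightarrow> 'a) set"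
  have "\<forall>C\<in>I. \<exists>A. (\<forall>l\<in>e. dep {l} (A l)) \<and> \<bar>\<sigma> C A\<bar> > \<epsilon> * card C"
    unfolding I_def regular_def \<sigma>_def by (auto simp: not_le)
  then obtain A where A: "\<And>C l. C \<in> I \<Longrightarrow> l \<in> e \<Longrightarrow> dep {l} (A C l)" "\<And>C. C \<in> I \<Longrightarrow> \<bar>\<sigma> C (A C)\<bar> > \<epsilon> * card C"
    by metis
  define N where "N = (\<lambda>(C, l). ({l}, A C l)) ` (I \<times> e)"
  define \<A>' where "\<A>' = \<A> \<union> N"
  have finN: "finite N" and cardN: "card N \<le> 2 * 2 ^ card \<A>"
  proof -
    show "finite N" unfolding N_def using finI fin_e by simp
    have "card N \<le> card (I \<times> e)" unfolding N_def using finI fin_e by (intro card_image_le) simp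
    also have "\<dots> \<le> 2 * 2 ^ card \<A>" using cardI e(2) by (simp add: card_cartesian_product)
    finally show "card N \<le> 2 * 2 ^ card \<A>" .
  qed
  have valid': "valid \<A>'"
    using v finN e(1) A(1) unfolding valid_def \<A>'_def N_def by auto
  have card': "card \<A>' \<le> card \<A> + 2 * 2 ^ card \<A>"
    using card_Un_le[of \<A> N] cardN by (simp add: \<A>'_def)
  have mem_iff: "w \<in> C \<longleftrightarrow> C = ?a w" if C: "C \<in> I" and w: "w \<in> \<Omega>" for C w
  proof -
    obtain v where v: "C = ?a v" using C by (auto simp: I_def)
    show ?thesis unfolding v using atom_eq[of w \<Omega> "sing \<A> e" v] atom_self[OF w] by metis
  qed
  \<comment> \<open>All signed witnesses at once: on each irregular cell, the indicator of its own witness.\<close>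
  define g where "g w = (if ?a w \<in> I then sgn (\<sigma> (?a w) (A (?a w))) * of_bool (\<forall>l\<in>e. w \<in> A (?a w) l) else 0)" for w
  have gsum: "g w = (\<Sum>C\<in>I. sgn (\<sigma> C (A C)) * (of_bool (w \<in> C) * of_bool (\<forall>l\<in>e. w \<in> A C l)))" if w: "w \<in> \<Omega>" for w
  proof -
    have "(\<Sum>C\<in>I. sgn (\<sigma> C (A C)) * (of_bool (w \<in> C) * of_bool (\<forall>l\<in>e. w \<in> A C l)))
        = (\<Sum>C\<in>I. if C = ?a w then sgn (\<sigma> C (A C)) * of_bool (\<forall>l\<in>e. w \<in> A C l) else 0)"
      by (intro sum.cong refl) (simp add: mem_iff[OF _ w])
    then show ?thesis using finI by (simp add: g_def)
  qed
  have gmeas: "g w' = g w" if w: "w \<in> \<Omega>" and w': "w' \<in> atom \<Omega> (sing \<A>' e) w" for w w'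
  proof -
    have "?a w' = ?a w"
      using w' atom_mono[OF families_mono(2)[of \<A> \<A>' e]] by (intro atom_eq) (auto simp: \<A>'_def)
    moreover have "w' \<in> A C l \<longleftrightarrow> w \<in> A C l" if "C \<in> I" "l \<in> e" for C l
    proof -
      have "A C l \<in> sing \<A>' e" using that unfolding sing_def \<A>'_def N_def by auto
      then show ?thesis using w' by (simp add: atom_def)
    qed
    ultimately show ?thesis by (simp add: g_def)
  qed
  have g1: "\<bar>g w\<bar> \<le> 1" for w by (simp add: g_def abs_mult sgn_if)
  have "(\<Sum>w\<in>\<Omega>. (?f w - cexp \<Omega> (sing \<A> e) ?f w) * g w)
      = (\<Sum>w\<in>\<Omega>. \<Sum>C\<in>I. sgn (\<sigma> C (A C)) * (of_bool (w \<in> C) * (of_bool (w \<in> U) - card (C \<inter> U) / card C) * of_bool (\<forall>l\<in>e. w \<in> A C l)))"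
  proof (intro sum.cong refl)
    fix w assume w: "w \<in> \<Omega>"
    have "cexp \<Omega> (sing \<A> e) ?f w = card (C \<inter> U) / card C" if "C \<in> I" "w \<in> C" for C
    proof -
      have "C = ?a w" using that mem_iff w by blast
      then show ?thesis by (simp add: cexp_indicator[OF fin])
    qed
    then show "(?f w - cexp \<Omega> (sing \<A> e) ?f w) * g w = (\<Sum>C\<in>I. sgn (\<sigma> C (A C)) * (of_bool (w \<in> C) * (of_bool (w \<in> U) - card (C \<inter> U) / card C) * of_bool (\<forall>l\<in>e. w \<in> A C l)))"
      unfolding gsum[OF w] sum_distrib_left by (intro sum.cong refl) auto
  qed
  also have "\<dots> = (\<Sum>C\<in>I. sgn (\<sigma> C (A C)) * \<sigma> C (A C))"
    unfolding \<sigma>_def sum_distrib_left by (rule sum.swap)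
  also have "\<dots> = (\<Sum>C\<in>I. \<bar>\<sigma> C (A C)\<bar>)" by (intro sum.cong refl) (simp add: abs_sgn mult.commute)
  finally have eq: "(\<Sum>w\<in>\<Omega>. (?f w - cexp \<Omega> (sing \<A> e) ?f w) * g w) = (\<Sum>C\<in>I. \<bar>\<sigma> C (A C)\<bar>)" .
  have sub: "irregular e \<epsilon> \<A> U \<subseteq> (\<Union>C\<in>I. C)"
    using atom_self[of _ \<Omega> "sing \<A> e"] by (auto simp: irregular_def I_def)
  have finU: "finite (\<Union>C\<in>I. C)" using finI finite_atom[OF fin] by (auto simp: I_def)
  have "card (irregular e \<epsilon> \<A> U) \<le> (\<Sum>C\<in>I. card C)"
    using card_mono[OF finU sub] card_UN_le[OF finI, of "\<lambda>C. C"] by linarith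
  then have "real (card (irregular e \<epsilon> \<A> U)) \<le> (\<Sum>C\<in>I. real (card C))"
    by (simp flip: of_nat_sum)
  then have "\<epsilon> * (\<gamma> * card \<Omega>) \<le> \<epsilon> * (\<Sum>C\<in>I. real (card C))"
    using irr \<epsilon> by (intro mult_left_mono) auto
  also have "\<dots> \<le> (\<Sum>C\<in>I. \<bar>\<sigma> C (A C)\<bar>)"
    unfolding sum_distrib_left using A(2) by (intro sum_mono) (simp add: less_imp_le)
  finally have big: "\<bar>\<Sum>w\<in>\<Omega>. (?f w - cexp \<Omega> (sing \<A> e) ?f w) * g w\<bar> \<ge> \<epsilon> * \<gamma> * card \<Omega>"
    unfolding eq by (simp add: mult.assoc)
  have "energy \<Omega> (sing \<A>' e) ?f \<ge> energy \<Omega> (sing \<A> e) ?f + (\<epsilon> * \<gamma>)\<^sup>2 * card \<Omega>"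
    using \<epsilon> \<gamma> gmeas g1 big by (intro energy_increment[OF fin families_mono(2)]) (auto simp: \<A>'_def)
  moreover have "\<forall>(e', A)\<in>\<A>' - \<A>. card e' = 1" by (auto simp: \<A>'_def N_def)
  ultimately show ?thesis using valid' card' by (intro exI[of _ \<A>']) (auto simp: \<A>'_def)
qed

text \<open>The cut norm of a 3-graph: a face \<open>E k\<close> minus its average must not correlate with any set of
  triples that is cut out by three graphs on the pairs of coordinates.\<close>

definition uniform_on :: "(nat set \<times> (nat \<Rightarrow> 'a) set) set \<Rightarrow> (nat \<Rightarrow> (nat \<Rightarrow> 'a) set) \<Rightarrow> nat \<Rightarrow> real \<Rightarrow> bool" where
  "uniform_on \<A> E k \<eta> \<longleftrightarrow> (\<forall>A. (\<forall>j\<in>D - {k}. dep (D - {k, j}) (A j)) \<longrightarrow>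
     \<bar>\<Sum>w\<in>\<Omega>. (of_bool (w \<in> E k) - cexp \<Omega> (fam \<A> (D - {k})) (\<lambda>w. of_bool (w \<in> E k)) w) * of_bool (\<forall>j\<in>D - {k}. w \<in> A j)\<bar>
       \<le> \<eta> * real (card \<Omega>))"

lemma uniform_increment:
  fixes \<eta> :: real
  assumes v: "valid \<A>" and k: "k \<in> D" and cD: "card D = 4" and \<eta>: "\<eta> > 0"
    and nu: "\<not> uniform_on \<A> E k \<eta>"
  shows "\<exists>\<A>'. valid \<A>' \<and> \<A> \<subseteq> \<A>' \<and> card \<A>' \<le> card \<A> + 4 \<and>
     energy \<Omega> (fam \<A>' (D - {k})) (\<lambda>w. of_bool (w \<in> E k)) \<ge> energy \<Omega> (fam \<A> (D - {k})) (\<lambda>w. of_bool (w \<in> E k)) + \<eta>\<^sup>2 * card \<Omega>"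
proof -
  obtain A where A: "\<And>j. j \<in> D - {k} \<Longrightarrow> dep (D - {k, j}) (A j)"
    and big: "\<bar>\<Sum>w\<in>\<Omega>. (of_bool (w \<in> E k) - cexp \<Omega> (fam \<A> (D - {k})) (\<lambda>w. of_bool (w \<in> E k)) w) * of_bool (\<forall>j\<in>D - {k}. w \<in> A j)\<bar> > \<eta> * real (card \<Omega>)"
    using nu unfolding uniform_on_def by (auto simp: not_le)
  define N where "N = (\<lambda>j. (D - {k, j}, A j)) ` (D - {k})"
  have "card N \<le> card (D - {k})" unfolding N_def using finD by (intro card_image_le) simp
  also have "\<dots> \<le> 4" using cD card_Diff1_le[of D k] by linarith
  finally have cardN: "card N \<le> 4" .
  have "card (D - {k, j}) = 2" if "j \<in> D - {k}" for j
    using that k cD finD by (subst card_Diff_subset) auto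
  then have "valid (\<A> \<union> N)" using v A finD unfolding valid_def N_def by auto
  moreover have "energy \<Omega> (fam (\<A> \<union> N) (D - {k})) (\<lambda>w. of_bool (w \<in> E k)) \<ge> energy \<Omega> (fam \<A> (D - {k})) (\<lambda>w. of_bool (w \<in> E k)) + \<eta>\<^sup>2 * card \<Omega>"
  proof (rule energy_increment[OF fin families_mono(1), where g = "\<lambda>w. of_bool (\<forall>j\<in>D - {k}. w \<in> A j)"])
    fix w w' assume w: "w \<in> \<Omega>" "w' \<in> atom \<Omega> (fam (\<A> \<union> N) (D - {k})) w"
    have "A j \<in> fam (\<A> \<union> N) (D - {k})" if "j \<in> D - {k}" for j
      using that unfolding fam_def N_def by (intro CollectI exI[of _ "D - {k, j}"]) auto
    then have "w' \<in> A j \<longleftrightarrow> w \<in> A j" if "j \<in> D - {k}" for j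
      using w(2) that unfolding atom_def by blast
    then show "(of_bool (\<forall>j\<in>D - {k}. w' \<in> A j) :: real) = of_bool (\<forall>j\<in>D - {k}. w \<in> A j)" by simp
  qed (use big \<eta> in auto)
  moreover have "card (\<A> \<union> N) \<le> card \<A> + 4" using card_Un_le[of \<A> N] cardN by linarith
  ultimately show ?thesis by (intro exI[of _ "\<A> \<union> N"]) auto
qed

end

section \<open>Strong regularity\<close>

lemma quotient_increment:
  fixes a b d n :: real
  assumes "a + d * n \<le> b" "n > 0" shows "a / n + d \<le> b / n"
  using divide_right_mono[OF assms(1), of n] assms(2) by (simp add: add_divide_distrib)

lemma cell_regularity:
  fixes D :: "nat set" and \<epsilon> \<gamma> :: real
  assumes D: "finite D" and \<epsilon>: "\<epsilon> > 0" and \<gamma>: "\<gamma> > 0"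
  shows "\<exists>M. \<forall>(X :: 'a set) \<U> \<A>. finite X \<and> finite \<U> \<and> card \<U> \<le> L \<and> (\<forall>(e, U)\<in>\<U>. e \<subseteq> D \<and> card e = 2) \<and>
      cube.valid D X \<A> \<and> card \<A> \<le> m \<longrightarrow>
      (\<exists>\<A>'. cube.valid D X \<A>' \<and> \<A> \<subseteq> \<A>' \<and> (\<forall>(e, A)\<in>\<A>' - \<A>. card e = 1) \<and> card \<A>' \<le> M \<and>
        (\<forall>(e, U)\<in>\<U>. card (cube.irregular D X e \<epsilon> \<A>' U) \<le> \<gamma> * card (cube.\<Omega> D X)))"
proof -
  let ?I = "\<lambda>(X :: 'a set, \<U>) \<A>. finite X \<and> finite \<U> \<and> card \<U> \<le> L \<and> (\<forall>(e, U)\<in>\<U>. e \<subseteq> D \<and> card e = 2) \<and> cube.valid D X \<A>"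
  let ?S = "\<lambda>(X :: 'a set) \<U> \<A>. \<Sum>(e, U)\<in>\<U>. energy (cube.\<Omega> D X) (sing \<A> e) (\<lambda>w. of_bool (w \<in> U))"
  let ?\<Phi> = "\<lambda>(X :: 'a set, \<U>) \<A>. ?S X \<U> \<A> / card (cube.\<Omega> D X)"
  let ?R = "\<lambda>\<A> \<A>'. \<A> \<subseteq> \<A>' \<and> (\<forall>(e, A)\<in>\<A>' - \<A>. card e = 1)"
  let ?good = "\<lambda>(X :: 'a set, \<U>) \<A>. \<forall>(e, U)\<in>\<U>. card (cube.irregular D X e \<epsilon> \<A> U) \<le> \<gamma> * card (cube.\<Omega> D X)"
  have "\<exists>M. \<forall>t \<A>. ?I t \<A> \<and> card \<A> \<le> m \<longrightarrow> (\<exists>\<A>'. ?I t \<A>' \<and> ?R \<A> \<A>' \<and> card \<A>' \<le> M \<and> ?good t \<A>')"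
  proof (rule increment_iteration[where \<Phi> = ?\<Phi> and C = L and \<delta> = "(\<epsilon> * \<gamma>)\<^sup>2"])
    show "(\<epsilon> * \<gamma>)\<^sup>2 > 0" using \<epsilon> \<gamma> by simp
  next
    fix t :: "'a set \<times> (nat set \<times> (nat \<Rightarrow> 'a) set) set" and \<A>
    assume I: "?I t \<A>"
    obtain X \<U> where t: "t = (X, \<U>)" by (cases t)
    interpret cube D X using D I t by unfold_locales auto
    show "0 \<le> ?\<Phi> t \<A>" unfolding t energy_def by (auto intro!: divide_nonneg_nonneg sum_nonneg)
    have "?S X \<U> \<A> \<le> (\<Sum>(e, U)\<in>\<U>. real (card \<Omega>))"
      by (intro sum_mono) (auto intro!: energy_le fin)
    also have "\<dots> \<le> L * real (card \<Omega>)" using I t by (auto intro!: mult_right_mono)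
    finally show "?\<Phi> t \<A> \<le> L" unfolding t by (cases "card \<Omega> = 0") (simp_all add: divide_le_eq)
  next
    fix m
    show "\<exists>M. \<forall>t \<A>. ?I t \<A> \<and> card \<A> \<le> m \<and> \<not> ?good t \<A> \<longrightarrow>
        (\<exists>\<A>'. ?I t \<A>' \<and> ?R \<A> \<A>' \<and> card \<A>' \<le> M \<and> ?\<Phi> t \<A>' \<ge> ?\<Phi> t \<A> + (\<epsilon> * \<gamma>)\<^sup>2)"
    proof (rule exI[of _ "m + 2 * 2 ^ m"], intro allI impI, elim conjE)
      fix t \<A> assume I: "?I t \<A>" and m: "card \<A> \<le> m" and bad: "\<not> ?good t \<A>"
      obtain X \<U> where t: "t = (X, \<U>)" by (cases t)
      interpret cube D X using D I t by unfold_locales auto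
      obtain e U where eU: "(e, U) \<in> \<U>" and irr: "card (irregular e \<epsilon> \<A> U) > \<gamma> * card \<Omega>"
        using bad unfolding t by (auto simp: not_le)
      have e: "e \<subseteq> D" "card e = 2" and finU: "finite \<U>" and v: "valid \<A>" using I eU t by auto
      have pos: "card \<Omega> > 0"
      proof (rule ccontr)
        assume "\<not> card \<Omega> > 0"
        then have "\<Omega> = {}" using fin by simp
        then show False using irr by (simp add: irregular_def)
      qed
      obtain \<A>' where A': "valid \<A>'" "\<A> \<subseteq> \<A>'" "\<forall>(e', A)\<in>\<A>' - \<A>. card e' = 1" "card \<A>' \<le> card \<A> + 2 * 2 ^ card \<A>"
        and inc: "energy \<Omega> (sing \<A>' e) (\<lambda>w. of_bool (w \<in> U)) \<ge> energy \<Omega> (sing \<A> e) (\<lambda>w. of_bool (w \<in> U)) + (\<epsilon> * \<gamma>)\<^sup>2 * card \<Omega>"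
        using irregular_increment[OF v e \<epsilon> \<gamma> irr] by blast
      have "?S X \<U> \<A> + (\<epsilon> * \<gamma>)\<^sup>2 * card \<Omega> \<le> ?S X \<U> \<A>'"
      proof -
        have "(\<Sum>(e, U)\<in>\<U> - {(e, U)}. energy \<Omega> (sing \<A> e) (\<lambda>w. of_bool (w \<in> U)))
            \<le> (\<Sum>(e, U)\<in>\<U> - {(e, U)}. energy \<Omega> (sing \<A>' e) (\<lambda>w. of_bool (w \<in> U)))"
          by (intro sum_mono) (auto intro!: energy_mono fin families_mono A')
        then show ?thesis using inc by (simp add: sum.remove[OF finU eU])
      qed
      from quotient_increment[OF this] have "?\<Phi> t \<A>' \<ge> ?\<Phi> t \<A> + (\<epsilon> * \<gamma>)\<^sup>2"
        using pos unfolding t by simp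
      moreover have "card \<A>' \<le> m + 2 * 2 ^ m"
      proof -
        have "(2::nat) ^ card \<A> \<le> 2 ^ m" using m by (intro power_increasing) auto
        then show ?thesis using A'(4) m by linarith
      qed
      ultimately show "\<exists>\<A>'. ?I t \<A>' \<and> ?R \<A> \<A>' \<and> card \<A>' \<le> m + 2 * 2 ^ m \<and> ?\<Phi> t \<A>' \<ge> ?\<Phi> t \<A> + (\<epsilon> * \<gamma>)\<^sup>2" using A' I t by (intro exI[of _ \<A>']) auto
    qed
  next
    show "?R \<A> \<A>" for \<A> by simp
    show "?R \<A> \<A>''" if "?R \<A> \<A>'" "?R \<A>' \<A>''" for \<A> \<A>' \<A>'' using that by blast
  qed
  then obtain M where M: "\<forall>t \<A>. ?I t \<A> \<and> card \<A> \<le> m \<longrightarrow> (\<exists>\<A>'. ?I t \<A>' \<and> ?R \<A> \<A>' \<and> card \<A>' \<le> M \<and> ?good t \<A>')"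
    by (rule exE)
  show ?thesis
  proof (intro exI[of _ M] allI impI)
    fix X :: "'a set" and \<U> :: "(nat set \<times> (nat \<Rightarrow> 'a) set) set" and \<A>
    assume "finite X \<and> finite \<U> \<and> card \<U> \<le> L \<and> (\<forall>(e, U)\<in>\<U>. e \<subseteq> D \<and> card e = 2) \<and> cube.valid D X \<A> \<and> card \<A> \<le> m"
    then have "?I (X, \<U>) \<A> \<and> card \<A> \<le> m" by simp
    from M[THEN spec, THEN spec, THEN mp, OF this]
    show "\<exists>\<A>'. cube.valid D X \<A>' \<and> \<A> \<subseteq> \<A>' \<and> (\<forall>(e, A)\<in>\<A>' - \<A>. card e = 1) \<and> card \<A>' \<le> M \<and>
        (\<forall>(e, U)\<in>\<U>. card (cube.irregular D X e \<epsilon> \<A>' U) \<le> \<gamma> * card (cube.\<Omega> D X))"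
      unfolding prod.case by blast
  qed
qed

definition face_energy :: "nat set \<Rightarrow> 'a set \<Rightarrow> (nat \<Rightarrow> (nat \<Rightarrow> 'a) set) \<Rightarrow> (nat set \<times> (nat \<Rightarrow> 'a) set) set \<Rightarrow> real" where
  "face_energy D X E \<A> = (\<Sum>k\<in>D. energy (cube.\<Omega> D X) (fam \<A> (D - {k})) (\<lambda>w. of_bool (w \<in> E k)))"

lemma face_energy_le:
  assumes "finite D" "finite X"
  shows "0 \<le> face_energy D X E \<A>" "face_energy D X E \<A> \<le> card D * card (cube.\<Omega> D X)"
proof -
  interpret cube D X using assms by unfold_locales
  show "0 \<le> face_energy D X E \<A>" unfolding face_energy_def energy_def by (auto intro!: sum_nonneg)
  have "face_energy D X E \<A> \<le> (\<Sum>k\<in>D. real (card \<Omega>))"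
    unfolding face_energy_def by (intro sum_mono energy_le fin) auto
  then show "face_energy D X E \<A> \<le> card D * card \<Omega>" by simp
qed

lemma face_energy_mono:
  assumes "finite D" "finite X" "\<A> \<subseteq> \<A>'"
  shows "face_energy D X E \<A> \<le> face_energy D X E \<A>'"
proof -
  interpret cube D X using assms by unfold_locales
  show ?thesis unfolding face_energy_def by (intro sum_mono energy_mono fin families_mono assms)
qed

lemma uniform_regularity:
  fixes D :: "nat set" and \<eta> :: real
  assumes D: "finite D" "card D = 4" and \<eta>: "\<eta> > 0"
  shows "\<exists>M. \<forall>(X :: 'a set) E \<A>. finite X \<and> cube.valid D X \<A> \<and> card \<A> \<le> m \<longrightarrow>
      (\<exists>\<A>'. cube.valid D X \<A>' \<and> \<A> \<subseteq> \<A>' \<and> card \<A>' \<le> M \<and> (\<forall>k\<in>D. cube.uniform_on D X \<A>' E k \<eta>))"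
proof -
  let ?I = "\<lambda>(X :: 'a set, E :: nat \<Rightarrow> (nat \<Rightarrow> 'a) set) \<A>. finite X \<and> cube.valid D X \<A>"
  let ?\<Phi> = "\<lambda>(X :: 'a set, E) \<A>. face_energy D X E \<A> / card (cube.\<Omega> D X)"
  let ?good = "\<lambda>(X :: 'a set, E) \<A>. \<forall>k\<in>D. cube.uniform_on D X \<A> E k \<eta>"
  have "\<exists>M. \<forall>t \<A>. ?I t \<A> \<and> card \<A> \<le> m \<longrightarrow> (\<exists>\<A>'. ?I t \<A>' \<and> \<A> \<subseteq> \<A>' \<and> card \<A>' \<le> M \<and> ?good t \<A>')"
  proof (rule increment_iteration[where \<Phi> = ?\<Phi> and C = 4 and \<delta> = "\<eta>\<^sup>2"])
    show "\<eta>\<^sup>2 > 0" using \<eta> by simp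
  next
    fix t :: "'a set \<times> (nat \<Rightarrow> (nat \<Rightarrow> 'a) set)" and \<A>
    assume I: "?I t \<A>"
    obtain X E where t: "t = (X, E)" by (cases t)
    have X: "finite X" using I t by simp
    show "0 \<le> ?\<Phi> t \<A>" using face_energy_le(1)[OF D(1) X] unfolding t by simp
    show "?\<Phi> t \<A> \<le> 4" using face_energy_le(2)[OF D(1) X, of E \<A>] D unfolding t
      by (cases "card (cube.\<Omega> D X) = 0") (simp_all add: divide_le_eq)
  next
    fix m
    show "\<exists>M. \<forall>t \<A>. ?I t \<A> \<and> card \<A> \<le> m \<and> \<not> ?good t \<A> \<longrightarrow>
        (\<exists>\<A>'. ?I t \<A>' \<and> \<A> \<subseteq> \<A>' \<and> card \<A>' \<le> M \<and> ?\<Phi> t \<A>' \<ge> ?\<Phi> t \<A> + \<eta>\<^sup>2)"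
    proof (rule exI[of _ "m + 4"], intro allI impI, elim conjE)
      fix t \<A> assume I: "?I t \<A>" and m: "card \<A> \<le> m" and bad: "\<not> ?good t \<A>"
      obtain X E where t: "t = (X, E)" by (cases t)
      interpret cube D X using D I t by unfold_locales auto
      obtain k where k: "k \<in> D" and nu: "\<not> uniform_on \<A> E k \<eta>" using bad unfolding t by auto
      have v: "valid \<A>" using I t by auto
      have pos: "card \<Omega> > 0"
      proof (rule ccontr)
        assume "\<not> card \<Omega> > 0"
        then have "\<Omega> = {}" using fin by simp
        then show False using nu by (simp add: uniform_on_def)
      qed
      obtain \<A>' where A': "valid \<A>'" "\<A> \<subseteq> \<A>'" "card \<A>' \<le> card \<A> + 4"
        and inc: "energy \<Omega> (fam \<A>' (D - {k})) (\<lambda>w. of_bool (w \<in> E k)) \<ge> energy \<Omega> (fam \<A> (D - {k})) (\<lambda>w. of_bool (w \<in> E k)) + \<eta>\<^sup>2 * card \<Omega>"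
        using uniform_increment[OF v k D(2) \<eta> nu] by blast
      have "face_energy D X E \<A> + \<eta>\<^sup>2 * card \<Omega> \<le> face_energy D X E \<A>'"
      proof -
        have "(\<Sum>k\<in>D - {k}. energy \<Omega> (fam \<A> (D - {k})) (\<lambda>w. of_bool (w \<in> E k)))
            \<le> (\<Sum>k\<in>D - {k}. energy \<Omega> (fam \<A>' (D - {k})) (\<lambda>w. of_bool (w \<in> E k)))"
          by (intro sum_mono energy_mono fin families_mono A')
        then show ?thesis using inc unfolding face_energy_def by (simp add: sum.remove[OF D(1) k])
      qed
      from quotient_increment[OF this] have "?\<Phi> t \<A>' \<ge> ?\<Phi> t \<A> + \<eta>\<^sup>2"
        using pos unfolding t by simp
      then show "\<exists>\<A>'. ?I t \<A>' \<and> \<A> \<subseteq> \<A>' \<and> card \<A>' \<le> m + 4 \<and> ?\<Phi> t \<A>' \<ge> ?\<Phi> t \<A> + \<eta>\<^sup>2" using A' I t m by (intro exI[of _ \<A>']) auto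
    qed
  qed auto
  then obtain M where M: "\<forall>t \<A>. ?I t \<A> \<and> card \<A> \<le> m \<longrightarrow> (\<exists>\<A>'. ?I t \<A>' \<and> \<A> \<subseteq> \<A>' \<and> card \<A>' \<le> M \<and> ?good t \<A>')"
    by (rule exE)
  show ?thesis
  proof (intro exI[of _ M] allI impI)
    fix X :: "'a set" and E \<A>
    assume "finite X \<and> cube.valid D X \<A> \<and> card \<A> \<le> m"
    then have "?I (X, E) \<A> \<and> card \<A> \<le> m" by simp
    from M[THEN spec, THEN spec, THEN mp, OF this] show "\<exists>\<A>'. cube.valid D X \<A>' \<and> \<A> \<subseteq> \<A>' \<and> card \<A>' \<le> M \<and> (\<forall>k\<in>D. cube.uniform_on D X \<A>' E k \<eta>)"
      unfolding prod.case by blast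
  qed
qed

definition (in cube) bad_pair :: "nat set \<Rightarrow> real \<Rightarrow> (nat set \<times> (nat \<Rightarrow> 'a) set) set \<Rightarrow> (nat \<Rightarrow> 'a) set" where
  "bad_pair e \<epsilon> \<A> = {w\<in>\<Omega>. \<not> regular e \<epsilon> (atom \<Omega> (sing \<A> e) w) (atom \<Omega> (pairs \<A> e) w)}"

text \<open>Only sets on single coordinates are added, so the number \<open>2 ^ m\<close> of labels of a pair does not grow
  while the cells shrink.  This is why the tolerance \<open>\<epsilon>\<close> may be small compared with the typical
  density \<open>1 / 2 ^ m\<close> of a label.\<close>

lemma pair_regularity:
  fixes D :: "nat set" and \<epsilon> \<gamma> :: real
  assumes D: "finite D" "card D = 4" and \<epsilon>: "\<epsilon> > 0" and \<gamma>: "\<gamma> > 0"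
  shows "\<exists>M. \<forall>(X :: 'a set) \<A>. finite X \<and> cube.valid D X \<A> \<and> card \<A> \<le> m \<longrightarrow>
      (\<exists>\<A>'. cube.valid D X \<A>' \<and> \<A> \<subseteq> \<A>' \<and> card \<A>' \<le> M \<and> (\<forall>e. card e = 2 \<longrightarrow> pairs \<A>' e = pairs \<A> e) \<and>
        (\<forall>e\<subseteq>D. card e = 2 \<longrightarrow> card (cube.bad_pair D X e \<epsilon> \<A>') \<le> \<gamma> * card (cube.\<Omega> D X)))"
proof -
  have "\<gamma> / 2 ^ m > 0" using \<gamma> by simp
  from cell_regularity[OF D(1) \<epsilon> this, of "16 * 2 ^ m" m]
  obtain M where M: "\<forall>(X :: 'a set) \<U> \<A>. finite X \<and> finite \<U> \<and> card \<U> \<le> 16 * 2 ^ m \<and> (\<forall>(e, U)\<in>\<U>. e \<subseteq> D \<and> card e = 2) \<and>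
      cube.valid D X \<A> \<and> card \<A> \<le> m \<longrightarrow>
      (\<exists>\<A>'. cube.valid D X \<A>' \<and> \<A> \<subseteq> \<A>' \<and> (\<forall>(e, A)\<in>\<A>' - \<A>. card e = 1) \<and> card \<A>' \<le> M \<and>
        (\<forall>(e, U)\<in>\<U>. card (cube.irregular D X e \<epsilon> \<A>' U) \<le> \<gamma> / 2 ^ m * card (cube.\<Omega> D X)))"
    by (rule exE)
  show ?thesis
  proof (intro exI[of _ M] allI impI, elim conjE)
    fix X :: "'a set" and \<A> assume X: "finite X" and v: "cube.valid D X \<A>" and m: "card \<A> \<le> m"
    interpret cube D X using D X by unfold_locales
    have finA: "finite \<A>" using v by (simp add: valid_def)
    have atoms: "finite (atom \<Omega> (pairs \<A> e) ` \<Omega>)" "card (atom \<Omega> (pairs \<A> e) ` \<Omega>) \<le> 2 ^ m" for e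
    proof -
      show "finite (atom \<Omega> (pairs \<A> e) ` \<Omega>)" using fin by simp
      have "card (atom \<Omega> (pairs \<A> e) ` \<Omega>) \<le> 2 ^ card (pairs \<A> e)"
        by (rule card_atoms_le(2)[OF finite_families(5)[OF finA]])
      also have "\<dots> \<le> 2 ^ m" using finite_families(6)[OF finA, of e] m by (intro power_increasing) auto
      finally show "card (atom \<Omega> (pairs \<A> e) ` \<Omega>) \<le> 2 ^ m" .
    qed
    define \<U> where "\<U> = (SIGMA e:{e. e \<subseteq> D \<and> card e = 2}. atom \<Omega> (pairs \<A> e) ` \<Omega>)"
    have sub: "{e. e \<subseteq> D \<and> card e = 2} \<subseteq> Pow D" by blast
    have finP: "finite {e. e \<subseteq> D \<and> card e = 2}" using finite_subset[OF sub] D by simp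
    have "card {e. e \<subseteq> D \<and> card e = 2} \<le> 16"
      using card_mono[OF _ sub] D by (simp add: card_Pow)
    have "card \<U> = (\<Sum>e\<in>{e. e \<subseteq> D \<and> card e = 2}. card (atom \<Omega> (pairs \<A> e) ` \<Omega>))"
      unfolding \<U>_def using finP atoms(1) by (intro card_SigmaI) auto
    also have "\<dots> \<le> (\<Sum>e\<in>{e. e \<subseteq> D \<and> card e = 2}. 2 ^ m)" by (intro sum_mono atoms(2))
    also have "\<dots> \<le> 16 * 2 ^ m" using \<open>card {e. e \<subseteq> D \<and> card e = 2} \<le> 16\<close> by simp
    finally have U: "finite \<U>" "card \<U> \<le> 16 * 2 ^ m" "\<forall>(e, U)\<in>\<U>. e \<subseteq> D \<and> card e = 2"
      unfolding \<U>_def using finP fin by auto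
    obtain \<A>' where A': "valid \<A>'" "\<A> \<subseteq> \<A>'" "\<forall>(e, A)\<in>\<A>' - \<A>. card e = 1" "card \<A>' \<le> M"
      and irr: "\<forall>(e, U)\<in>\<U>. card (irregular e \<epsilon> \<A>' U) \<le> \<gamma> / 2 ^ m * card \<Omega>"
      using M[THEN spec, THEN spec, THEN spec, THEN mp, of X \<U> \<A>] X U v m by blast
    have pairs: "pairs \<A>' e = pairs \<A> e" if "card e = 2" for e
    proof -
      have "(e, A) \<notin> \<A>' - \<A>" for A using bspec[OF A'(3), of "(e, A)"] that by auto
      then show ?thesis using A'(2) by (auto simp: pairs_def)
    qed
    moreover have "card (bad_pair e \<epsilon> \<A>') \<le> \<gamma> * card \<Omega>" if e: "e \<subseteq> D" "card e = 2" for e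
    proof -
      have "bad_pair e \<epsilon> \<A>' \<subseteq> (\<Union>U\<in>atom \<Omega> (pairs \<A> e) ` \<Omega>. irregular e \<epsilon> \<A>' U)"
        unfolding bad_pair_def irregular_def pairs[OF e(2)] by blast
      moreover have "finite (\<Union>U\<in>atom \<Omega> (pairs \<A> e) ` \<Omega>. irregular e \<epsilon> \<A>' U)"
        using fin by (auto simp: irregular_def)
      ultimately have "card (bad_pair e \<epsilon> \<A>') \<le> (\<Sum>U\<in>atom \<Omega> (pairs \<A> e) ` \<Omega>. card (irregular e \<epsilon> \<A>' U))"
        using card_mono card_UN_le[OF atoms(1), of "irregular e \<epsilon> \<A>'"] order_trans by meson
      then have "card (bad_pair e \<epsilon> \<A>') \<le> (\<Sum>U\<in>atom \<Omega> (pairs \<A> e) ` \<Omega>. real (card (irregular e \<epsilon> \<A>' U)))"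
        by (simp flip: of_nat_sum)
      also have "\<dots> \<le> (\<Sum>U\<in>atom \<Omega> (pairs \<A> e) ` \<Omega>. \<gamma> / 2 ^ m * card \<Omega>)"
        using irr e by (intro sum_mono) (auto simp: \<U>_def)
      also have "\<dots> = real (card (atom \<Omega> (pairs \<A> e) ` \<Omega>)) * (\<gamma> / 2 ^ m * card \<Omega>)" by simp
      also have "\<dots> \<le> real (2 ^ m) * (\<gamma> / 2 ^ m * card \<Omega>)"
        using atoms(2)[of e] \<gamma> by (intro mult_right_mono of_nat_mono) auto
      finally show ?thesis by simp
    qed
    ultimately show "\<exists>\<A>'. valid \<A>' \<and> \<A> \<subseteq> \<A>' \<and> card \<A>' \<le> M \<and> (\<forall>e. card e = 2 \<longrightarrow> pairs \<A>' e = pairs \<A> e) \<and>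
        (\<forall>e\<subseteq>D. card e = 2 \<longrightarrow> card (bad_pair e \<epsilon> \<A>') \<le> \<gamma> * card \<Omega>)"
      using A' by blast
  qed
qed

definition strongly_regular :: "nat set \<Rightarrow> 'a set \<Rightarrow> (nat \<Rightarrow> (nat \<Rightarrow> 'a) set) \<Rightarrow> real \<Rightarrow> real \<Rightarrow>
    (nat \<Rightarrow> real) \<Rightarrow> (nat \<Rightarrow> nat \<Rightarrow> real) \<Rightarrow> (nat \<Rightarrow> nat) \<Rightarrow> nat \<Rightarrow>
    (nat set \<times> (nat \<Rightarrow> 'a) set) set \<Rightarrow> (nat set \<times> (nat \<Rightarrow> 'a) set) set \<Rightarrow> bool" where
  "strongly_regular D X E \<gamma> \<epsilon>\<^sub>2 \<epsilon>\<^sub>1 \<eta> R m \<A> \<A>' \<longleftrightarrow>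
      cube.valid D X \<A> \<and> cube.valid D X \<A>' \<and> \<A> \<subseteq> \<A>' \<and>
      card \<A> \<le> R m \<and> (\<forall>e. card e = 2 \<longrightarrow> card (pairs \<A> e) \<le> m) \<and>
      (\<forall>e\<subseteq>D. card e = 2 \<longrightarrow> real (card (cube.bad_pair D X e (\<epsilon>\<^sub>1 m) \<A>)) \<le> \<gamma> * real (card (cube.\<Omega> D X))) \<and>
      (\<forall>k\<in>D. cube.uniform_on D X \<A>' E k (\<eta> m (R m))) \<and>
      face_energy D X E \<A>' \<le> face_energy D X E \<A> + \<epsilon>\<^sub>2 * real (card (cube.\<Omega> D X))"

text \<open>Regularise the cells of a family to obtain \<open>\<A>\<close>, then refine \<open>\<A>\<close> to a uniform \<open>\<A>'\<close>.  If the two have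
  very different energies, start again from \<open>\<A>'\<close>; this can happen a bounded number of times.  The
  outcome is a coarse \<open>\<A>\<close> that predicts the averages on \<open>\<A>'\<close> in the mean square sense, while the error
  \<open>\<eta>\<close> of \<open>\<A>'\<close> is as small as desired in terms of the complexity of the coarse family \<open>\<A>\<close>.\<close>

lemma strong_regularity:
  fixes D :: "nat set" and \<gamma> \<epsilon>\<^sub>2 :: real and \<epsilon>\<^sub>1 :: "nat \<Rightarrow> real" and \<eta> :: "nat \<Rightarrow> nat \<Rightarrow> real"
  assumes D: "finite D" "card D = 4" and \<gamma>: "\<gamma> > 0" and \<epsilon>\<^sub>2: "\<epsilon>\<^sub>2 > 0"
    and \<epsilon>\<^sub>1: "\<And>m. \<epsilon>\<^sub>1 m > 0" and \<eta>: "\<And>m M. \<eta> m M > 0"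
  shows "\<exists>N R. \<forall>(X :: 'a set) E. finite X \<longrightarrow> (\<exists>m\<le>N. \<exists>\<A> \<A>'. strongly_regular D X E \<gamma> \<epsilon>\<^sub>2 \<epsilon>\<^sub>1 \<eta> R m \<A> \<A>')"
proof -
  have "\<forall>m. \<exists>M. \<forall>(X :: 'a set) \<A>. finite X \<and> cube.valid D X \<A> \<and> card \<A> \<le> m \<longrightarrow>
      (\<exists>\<A>'. cube.valid D X \<A>' \<and> \<A> \<subseteq> \<A>' \<and> card \<A>' \<le> M \<and> (\<forall>e. card e = 2 \<longrightarrow> pairs \<A>' e = pairs \<A> e) \<and>
        (\<forall>e\<subseteq>D. card e = 2 \<longrightarrow> card (cube.bad_pair D X e (\<epsilon>\<^sub>1 m) \<A>') \<le> \<gamma> * card (cube.\<Omega> D X)))"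
    using pair_regularity[OF D \<epsilon>\<^sub>1 \<gamma>] by blast
  then obtain R where R: "\<forall>m. \<forall>(X :: 'a set) \<A>. finite X \<and> cube.valid D X \<A> \<and> card \<A> \<le> m \<longrightarrow>
      (\<exists>\<A>'. cube.valid D X \<A>' \<and> \<A> \<subseteq> \<A>' \<and> card \<A>' \<le> R m \<and> (\<forall>e. card e = 2 \<longrightarrow> pairs \<A>' e = pairs \<A> e) \<and>
        (\<forall>e\<subseteq>D. card e = 2 \<longrightarrow> card (cube.bad_pair D X e (\<epsilon>\<^sub>1 m) \<A>') \<le> \<gamma> * card (cube.\<Omega> D X)))"
    by (rule choice[THEN exE])
  have "\<forall>m. \<exists>M. \<forall>(X :: 'a set) E \<A>. finite X \<and> cube.valid D X \<A> \<and> card \<A> \<le> R m \<longrightarrow>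
      (\<exists>\<A>'. cube.valid D X \<A>' \<and> \<A> \<subseteq> \<A>' \<and> card \<A>' \<le> M \<and> (\<forall>k\<in>D. cube.uniform_on D X \<A>' E k (\<eta> m (R m))))"
    using uniform_regularity[OF D \<eta>] by blast
  then obtain T where T: "\<forall>m. \<forall>(X :: 'a set) E \<A>. finite X \<and> cube.valid D X \<A> \<and> card \<A> \<le> R m \<longrightarrow>
      (\<exists>\<A>'. cube.valid D X \<A>' \<and> \<A> \<subseteq> \<A>' \<and> card \<A>' \<le> T m \<and> (\<forall>k\<in>D. cube.uniform_on D X \<A>' E k (\<eta> m (R m))))"
    by (rule choice[THEN exE])
  let ?I = "\<lambda>(X :: 'a set, E :: nat \<Rightarrow> (nat \<Rightarrow> 'a) set) \<A>. finite X \<and> cube.valid D X \<A>"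
  let ?\<Phi> = "\<lambda>(X :: 'a set, E) \<A>. face_energy D X E \<A> / card (cube.\<Omega> D X)"
  let ?P = "\<lambda>X E m \<A> \<A>'. strongly_regular D X E \<gamma> \<epsilon>\<^sub>2 \<epsilon>\<^sub>1 \<eta> R m \<A> \<A>'"
  let ?good = "\<lambda>(X :: 'a set, E) \<B>. \<exists>\<A> \<A>'. ?P X E (card \<B>) \<A> \<A>'"
  have "\<exists>N. \<forall>t \<B>. ?I t \<B> \<and> card \<B> \<le> 0 \<longrightarrow> (\<exists>\<B>'. ?I t \<B>' \<and> True \<and> card \<B>' \<le> N \<and> ?good t \<B>')"
  proof (rule increment_iteration[where \<Phi> = ?\<Phi> and C = 4 and \<delta> = "\<epsilon>\<^sub>2"])
    fix t :: "'a set \<times> (nat \<Rightarrow> (nat \<Rightarrow> 'a) set)" and \<A>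
    assume I: "?I t \<A>"
    obtain X E where t: "t = (X, E)" by (cases t)
    have X: "finite X" using I t by simp
    show "0 \<le> ?\<Phi> t \<A>" using face_energy_le(1)[OF D(1) X] unfolding t by simp
    show "?\<Phi> t \<A> \<le> 4" using face_energy_le(2)[OF D(1) X, of E \<A>] D unfolding t
      by (cases "card (cube.\<Omega> D X) = 0") (simp_all add: divide_le_eq)
  next
    fix m
    show "\<exists>M. \<forall>t \<B>. ?I t \<B> \<and> card \<B> \<le> m \<and> \<not> ?good t \<B> \<longrightarrow>
        (\<exists>\<B>'. ?I t \<B>' \<and> True \<and> card \<B>' \<le> M \<and> ?\<Phi> t \<B>' \<ge> ?\<Phi> t \<B> + \<epsilon>\<^sub>2)"
    proof (rule exI[of _ "Max (T ` {..m})"], intro allI impI, elim conjE)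
      fix t \<B> assume I: "?I t \<B>" and m: "card \<B> \<le> m" and bad: "\<not> ?good t \<B>"
      obtain X E where t: "t = (X, E)" by (cases t)
      have X: "finite X" and v: "cube.valid D X \<B>" using I t by auto
      interpret cube D X using D X by unfold_locales
      obtain \<A> where A: "valid \<A>" "\<B> \<subseteq> \<A>" "card \<A> \<le> R (card \<B>)" "\<forall>e. card e = 2 \<longrightarrow> pairs \<A> e = pairs \<B> e"
        "\<forall>e\<subseteq>D. card e = 2 \<longrightarrow> card (bad_pair e (\<epsilon>\<^sub>1 (card \<B>)) \<A>) \<le> \<gamma> * card \<Omega>"
        using R[THEN spec, THEN spec, THEN spec, THEN mp, of X \<B> "card \<B>"] X v by blast
      obtain \<A>' where A': "valid \<A>'" "\<A> \<subseteq> \<A>'" "card \<A>' \<le> T (card \<B>)"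
        "\<forall>k\<in>D. uniform_on \<A>' E k (\<eta> (card \<B>) (R (card \<B>)))"
        using T[THEN spec, THEN spec, THEN spec, THEN spec, THEN mp, of X \<A> "card \<B>" E] X A by blast
      have small: "card (pairs \<A> e) \<le> card \<B>" if "card e = 2" for e
        using A(4) that finite_families(6)[of \<B> e] v by (simp add: valid_def)
      have notP: "\<not> ?P X E (card \<B>) \<A> \<A>'" using bad unfolding t prod.case by blast
      have gap: "face_energy D X E \<A>' > face_energy D X E \<A> + \<epsilon>\<^sub>2 * card \<Omega>"
      proof (rule ccontr)
        assume "\<not> ?thesis"
        then have "face_energy D X E \<A>' \<le> face_energy D X E \<A> + \<epsilon>\<^sub>2 * card \<Omega>" by simp
        then have "?P X E (card \<B>) \<A> \<A>'"
          unfolding strongly_regular_def using A(1,3,5) A'(1,2,4) small by blast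
        then show False using notP by simp
      qed
      then have gap': "face_energy D X E \<A>' > face_energy D X E \<B> + \<epsilon>\<^sub>2 * card \<Omega>"
        using face_energy_mono[OF D(1) X A(2), of E] by linarith
      have pos: "card \<Omega> > 0"
      proof (rule ccontr)
        assume "\<not> card \<Omega> > 0"
        then show False
          using gap' face_energy_le[OF D(1) X, of E \<A>'] face_energy_le[OF D(1) X, of E \<B>] by simp
      qed
      have "?\<Phi> t \<A>' \<ge> ?\<Phi> t \<B> + \<epsilon>\<^sub>2"
        using quotient_increment[OF less_imp_le[OF gap']] pos unfolding t by simp
      moreover have "T (card \<B>) \<le> Max (T ` {..m})" using m by (intro Max_ge) auto
      ultimately show "\<exists>\<B>'. ?I t \<B>' \<and> True \<and> card \<B>' \<le> Max (T ` {..m}) \<and> ?\<Phi> t \<B>' \<ge> ?\<Phi> t \<B> + \<epsilon>\<^sub>2" using A' X t by (intro exI[of _ \<A>']) auto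
    qed
  qed (use \<epsilon>\<^sub>2 in auto)
  then obtain N where N: "\<forall>t \<B>. ?I t \<B> \<and> card \<B> \<le> 0 \<longrightarrow> (\<exists>\<B>'. ?I t \<B>' \<and> True \<and> card \<B>' \<le> N \<and> ?good t \<B>')"
    by (rule exE)
  show ?thesis
  proof (rule exI[of _ N], rule exI[of _ R], rule allI, rule allI, rule impI)
    fix X :: "'a set" and E assume X: "finite X"
    interpret cube D X using D X by unfold_locales
    have "?I (X, E) {} \<and> card ({} :: (nat set \<times> (nat \<Rightarrow> 'a) set) set) \<le> 0" using X by (simp add: valid_def)
    from N[THEN spec, THEN spec, THEN mp, OF this] show "\<exists>m\<le>N. \<exists>\<A> \<A>'. ?P X E m \<A> \<A>'"
      unfolding prod.case by blast
  qed
qed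

section \<open>Tetrahedra\<close>

context cube
begin

lemma dep_atom_pred:
  assumes "\<And>A. A \<in> \<C> \<Longrightarrow> dep e A" "\<And>A. A \<in> \<D> \<Longrightarrow> dep e A"
  shows "dep e {w\<in>\<Omega>. P (atom \<Omega> \<C> w) (atom \<Omega> \<D> w)}"
proof (rule depI)
  fix w w' assume w: "w \<in> \<Omega>" "w' \<in> \<Omega>" "\<And>i. i \<in> e \<Longrightarrow> w i = w' i"
  have "w' \<in> atom \<Omega> \<C> w" "w' \<in> atom \<Omega> \<D> w"
    using depD[OF assms(1) w] depD[OF assms(2) w] w(2) by (auto simp: atom_def)
  then show "w \<in> {w\<in>\<Omega>. P (atom \<Omega> \<C> w) (atom \<Omega> \<D> w)} \<Longrightarrow> w' \<in> {w\<in>\<Omega>. P (atom \<Omega> \<C> w) (atom \<Omega> \<D> w)}"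
    using w(2) by (simp add: atom_eq)
qed

lemma valid_dep:
  assumes "valid \<A>"
  shows "A \<in> fam \<A> e \<Longrightarrow> dep e A" "A \<in> sing \<A> e \<Longrightarrow> dep e A" "A \<in> pairs \<A> e \<Longrightarrow> dep e A"
proof -
  have "dep e' A" if "(e', A) \<in> \<A>" for e' A using assms that by (auto simp: valid_def)
  then show "A \<in> fam \<A> e \<Longrightarrow> dep e A" "A \<in> sing \<A> e \<Longrightarrow> dep e A" "A \<in> pairs \<A> e \<Longrightarrow> dep e A"
    by (auto simp: fam_def sing_def pairs_def intro: dep_mono)
qed

text \<open>On an atom where the coarse average is at least \<open>\<gamma>\<close>, each point with \<open>h w < \<gamma> / 2\<close> costs \<open>(\<gamma> / 2)\<^sup>2\<close> in
  the square distance; this is Chebyshev's inequality on the level of atoms.\<close>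

lemma card_bad_atoms:
  fixes \<gamma> :: real
  assumes \<gamma>: "\<gamma> > 0"
  shows "card {w\<in>\<Omega>. cexp \<Omega> \<C> f w \<ge> \<gamma> \<and> card (atom \<Omega> \<C> w \<inter> {w\<in>\<Omega>. h w < \<gamma> / 2}) > card (atom \<Omega> \<C> w) / 16} * (\<gamma>\<^sup>2 / 64)
          \<le> (\<Sum>w\<in>\<Omega>. (h w - cexp \<Omega> \<C> f w)\<^sup>2)"
proof -
  define B where "B = {w\<in>\<Omega>. cexp \<Omega> \<C> f w \<ge> \<gamma> \<and> card (atom \<Omega> \<C> w \<inter> {w\<in>\<Omega>. h w < \<gamma> / 2}) > card (atom \<Omega> \<C> w) / 16}"
  let ?q = "\<lambda>w. (h w - cexp \<Omega> \<C> f w)\<^sup>2"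
  have "card B * (\<gamma>\<^sup>2 / 64) = (\<Sum>w\<in>B. \<gamma>\<^sup>2 / 64)" by simp
  also have "\<dots> \<le> (\<Sum>w\<in>B. cexp \<Omega> \<C> ?q w)"
  proof (rule sum_mono)
    fix w assume w: "w \<in> B"
    let ?a = "atom \<Omega> \<C> w" and ?b = "{w\<in>\<Omega>. h w < \<gamma> / 2}"
    have wO: "w \<in> \<Omega>" and H: "cexp \<Omega> \<C> f w \<ge> \<gamma>" and big: "card (?a \<inter> ?b) > card ?a / 16"
      using w by (auto simp: B_def)
    have pos: "card ?a > 0" by (rule card_atom_pos[OF fin wO])
    have "\<gamma>\<^sup>2 / 64 * card ?a = (\<gamma> / 2)\<^sup>2 * (card ?a / 16)" by (simp add: power2_eq_square)
    also have "\<dots> \<le> (\<gamma> / 2)\<^sup>2 * card (?a \<inter> ?b)" using big by (intro mult_left_mono) auto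
    also have "\<dots> = (\<Sum>w'\<in>?a \<inter> ?b. (\<gamma> / 2)\<^sup>2)" by simp
    also have "\<dots> \<le> (\<Sum>w'\<in>?a \<inter> ?b. ?q w')"
    proof (rule sum_mono)
      fix w' assume w': "w' \<in> ?a \<inter> ?b"
      then have "cexp \<Omega> \<C> f w' \<ge> \<gamma>" using cexp_const[of w' \<Omega> \<C> w f] H by simp
      then have "\<gamma> / 2 \<le> cexp \<Omega> \<C> f w' - h w'" using w' by simp
      then have "(\<gamma> / 2)\<^sup>2 \<le> (cexp \<Omega> \<C> f w' - h w')\<^sup>2" using \<gamma> by (intro power_mono) auto
      then show "(\<gamma> / 2)\<^sup>2 \<le> ?q w'" by (simp add: power2_commute)
    qed
    also have "\<dots> \<le> (\<Sum>w'\<in>?a. ?q w')" using finite_atom[OF fin] by (intro sum_mono2) auto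
    finally show "\<gamma>\<^sup>2 / 64 \<le> cexp \<Omega> \<C> ?q w" using pos by (simp add: cexp_def le_divide_eq)
  qed
  also have "\<dots> \<le> (\<Sum>w\<in>\<Omega>. cexp \<Omega> \<C> ?q w)"
    using fin by (intro sum_mono2) (auto simp: B_def cexp_def intro!: divide_nonneg_nonneg sum_nonneg)
  also have "\<dots> = (\<Sum>w\<in>\<Omega>. ?q w)" by (rule sum_cexp[OF fin])
  finally show ?thesis by (simp add: B_def)
qed

lemma card_low_average:
  fixes \<gamma> :: real
  assumes "\<gamma> \<ge> 0"
  shows "card {w\<in>\<Omega>. w \<in> B \<and> cexp \<Omega> \<C> (\<lambda>w. of_bool (w \<in> B)) w < \<gamma>} \<le> \<gamma> * card \<Omega>"
proof -
  let ?H = "cexp \<Omega> \<C> (\<lambda>w. of_bool (w \<in> B))"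
  have "real (card {w\<in>\<Omega>. w \<in> B \<and> ?H w < \<gamma>}) = (\<Sum>w\<in>\<Omega>. of_bool (w \<in> B) * of_bool (?H w < \<gamma>))"
    unfolding card_eq_sum by (intro sum.cong) auto
  also have "\<dots> = (\<Sum>w\<in>\<Omega>. ?H w * of_bool (?H w < \<gamma>))"
    by (rule sum_cexp_mult[OF fin, symmetric]) (simp add: cexp_const)
  also have "\<dots> \<le> (\<Sum>w\<in>\<Omega>. \<gamma>)" using assms by (intro sum_mono) auto
  finally show ?thesis by (simp add: mult.commute)
qed

lemma card_box_ge:
  fixes \<theta> :: real
  assumes J: "\<And>i. i \<in> D \<Longrightarrow> dep {i} (J i)" and big: "\<And>i. i \<in> D \<Longrightarrow> card {w\<in>\<Omega>. w \<in> J i} \<ge> \<theta> * card \<Omega>"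
    and \<theta>: "\<theta> \<ge> 0" and e: "e \<subseteq> D"
  shows "card {w\<in>\<Omega>. \<forall>i\<in>e. w \<in> J i} \<ge> \<theta> ^ card e * card \<Omega>"
proof -
  have "finite e" using e finD by (rule finite_subset)
  then show ?thesis using e
  proof (induction e)
    case empty then show ?case by simp
  next
    case (insert i e)
    let ?C = "\<lambda>e. {w\<in>\<Omega>. \<forall>i\<in>e. w \<in> J i}"
    show ?case
    proof (cases "card \<Omega> = 0")
      case True then show ?thesis by simp
    next
      case False
      have "dep e {w. \<forall>i\<in>e. w \<in> J i}" using insert.prems J by (intro dep_Inter dep_mono[OF J]) auto
      moreover have "dep (D - e) (J i)" using insert by (intro dep_mono[OF J]) auto
      ultimately have "real (card {w\<in>\<Omega>. w \<in> {w. \<forall>i\<in>e. w \<in> J i} \<and> w \<in> J i}) * card \<Omega>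
          = real (card (?C e)) * card {w\<in>\<Omega>. w \<in> J i}"
        by (subst indep) simp_all
      also have "\<dots> \<ge> (\<theta> ^ card e * card \<Omega>) * (\<theta> * card \<Omega>)"
        using insert \<theta> big by (intro mult_mono) auto
      moreover have "{w\<in>\<Omega>. w \<in> {w. \<forall>i\<in>e. w \<in> J i} \<and> w \<in> J i} = ?C (insert i e)" by auto
      ultimately have "(\<theta> ^ card (insert i e) * card \<Omega>) * card \<Omega> \<le> real (card (?C (insert i e))) * card \<Omega>"
        using insert.hyps by (simp add: mult_ac)
      then show ?thesis using False by simp
    qed
  qed
qed

text \<open>Uniformity turns a face \<open>E k\<close> into its average, and Markov's inequality turns the average into the
  set where it is not small.  Passing to a set at once, before the next face is treated, keeps all
  the other factors indicator functions, which is what uniformity speaks about.\<close>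

lemma card_high_average_le:
  fixes \<tau> \<eta> :: real
  assumes E: "\<And>k. k \<in> D \<Longrightarrow> dep (D - {k}) (E k)" and v: "valid \<A>"
    and unif: "\<And>k. k \<in> D \<Longrightarrow> uniform_on \<A> E k \<eta>"
    and \<tau>: "0 < \<tau>" "\<tau> \<le> 1" and \<eta>: "\<eta> \<ge> 0"
    and h: "\<And>k. h k = cexp \<Omega> (fam \<A> (D - {k})) (\<lambda>w. of_bool (w \<in> E k))"
    and s: "s \<subseteq> D"
  shows "\<tau> ^ card s * card {w\<in>\<Omega>. (\<forall>j\<in>s. h j w \<ge> \<tau>) \<and> (\<forall>j\<in>D - s. w \<in> E j)}
           \<le> card {w\<in>\<Omega>. \<forall>k\<in>D. w \<in> E k} + card s * \<eta> * card \<Omega>"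
proof -
  have "finite s" using s finD by (rule finite_subset)
  then show ?thesis using s
  proof (induction s)
    case empty then show ?case by simp
  next
    case (insert k s)
    let ?S = "\<lambda>s. {w\<in>\<Omega>. (\<forall>j\<in>s. h j w \<ge> \<tau>) \<and> (\<forall>j\<in>D - s. w \<in> E j)}"
    let ?E = "\<lambda>w. of_bool (w \<in> E k) :: real"
    have k: "k \<in> D" "k \<notin> s" and sD: "s \<subseteq> D" using insert by auto
    define A where "A j = (if j \<in> s then {w\<in>\<Omega>. h j w \<ge> \<tau>} else E j)" for j
    have depA: "dep (D - {j}) (A j)" if "j \<in> D" for j
    proof -
      have "dep (D - {j}) {w\<in>\<Omega>. (\<Sum>w'\<in>atom \<Omega> (fam \<A> (D - {j})) w. of_bool (w' \<in> E j)) / card (atom \<Omega> (fam \<A> (D - {j})) w) \<ge> \<tau>}"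
        by (rule dep_atom_pred[where \<D> = "fam \<A> (D - {j})"
              and P = "\<lambda>a _. (\<Sum>w'\<in>a. of_bool (w' \<in> E j)) / card a \<ge> \<tau>"]) (erule valid_dep(1)[OF v])+
      then show ?thesis using E[OF that] by (simp add: A_def h cexp_def)
    qed
    have SA: "w \<in> ?S s \<longleftrightarrow> w \<in> E k \<and> (\<forall>j\<in>D - {k}. w \<in> A j)" if "w \<in> \<Omega>" for w
      using that k sD by (auto simp: A_def)
    have SA': "w \<in> ?S (insert k s) \<longleftrightarrow> h k w \<ge> \<tau> \<and> (\<forall>j\<in>D - {k}. w \<in> A j)" if "w \<in> \<Omega>" for w
      using that k sD by (auto simp: A_def)
    have cr: "real (card (?S s')) = (\<Sum>w\<in>\<Omega>. of_bool (w \<in> ?S s'))" for s'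
      unfolding card_eq_sum by (intro sum.cong) auto
    have "\<bar>\<Sum>w\<in>\<Omega>. (?E w - h k w) * of_bool (\<forall>j\<in>D - {k}. w \<in> A j)\<bar> * card \<Omega> \<le> (\<eta> * card \<Omega>) * card {w\<in>\<Omega>. w \<in> UNIV}"
    proof -
      have "\<bar>\<Sum>w\<in>\<Omega>. (?E w - h k w) * of_bool ((\<forall>j\<in>D - {k}. w \<in> A j) \<and> w \<in> UNIV)\<bar> * card \<Omega> \<le> (\<eta> * card \<Omega>) * card {w\<in>\<Omega>. w \<in> UNIV}"
      proof (rule fibre_bound[where e = "D - {k}" and s = "\<lambda>j. D - {j}"])
        fix w w' assume w: "w \<in> \<Omega>" "w' \<in> \<Omega>" "\<And>i. i \<in> D - {k} \<Longrightarrow> w i = w' i"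
        have "w' \<in> atom \<Omega> (fam \<A> (D - {k})) w"
          using depD[OF valid_dep(1)[OF v] w] w(2) by (auto simp: atom_def)
        then show "?E w - h k w = ?E w' - h k w'"
          using depD[OF E[OF k(1)] w] by (simp add: h cexp_const)
      next
        fix A' assume A': "\<And>j. j \<in> D - {k} \<Longrightarrow> dep ((D - {j}) \<inter> (D - {k})) (A' j)"
        have "(D - {j}) \<inter> (D - {k}) = D - {k, j}" for j by blast
        then have "\<forall>j\<in>D - {k}. dep (D - {k, j}) (A' j)" using A' by simp
        then show "\<bar>\<Sum>w\<in>\<Omega>. (?E w - h k w) * of_bool (\<forall>j\<in>D - {k}. w \<in> A' j)\<bar> \<le> \<eta> * card \<Omega>"
          using unif[OF k(1)] unfolding uniform_on_def h by blast
      qed (use depA dep_UNIV in auto)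
      then show ?thesis by simp
    qed
    then have U: "\<bar>\<Sum>w\<in>\<Omega>. (?E w - h k w) * of_bool (\<forall>j\<in>D - {k}. w \<in> A j)\<bar> \<le> \<eta> * card \<Omega>"
      by (cases "card \<Omega> = 0") (use fin in auto)
    have "\<tau> * card (?S (insert k s)) = (\<Sum>w\<in>\<Omega>. \<tau> * of_bool (w \<in> ?S (insert k s)))"
      unfolding cr by (simp add: sum_distrib_left)
    also have "\<dots> \<le> (\<Sum>w\<in>\<Omega>. h k w * of_bool (\<forall>j\<in>D - {k}. w \<in> A j))"
    proof (rule sum_mono)
      fix w assume w: "w \<in> \<Omega>"
      have "0 \<le> h k w" unfolding h using w by (intro cexp_bounds(1) fin) auto
      then show "\<tau> * of_bool (w \<in> ?S (insert k s)) \<le> h k w * of_bool (\<forall>j\<in>D - {k}. w \<in> A j)"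
        unfolding SA'[OF w] by auto
    qed
    also have "\<dots> \<le> (\<Sum>w\<in>\<Omega>. ?E w * of_bool (\<forall>j\<in>D - {k}. w \<in> A j)) + \<eta> * card \<Omega>"
      using U by (simp add: left_diff_distrib sum_subtractf abs_le_iff)
    also have "(\<Sum>w\<in>\<Omega>. ?E w * of_bool (\<forall>j\<in>D - {k}. w \<in> A j)) = card (?S s)"
      unfolding cr by (intro sum.cong refl) (simp only: SA of_bool_conj)
    finally have step: "\<tau> * card (?S (insert k s)) \<le> card (?S s) + \<eta> * card \<Omega>" .
    have "\<tau> ^ card (insert k s) * card (?S (insert k s)) = \<tau> ^ card s * (\<tau> * card (?S (insert k s)))"
      using insert.hyps by simp
    also have "\<dots> \<le> \<tau> ^ card s * (card (?S s) + \<eta> * card \<Omega>)"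
      using step \<tau> by (intro mult_left_mono) auto
    also have "\<dots> = \<tau> ^ card s * card (?S s) + \<tau> ^ card s * (\<eta> * card \<Omega>)" by (simp add: distrib_left)
    also have "\<dots> \<le> \<tau> ^ card s * card (?S s) + \<eta> * card \<Omega>"
      using \<tau> \<eta> by (intro add_left_mono mult_left_le_one_le) (auto simp: power_le_one)
    also have "\<dots> \<le> card {w\<in>\<Omega>. \<forall>k\<in>D. w \<in> E k} + card (insert k s) * \<eta> * card \<Omega>"
      using insert.IH[OF sD] insert.hyps by (simp add: algebra_simps)
    finally show ?case .
  qed
qed


lemma atom_fam_face:
  assumes v: "valid \<A>" and k: "k \<in> D"
  shows "atom \<Omega> (fam \<A> (D - {k})) w = {w'\<in>\<Omega>. (\<forall>i\<in>D - {k}. w' \<in> atom \<Omega> (sing \<A> {i}) w) \<and>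
           (\<forall>e. e \<subseteq> D - {k} \<and> card e = 2 \<longrightarrow> w' \<in> atom \<Omega> (pairs \<A> e) w)}" (is "?L = ?R")
proof
  show "?L \<subseteq> ?R"
  proof
    fix w' assume w': "w' \<in> ?L"
    have "w' \<in> atom \<Omega> (sing \<A> {i}) w" if "i \<in> D - {k}" for i
    proof -
      have "sing \<A> {i} \<subseteq> fam \<A> (D - {k})" using that by (auto simp: sing_def fam_def)
      from subsetD[OF atom_mono[OF this] w'] show ?thesis .
    qed
    moreover have "w' \<in> atom \<Omega> (pairs \<A> e) w" if "e \<subseteq> D - {k}" for e
    proof -
      have "pairs \<A> e \<subseteq> fam \<A> (D - {k})" using that by (auto simp: pairs_def fam_def)
      from subsetD[OF atom_mono[OF this] w'] show ?thesis .
    qed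
    moreover have "w' \<in> \<Omega>" using w' by (simp add: atom_def)
    ultimately show "w' \<in> ?R" by simp
  qed
  show "?R \<subseteq> ?L"
  proof
    fix w' assume w': "w' \<in> ?R"
    have "w' \<in> A \<longleftrightarrow> w \<in> A" if A: "A \<in> fam \<A> (D - {k})" for A
    proof -
      obtain e where e: "e \<subseteq> D - {k}" "(e, A) \<in> \<A>" using A by (auto simp: fam_def)
      then have "card e = 1 \<or> card e = 2" using v by (auto simp: valid_def)
      then show ?thesis
      proof
        assume "card e = 1"
        then obtain i where "e = {i}" by (auto simp: card_1_singleton_iff)
        then have "A \<in> sing \<A> {i}" "w' \<in> atom \<Omega> (sing \<A> {i}) w" using e w' by (auto simp: sing_def)
        then show ?thesis by (auto simp: atom_def)
      next
        assume "card e = 2"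
        then have "A \<in> pairs \<A> e" "w' \<in> atom \<Omega> (pairs \<A> e) w" using e w' by (auto simp: pairs_def)
        then show ?thesis by (auto simp: atom_def)
      qed
    qed
    then show "w' \<in> ?L" using w' by (simp add: atom_def)
  qed
qed

text \<open>The three edges at \<open>k\<close> extend every set of triangles on the opposite face in the proportion that
  their densities predict, whatever the set.  Hence a set \<open>B k\<close> that is sparse among these triangles is
  also sparse among the tetrahedra of the box, and most tetrahedra avoid all four sets.\<close>

lemma card_regular_box:
  fixes \<epsilon> \<theta> d\<^sub>0 :: real
  assumes cD: "card D = 4" and v: "valid \<A>" and \<omega>: "\<omega> \<in> \<Omega>" and d\<^sub>0: "d\<^sub>0 > 0" and \<theta>: "\<theta> \<ge> 0"
    and dens: "\<And>e. e \<subseteq> D \<Longrightarrow> card e = 2 \<Longrightarrow>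
       card (atom \<Omega> (sing \<A> e) \<omega> \<inter> atom \<Omega> (pairs \<A> e) \<omega>) \<ge> d\<^sub>0 * card (atom \<Omega> (sing \<A> e) \<omega>)"
    and reg: "\<And>e. e \<subseteq> D \<Longrightarrow> card e = 2 \<Longrightarrow> regular e \<epsilon> (atom \<Omega> (sing \<A> e) \<omega>) (atom \<Omega> (pairs \<A> e) \<omega>)"
    and \<epsilon>: "\<epsilon> = d\<^sub>0 ^ 6 / 200"
    and big: "\<And>i. i \<in> D \<Longrightarrow> card (atom \<Omega> (sing \<A> {i}) \<omega>) \<ge> \<theta> * card \<Omega>"
    and B: "\<And>k. k \<in> D \<Longrightarrow> dep (D - {k}) (B k)"
    and few: "\<And>k. k \<in> D \<Longrightarrow> card (atom \<Omega> (fam \<A> (D - {k})) \<omega> \<inter> B k) \<le> card (atom \<Omega> (fam \<A> (D - {k})) \<omega>) / 16"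
  shows "card {w\<in>\<Omega>. \<forall>k\<in>D. w \<notin> B k} \<ge> d\<^sub>0 ^ 6 / 2 * \<theta> ^ 4 * card \<Omega>"
proof -
  define J where "J i = atom \<Omega> (sing \<A> {i}) \<omega>" for i
  define C where "C e = {w\<in>\<Omega>. \<forall>i\<in>e. w \<in> J i}" for e
  define Q where "Q = {w\<in>\<Omega>. \<forall>i\<in>D. w \<in> J i}"
  define U where "U e = atom \<Omega> (pairs \<A> e) \<omega>" for e
  define T where "T k = atom \<Omega> (fam \<A> (D - {k})) \<omega>" for k
  define d :: "nat set \<Rightarrow> real" where "d e = card (C e \<inter> U e) / card (C e)" for e
  define P where "P = {e. e \<subseteq> D \<and> card e = 2}"
  define K where "K = {w\<in>Q. \<forall>e\<in>P. w \<in> U e}"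
  have finP: "finite P" unfolding P_def using finite_subset[of "{e. e \<subseteq> D \<and> card e = 2}" "Pow D"] finD by auto
  have cardP: "card P = 6" unfolding P_def using n_subsets[OF finD, of 2] cD by (simp add: choose_two)
  have finQ: "finite Q" unfolding Q_def using fin by simp
  have CA: "C e = atom \<Omega> (sing \<A> e) \<omega>" for e by (auto simp: C_def J_def atom_def sing_def)
  have depJ: "dep {i} (J i)" for i unfolding J_def by (intro dep_atom valid_dep(2)[OF v])
  have depU: "dep e (U e)" for e unfolding U_def by (intro dep_atom valid_dep(3)[OF v])
  have depT: "dep (D - {k}) (T k)" for k unfolding T_def by (intro dep_atom valid_dep(1)[OF v])
  have E: "e \<subseteq> D \<and> card e = 2 \<and> dep e (U e) \<and> regular e \<epsilon> (C e) (U e)" if "e \<in> P" for e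
    using that reg depU by (auto simp: P_def CA U_def)
  have \<omega>C: "\<omega> \<in> C e" for e unfolding CA by (rule atom_self[OF \<omega>])
  have d_ge: "d\<^sub>0 \<le> d e" if "e \<in> P" for e
  proof -
    have "card (C e) > 0" using card_atom_pos[OF fin \<omega>] unfolding CA by simp
    then show ?thesis using dens that by (simp add: P_def CA U_def d_def le_divide_eq)
  qed
  note count = regular_count[OF depJ C_def Q_def d_def]
  have prod_ge: "d\<^sub>0 ^ 6 \<le> (\<Prod>e\<in>P. d e)"
  proof -
    have "(\<Prod>e\<in>P. d\<^sub>0) \<le> (\<Prod>e\<in>P. d e)" using d_ge d\<^sub>0 by (intro prod_mono) auto
    then show ?thesis using cardP by simp
  qed
  have "\<bar>real (card {w\<in>Q. w \<in> UNIV \<and> (\<forall>e\<in>P. w \<in> U e)}) - (\<Prod>e\<in>P. d e) * card {w\<in>Q. w \<in> UNIV}\<bar> \<le> card P * \<epsilon> * card Q"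
  proof (rule count[OF finP E])
    fix e assume "e \<in> P"
    then have "e \<noteq> {}" by (auto simp: P_def)
    then show "\<exists>l\<in>e. dep (D - {l}) UNIV" using dep_UNIV by blast
  qed
  then have "(\<Prod>e\<in>P. d e) * card Q - 6 * \<epsilon> * card Q \<le> card K" by (simp add: K_def cardP abs_le_iff)
  moreover have "d\<^sub>0 ^ 6 * card Q \<le> (\<Prod>e\<in>P. d e) * card Q" using prod_ge by (intro mult_right_mono) auto
  \<comment> \<open>Each of the six edges costs \<open>\<epsilon>\<close>, which is \<open>d\<^sub>0 ^ 6 / 200\<close>.\<close>
  ultimately have cardK: "194 / 200 * (d\<^sub>0 ^ 6 * card Q) \<le> card K" using \<epsilon> by (simp add: algebra_simps)
  have bad: "card (K \<inter> B k) \<le> card K / 16 + 6 * \<epsilon> * card Q" if k: "k \<in> D" for k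
  proof -
    define L where "L = {e\<in>P. k \<in> e}"
    have finL: "finite L" unfolding L_def using finP by simp
    have P_split: "P = L \<union> {e. e \<subseteq> D - {k} \<and> card e = 2}" "L \<inter> {e. e \<subseteq> D - {k} \<and> card e = 2} = {}"
      by (auto simp: L_def P_def)
    have cardL: "card L = 3"
    proof -
      have "card {e. e \<subseteq> D - {k} \<and> card e = 2} = 3"
        using n_subsets[of "D - {k}" 2] finD k cD by (simp add: choose_two)
      moreover have "card P = card L + card {e. e \<subseteq> D - {k} \<and> card e = 2}"
        using P_split finP by (metis card_Un_disjoint finite_Un)
      ultimately show ?thesis using cardP by simp
    qed
    have TQ: "w \<in> T k \<longleftrightarrow> (\<forall>e. e \<subseteq> D - {k} \<and> card e = 2 \<longrightarrow> w \<in> U e)" if "w \<in> Q" for w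
      using that unfolding T_def atom_fam_face[OF v k] by (auto simp: Q_def J_def U_def)
    have K1: "{w\<in>Q. w \<in> T k \<and> (\<forall>e\<in>L. w \<in> U e)} = K"
      unfolding K_def using TQ P_split(1) by auto
    have K2: "{w\<in>Q. w \<in> T k \<inter> B k \<and> (\<forall>e\<in>L. w \<in> U e)} = K \<inter> B k"
      using K1 by auto
    have W: "\<exists>l\<in>e. dep (D - {l}) (T k)" "\<exists>l\<in>e. dep (D - {l}) (T k \<inter> B k)" if "e \<in> L" for e
      using that depT[of k] dep_Int[OF depT B[OF k]] by (auto simp: L_def)
    have EL: "e \<subseteq> D \<and> card e = 2 \<and> dep e (U e) \<and> regular e \<epsilon> (C e) (U e)" if "e \<in> L" for e
      using that E by (simp add: L_def)
    let ?m = "\<Prod>e\<in>L. d e"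
    have m0: "?m \<ge> 0" by (intro prod_nonneg) (simp add: d_def)
    have c1: "\<bar>real (card K) - ?m * card {w\<in>Q. w \<in> T k}\<bar> \<le> 3 * \<epsilon> * card Q"
      using count[OF finL EL W(1)] unfolding K1 cardL by simp
    have c2: "\<bar>real (card (K \<inter> B k)) - ?m * card {w\<in>Q. w \<in> T k \<inter> B k}\<bar> \<le> 3 * \<epsilon> * card Q"
      using count[OF finL EL W(2)] unfolding K2 cardL by simp
    have TJ: "{w\<in>Q. w \<in> T k \<inter> S} = {w\<in>\<Omega>. w \<in> T k \<inter> S \<and> w \<in> J k}" for S
      unfolding Q_def T_def atom_fam_face[OF v k] using k by (auto simp: J_def)
    have depJk: "dep (D - (D - {k})) (J k)" using depJ[of k] k by (auto intro: dep_mono)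
    have pos: "card \<Omega> > 0" using fin \<omega> by (auto simp: card_gt_0_iff)
    have "{w\<in>\<Omega>. w \<in> T k} = T k" "{w\<in>\<Omega>. w \<in> T k \<inter> B k} = T k \<inter> B k"
      unfolding T_def atom_def by auto
    then have "real (card {w\<in>Q. w \<in> T k \<inter> B k}) * card \<Omega> = real (card (T k \<inter> B k)) * card {w\<in>\<Omega>. w \<in> J k}"
      "real (card {w\<in>Q. w \<in> T k}) * card \<Omega> = real (card (T k)) * card {w\<in>\<Omega>. w \<in> J k}"
      using indep[OF dep_Int[OF depT B[OF k]] depJk] indep[OF depT depJk] TJ[of "B k"] TJ[of UNIV] by simp_all
    moreover have "real (card (T k \<inter> B k)) * card {w\<in>\<Omega>. w \<in> J k} \<le> (card (T k) / 16) * card {w\<in>\<Omega>. w \<in> J k}"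
      using few[OF k] by (intro mult_right_mono) (auto simp: T_def)
    ultimately have "real (card {w\<in>Q. w \<in> T k \<inter> B k}) * card \<Omega> \<le> (card {w\<in>Q. w \<in> T k} / 16) * card \<Omega>"
      by simp
    then have "real (card {w\<in>Q. w \<in> T k \<inter> B k}) \<le> card {w\<in>Q. w \<in> T k} / 16" using pos by simp
    then have "?m * card {w\<in>Q. w \<in> T k \<inter> B k} \<le> ?m * (card {w\<in>Q. w \<in> T k} / 16)"
      using m0 by (rule mult_left_mono)
    moreover have "0 \<le> \<epsilon> * card Q" unfolding \<epsilon> using d\<^sub>0 by simp
    ultimately show ?thesis using c1 c2 by (simp add: abs_le_iff)
  qed
  have "K \<subseteq> {w\<in>\<Omega>. \<forall>k\<in>D. w \<notin> B k} \<union> (\<Union>k\<in>D. K \<inter> B k)" by (auto simp: K_def Q_def)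
  then have "card K \<le> card ({w\<in>\<Omega>. \<forall>k\<in>D. w \<notin> B k} \<union> (\<Union>k\<in>D. K \<inter> B k))"
    using fin finD finQ by (intro card_mono) (auto simp: K_def)
  also have "\<dots> \<le> card {w\<in>\<Omega>. \<forall>k\<in>D. w \<notin> B k} + card (\<Union>k\<in>D. K \<inter> B k)" by (rule card_Un_le)
  also have "\<dots> \<le> card {w\<in>\<Omega>. \<forall>k\<in>D. w \<notin> B k} + (\<Sum>k\<in>D. card (K \<inter> B k))"
    using card_UN_le[OF finD, of "\<lambda>k. K \<inter> B k"] by simp
  finally have "real (card K) \<le> card {w\<in>\<Omega>. \<forall>k\<in>D. w \<notin> B k} + (\<Sum>k\<in>D. real (card (K \<inter> B k)))"
    by (simp flip: of_nat_sum of_nat_add)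
  also have "\<dots> \<le> card {w\<in>\<Omega>. \<forall>k\<in>D. w \<notin> B k} + (\<Sum>k\<in>D. card K / 16 + 6 * \<epsilon> * card Q)"
    using bad by (intro add_left_mono sum_mono)
  finally have "real (card K) \<le> card {w\<in>\<Omega>. \<forall>k\<in>D. w \<notin> B k} + card K / 4 + 24 * \<epsilon> * card Q"
    using cD by simp
  then have "card {w\<in>\<Omega>. \<forall>k\<in>D. w \<notin> B k} \<ge> d\<^sub>0 ^ 6 * card Q / 2"
    using cardK \<epsilon> d\<^sub>0 by (simp add: field_simps)
  moreover have "\<theta> ^ 4 * card \<Omega> \<le> card Q"
  proof -
    have "{w\<in>\<Omega>. w \<in> J i} = J i" for i unfolding J_def atom_def by auto
    then show ?thesis using card_box_ge[of J \<theta> D] depJ big \<theta> cD by (simp add: J_def Q_def)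
  qed
  then have "d\<^sub>0 ^ 6 / 2 * (\<theta> ^ 4 * card \<Omega>) \<le> d\<^sub>0 ^ 6 / 2 * card Q"
    using d\<^sub>0 by (intro mult_left_mono) auto
  ultimately show ?thesis by (simp add: mult.assoc)
qed


definition faces :: "(nat \<Rightarrow> 'a) set \<Rightarrow> nat \<Rightarrow> (nat \<Rightarrow> 'a) set" where
  "faces F k = {w\<in>\<Omega>. \<exists>w'\<in>F. \<forall>i\<in>D - {k}. w' i = w i}"

lemma dep_faces: "dep (D - {k}) (faces F k)"
  by (rule depI) (auto simp: faces_def)

text \<open>The partial systems to which the tetrahedron lemma applies: the four faces of a member of \<open>F\<close> lie in
  no other member.\<close>

definition determined :: "(nat \<Rightarrow> 'a) set \<Rightarrow> bool" where
  "determined F \<longleftrightarrow> F \<subseteq> \<Omega> \<and> (\<forall>k\<in>D. \<forall>w\<in>F. \<forall>w'\<in>F. (\<forall>i\<in>D - {k}. w i = w' i) \<longrightarrow> w = w')"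

text \<open>Each of the properties below fails only on a set of small measure that does not involve some coordinate,
  and such a set contains few points of a determined \<open>F\<close>.  There are \<open>24\<close> such sets (for \<open>4\<close> coordinates,
  \<open>6\<close> pairs twice and \<open>4\<close> faces twice), each costing \<open>\<gamma>\<close>, so density \<open>25 * \<gamma>\<close> leaves a point in \<open>F\<close>.\<close>

lemma generic_point:
  fixes \<gamma> \<epsilon> :: real
  assumes cD: "card D = 4" and F: "determined F" and dense: "real (card F) * card X \<ge> 25 * \<gamma> * card \<Omega>"
    and pos: "card \<Omega> > 0" and \<gamma>: "0 < \<gamma>"
    and v: "valid \<A>" and v': "valid \<A>'" and sub: "\<A> \<subseteq> \<A>'"
    and M: "card \<A> \<le> M" and m: "\<And>e. card e = 2 \<Longrightarrow> card (pairs \<A> e) \<le> m"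
    and reg: "\<And>e. e \<subseteq> D \<Longrightarrow> card e = 2 \<Longrightarrow> card (bad_pair e \<epsilon> \<A>) \<le> \<gamma> * card \<Omega>"
    and gap: "face_energy D X (faces F) \<A>' \<le> face_energy D X (faces F) \<A> + \<gamma> ^ 3 / 64 * card \<Omega>"
    and h: "\<And>k. h k = cexp \<Omega> (fam \<A>' (D - {k})) (\<lambda>w. of_bool (w \<in> faces F k))"
  shows "\<exists>\<omega>\<in>\<Omega>. (\<forall>i\<in>D. card (atom \<Omega> (sing \<A> {i}) \<omega>) \<ge> \<gamma> / 2 ^ M * card \<Omega>) \<and>
     (\<forall>e. e \<subseteq> D \<and> card e = 2 \<longrightarrow>
       card (atom \<Omega> (sing \<A> e) \<omega> \<inter> atom \<Omega> (pairs \<A> e) \<omega>) \<ge> \<gamma> / 2 ^ m * card (atom \<Omega> (sing \<A> e) \<omega>) \<and>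
       regular e \<epsilon> (atom \<Omega> (sing \<A> e) \<omega>) (atom \<Omega> (pairs \<A> e) \<omega>)) \<and>
     (\<forall>k\<in>D. card (atom \<Omega> (fam \<A> (D - {k})) \<omega> \<inter> {w\<in>\<Omega>. h k w < \<gamma> / 2}) \<le> card (atom \<Omega> (fam \<A> (D - {k})) \<omega>) / 16)"
proof -
  let ?E = "\<lambda>k w. of_bool (w \<in> faces F k) :: real"
  define H where "H k = cexp \<Omega> (fam \<A> (D - {k})) (?E k)" for k
  define B1 where "B1 i = {w\<in>\<Omega>. card (atom \<Omega> {} w \<inter> atom \<Omega> (sing \<A> {i}) w) < \<gamma> / 2 ^ M * card (atom \<Omega> {} w)}" for i
  define B2 where "B2 e = {w\<in>\<Omega>. card (atom \<Omega> (sing \<A> e) w \<inter> atom \<Omega> (pairs \<A> e) w) < \<gamma> / 2 ^ m * card (atom \<Omega> (sing \<A> e) w)}" for e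
  define B4 where "B4 k = {w\<in>\<Omega>. w \<in> faces F k \<and> H k w < \<gamma>}" for k
  define B5 where "B5 k = {w\<in>\<Omega>. H k w \<ge> \<gamma> \<and> card (atom \<Omega> (fam \<A> (D - {k})) w \<inter> {w\<in>\<Omega>. h k w < \<gamma> / 2}) > card (atom \<Omega> (fam \<A> (D - {k})) w) / 16}" for k
  define P where "P = {e. e \<subseteq> D \<and> card e = 2}"
  have finA: "finite \<A>" using v by (simp add: valid_def)
  have finP: "finite P" unfolding P_def using finite_subset[of "{e. e \<subseteq> D \<and> card e = 2}" "Pow D"] finD by auto
  have cardP: "card P = 6" unfolding P_def using n_subsets[OF finD, of 2] cD by (simp add: choose_two)
  have sparse: "real (card (F \<inter> B)) * card X \<le> \<gamma> * card \<Omega>"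
    if B: "card B \<le> \<gamma> * card \<Omega>" "dep e B" "e \<subseteq> D" "e \<noteq> D" "B \<subseteq> \<Omega>" for B e
  proof -
    obtain k where k: "k \<in> D" "k \<notin> e" using B(3,4) by blast
    have "dep (D - {k}) B" using B(2,3) k by (auto intro: dep_mono)
    then have "card (F \<inter> B) * card X \<le> card {w\<in>\<Omega>. w \<in> B}"
      using F k(1) by (intro card_Int_determined[where k = k]) (auto simp: determined_def)
    also have "{w\<in>\<Omega>. w \<in> B} = B" using B(5) by blast
    finally have "real (card (F \<inter> B) * card X) \<le> card B" by (simp only: of_nat_le_iff)
    then show ?thesis using B(1) by simp
  qed
  have proper: "e \<noteq> D" if "card e < 4" for e :: "nat set" using that cD by auto
  have s1: "real (card (F \<inter> B1 i)) * card X \<le> \<gamma> * card \<Omega>" if i: "i \<in> D" for i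
  proof (rule sparse)
    have "card (B1 i) \<le> 2 ^ card (sing \<A> {i}) * (\<gamma> / 2 ^ M) * card \<Omega>"
      unfolding B1_def using \<gamma> by (intro card_sparse_atoms fin finite_families finA) auto
    also have "\<dots> \<le> 2 ^ M * (\<gamma> / 2 ^ M) * card \<Omega>"
    proof (intro mult_right_mono)
      show "(2::real) ^ card (sing \<A> {i}) \<le> 2 ^ M"
        using finite_families(4)[OF finA, of "{i}"] M by (intro power_increasing) auto
    qed (use \<gamma> in auto)
    finally show "card (B1 i) \<le> \<gamma> * card \<Omega>" by simp
    show "dep {i} (B1 i)" unfolding B1_def
      by (rule dep_atom_pred[where P = "\<lambda>a b. real (card (a \<inter> b)) < \<gamma> / 2 ^ M * real (card a)"])
        (auto intro: valid_dep(2)[OF v])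
  qed (use i proper[of "{i}"] in \<open>auto simp: B1_def\<close>)
  have s2: "real (card (F \<inter> B2 e)) * card X \<le> \<gamma> * card \<Omega>" if e: "e \<in> P" for e
  proof (rule sparse)
    have "card (B2 e) \<le> 2 ^ card (pairs \<A> e) * (\<gamma> / 2 ^ m) * card \<Omega>"
      unfolding B2_def using \<gamma> by (intro card_sparse_atoms fin finite_families finA) auto
    also have "\<dots> \<le> 2 ^ m * (\<gamma> / 2 ^ m) * card \<Omega>"
    proof (intro mult_right_mono)
      show "(2::real) ^ card (pairs \<A> e) \<le> 2 ^ m"
        using m e by (intro power_increasing) (auto simp: P_def)
    qed (use \<gamma> in auto)
    finally show "card (B2 e) \<le> \<gamma> * card \<Omega>" by simp
    show "dep e (B2 e)" unfolding B2_def
      by (rule dep_atom_pred[where P = "\<lambda>a b. real (card (a \<inter> b)) < \<gamma> / 2 ^ m * real (card a)"])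
        (auto intro: valid_dep[OF v])
  qed (use e proper[of e] in \<open>auto simp: B2_def P_def\<close>)
  have s3: "real (card (F \<inter> bad_pair e \<epsilon> \<A>)) * card X \<le> \<gamma> * card \<Omega>" if e: "e \<in> P" for e
  proof (rule sparse)
    show "card (bad_pair e \<epsilon> \<A>) \<le> \<gamma> * card \<Omega>" using reg e by (simp add: P_def)
    show "dep e (bad_pair e \<epsilon> \<A>)" unfolding bad_pair_def
      by (rule dep_atom_pred[where P = "\<lambda>a b. \<not> regular e \<epsilon> a b"]) (auto intro: valid_dep[OF v])
  qed (use e proper[of e] in \<open>auto simp: bad_pair_def P_def\<close>)
  have depH: "dep (D - {k}) {w\<in>\<Omega>. Q (H k w) (atom \<Omega> (fam \<A> (D - {k})) w)}" for Q k
    unfolding H_def cexp_def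
    by (rule dep_atom_pred[where \<D> = "fam \<A> (D - {k})" and P = "\<lambda>a b. Q ((\<Sum>w'\<in>a. ?E k w') / real (card a)) b"])
      (auto intro: valid_dep(1)[OF v])
  have s4: "real (card (F \<inter> B4 k)) * card X \<le> \<gamma> * card \<Omega>" if k: "k \<in> D" for k
  proof (rule sparse)
    show "card (B4 k) \<le> \<gamma> * card \<Omega>"
      unfolding B4_def H_def using \<gamma> by (intro card_low_average) auto
    have "B4 k = faces F k \<inter> {w\<in>\<Omega>. H k w < \<gamma>}" by (auto simp: B4_def)
    then show "dep (D - {k}) (B4 k)" using dep_Int[OF dep_faces depH[of k "\<lambda>x _. x < \<gamma>"]] by simp
  qed (use k in \<open>auto simp: B4_def\<close>)
  have s5: "real (card (F \<inter> B5 k)) * card X \<le> \<gamma> * card \<Omega>" if k: "k \<in> D" for k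
  proof (rule sparse)
    let ?S = "\<lambda>k. \<Sum>w\<in>\<Omega>. (h k w - H k w)\<^sup>2"
    have "card (B5 k) * (\<gamma>\<^sup>2 / 64) \<le> ?S k"
      unfolding B5_def H_def by (rule card_bad_atoms[OF \<gamma>])
    also have "\<dots> \<le> (\<Sum>k\<in>D. ?S k)" using k finD by (intro member_le_sum sum_nonneg) auto
    also have "\<dots> = face_energy D X (faces F) \<A>' - face_energy D X (faces F) \<A>"
      unfolding face_energy_def sum_subtractf[symmetric] h H_def
      by (intro sum.cong refl energy_diff[symmetric] fin families_mono(1)[OF sub])
    also have "\<dots> \<le> (\<gamma> * card \<Omega>) * (\<gamma>\<^sup>2 / 64)"
      using gap by (simp add: power2_eq_square power3_eq_cube mult_ac)
    finally show "card (B5 k) \<le> \<gamma> * card \<Omega>" using \<gamma> by simp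
    show "dep (D - {k}) (B5 k)"
      unfolding B5_def by (rule depH[of k "\<lambda>x a. x \<ge> \<gamma> \<and> card (a \<inter> {w\<in>\<Omega>. h k w < \<gamma> / 2}) > card a / 16"])
  qed (use k in \<open>auto simp: B5_def\<close>)
  define Bad where "Bad = (\<Union>i\<in>D. B1 i \<union> B4 i \<union> B5 i) \<union> (\<Union>e\<in>P. B2 e \<union> bad_pair e \<epsilon> \<A>)"
  have "\<not> F \<subseteq> Bad"
  proof
    assume "F \<subseteq> Bad"
    then have "F = (\<Union>i\<in>D. F \<inter> B1 i \<union> F \<inter> B4 i \<union> F \<inter> B5 i) \<union> (\<Union>e\<in>P. F \<inter> B2 e \<union> F \<inter> bad_pair e \<epsilon> \<A>)"
      unfolding Bad_def by blast
    then have "card F \<le> card (\<Union>i\<in>D. F \<inter> B1 i \<union> F \<inter> B4 i \<union> F \<inter> B5 i) + card (\<Union>e\<in>P. F \<inter> B2 e \<union> F \<inter> bad_pair e \<epsilon> \<A>)"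
      by (rule ord_eq_le_trans[OF arg_cong[where f = card] card_Un_le])
    also have "\<dots> \<le> (\<Sum>i\<in>D. card (F \<inter> B1 i \<union> F \<inter> B4 i \<union> F \<inter> B5 i)) + (\<Sum>e\<in>P. card (F \<inter> B2 e \<union> F \<inter> bad_pair e \<epsilon> \<A>))"
      using finD finP by (intro add_mono card_UN_le)
    also have "\<dots> \<le> (\<Sum>i\<in>D. card (F \<inter> B1 i) + card (F \<inter> B4 i) + card (F \<inter> B5 i)) + (\<Sum>e\<in>P. card (F \<inter> B2 e) + card (F \<inter> bad_pair e \<epsilon> \<A>))"
      by (intro add_mono sum_mono card_Un_le order_trans[OF card_Un_le] le_refl)
    finally have "real (card F) * card X \<le> real ((\<Sum>i\<in>D. card (F \<inter> B1 i) + card (F \<inter> B4 i) + card (F \<inter> B5 i)) + (\<Sum>e\<in>P. card (F \<inter> B2 e) + card (F \<inter> bad_pair e \<epsilon> \<A>))) * card X"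
      by (intro mult_right_mono of_nat_mono) auto
    also have "\<dots> = (\<Sum>i\<in>D. real (card (F \<inter> B1 i)) * card X + real (card (F \<inter> B4 i)) * card X + real (card (F \<inter> B5 i)) * card X)
        + (\<Sum>e\<in>P. real (card (F \<inter> B2 e)) * card X + real (card (F \<inter> bad_pair e \<epsilon> \<A>)) * card X)"
      by (simp add: distrib_right sum_distrib_right)
    also have "\<dots> \<le> (\<Sum>i\<in>D. \<gamma> * card \<Omega> + \<gamma> * card \<Omega> + \<gamma> * card \<Omega>) + (\<Sum>e\<in>P. \<gamma> * card \<Omega> + \<gamma> * card \<Omega>)"
      by (intro add_mono sum_mono s1 s2 s3 s4 s5)
    also have "\<dots> = 24 * (\<gamma> * card \<Omega>)" using cD cardP by simp
    also have "\<dots> < 25 * \<gamma> * card \<Omega>" using \<gamma> pos by simp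
    finally show False using dense by simp
  qed
  then obtain \<omega> where \<omega>: "\<omega> \<in> F" "\<omega> \<notin> Bad" by blast
  have \<omega>\<Omega>: "\<omega> \<in> \<Omega>" using \<omega>(1) F by (auto simp: determined_def)
  have full: "atom \<Omega> {} \<omega> = \<Omega>" "\<Omega> \<inter> atom \<Omega> \<C> \<omega> = atom \<Omega> \<C> \<omega>" for \<C> by (auto simp: atom_def)
  have face: "\<omega> \<in> faces F k" for k using \<omega>(1) \<omega>\<Omega> by (auto simp: faces_def)
  show ?thesis
  proof (intro bexI[OF _ \<omega>\<Omega>] conjI allI impI ballI)
    fix i assume "i \<in> D"
    then have "\<omega> \<notin> B1 i" using \<omega>(2) by (auto simp: Bad_def)
    then show "\<gamma> / 2 ^ M * card \<Omega> \<le> card (atom \<Omega> (sing \<A> {i}) \<omega>)"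
      using \<omega>\<Omega> by (simp add: B1_def full)
  next
    fix e assume "e \<subseteq> D \<and> card e = 2"
    then have "\<omega> \<notin> B2 e" "\<omega> \<notin> bad_pair e \<epsilon> \<A>" using \<omega>(2) by (auto simp: Bad_def P_def)
    then show "\<gamma> / 2 ^ m * card (atom \<Omega> (sing \<A> e) \<omega>) \<le> card (atom \<Omega> (sing \<A> e) \<omega> \<inter> atom \<Omega> (pairs \<A> e) \<omega>)"
      "regular e \<epsilon> (atom \<Omega> (sing \<A> e) \<omega>) (atom \<Omega> (pairs \<A> e) \<omega>)"
      using \<omega>\<Omega> by (simp_all add: B2_def bad_pair_def)
  next
    fix k assume "k \<in> D"
    then have "\<omega> \<notin> B4 k" "\<omega> \<notin> B5 k" using \<omega>(2) by (auto simp: Bad_def)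
    then show "card (atom \<Omega> (fam \<A> (D - {k})) \<omega> \<inter> {w\<in>\<Omega>. h k w < \<gamma> / 2}) \<le> card (atom \<Omega> (fam \<A> (D - {k})) \<omega>) / 16"
      using \<omega>\<Omega> face[of k] by (auto simp: B4_def B5_def not_less)
  qed
qed

text \<open>The generic point selects a coarse box.  Most of it consists of points where all four averages with
  respect to \<open>\<A>'\<close> are large, and uniformity converts these into tetrahedra; \<open>\<eta>\<close> is chosen below the measure
  of the box so that the conversion error does not matter.\<close>

lemma count_tetrahedra:
  fixes \<gamma> \<epsilon> \<eta> d\<^sub>0 \<theta> :: real
  assumes cD: "card D = 4" and F: "determined F" and dense: "real (card F) * card X \<ge> 25 * \<gamma> * card \<Omega>"
    and \<gamma>: "0 < \<gamma>" "\<gamma> \<le> 1"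
    and v: "valid \<A>" and v': "valid \<A>'" and sub: "\<A> \<subseteq> \<A>'"
    and M: "card \<A> \<le> M" and m: "\<And>e. card e = 2 \<Longrightarrow> card (pairs \<A> e) \<le> m"
    and d\<^sub>0: "d\<^sub>0 = \<gamma> / 2 ^ m" and \<theta>: "\<theta> = \<gamma> / 2 ^ M" and \<epsilon>: "\<epsilon> = d\<^sub>0 ^ 6 / 200"
    and \<eta>: "\<eta> = (\<gamma> / 2) ^ 4 * (d\<^sub>0 ^ 6 * \<theta> ^ 4) / 16"
    and reg: "\<And>e. e \<subseteq> D \<Longrightarrow> card e = 2 \<Longrightarrow> card (bad_pair e \<epsilon> \<A>) \<le> \<gamma> * card \<Omega>"
    and gap: "face_energy D X (faces F) \<A>' \<le> face_energy D X (faces F) \<A> + \<gamma> ^ 3 / 64 * card \<Omega>"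
    and unif: "\<And>k. k \<in> D \<Longrightarrow> uniform_on \<A>' (faces F) k \<eta>"
  shows "card {w\<in>\<Omega>. \<forall>k\<in>D. w \<in> faces F k} \<ge> \<eta> * card \<Omega>"
proof (cases "card \<Omega> = 0")
  case True
  then show ?thesis by simp
next
  case False
  then have pos: "card \<Omega> > 0" by simp
  define h where "h k = cexp \<Omega> (fam \<A>' (D - {k})) (\<lambda>w. of_bool (w \<in> faces F k))" for k
  have d0: "d\<^sub>0 > 0" and th: "\<theta> > 0" using \<gamma> by (simp_all add: d\<^sub>0 \<theta>)
  have \<eta>0: "\<eta> > 0" unfolding \<eta> using \<gamma> d0 th by simp
  obtain \<omega> where \<omega>: "\<omega> \<in> \<Omega>" "\<forall>i\<in>D. card (atom \<Omega> (sing \<A> {i}) \<omega>) \<ge> \<theta> * card \<Omega>"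
     "\<forall>e. e \<subseteq> D \<and> card e = 2 \<longrightarrow>
       card (atom \<Omega> (sing \<A> e) \<omega> \<inter> atom \<Omega> (pairs \<A> e) \<omega>) \<ge> d\<^sub>0 * card (atom \<Omega> (sing \<A> e) \<omega>) \<and>
       regular e \<epsilon> (atom \<Omega> (sing \<A> e) \<omega>) (atom \<Omega> (pairs \<A> e) \<omega>)"
     "\<forall>k\<in>D. card (atom \<Omega> (fam \<A> (D - {k})) \<omega> \<inter> {w\<in>\<Omega>. h k w < \<gamma> / 2}) \<le> card (atom \<Omega> (fam \<A> (D - {k})) \<omega>) / 16"
    using generic_point[OF cD F dense pos \<gamma>(1) v v' sub M m reg gap h_def] unfolding d\<^sub>0 \<theta> by blast
  have "card {w\<in>\<Omega>. \<forall>k\<in>D. w \<notin> {w\<in>\<Omega>. h k w < \<gamma> / 2}} \<ge> d\<^sub>0 ^ 6 / 2 * \<theta> ^ 4 * card \<Omega>"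
  proof (rule card_regular_box[OF cD v \<omega>(1) d0 less_imp_le[OF th] _ _ \<epsilon>])
    fix k assume k: "k \<in> D"
    show "dep (D - {k}) {w\<in>\<Omega>. h k w < \<gamma> / 2}" unfolding h_def cexp_def
      by (rule dep_atom_pred[where \<D> = "fam \<A>' (D - {k})" and P = "\<lambda>a _. (\<Sum>w'\<in>a. of_bool (w' \<in> faces F k)) / real (card a) < \<gamma> / 2"])
        (auto intro: valid_dep(1)[OF v'])
  qed (use \<omega> in auto)
  moreover have "{w\<in>\<Omega>. \<forall>k\<in>D. w \<notin> {w\<in>\<Omega>. h k w < \<gamma> / 2}} = {w\<in>\<Omega>. (\<forall>j\<in>D. h j w \<ge> \<gamma> / 2) \<and> (\<forall>j\<in>D - D. w \<in> faces F j)}"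
    by auto
  ultimately have "d\<^sub>0 ^ 6 / 2 * \<theta> ^ 4 * card \<Omega> \<le> card {w\<in>\<Omega>. (\<forall>j\<in>D. h j w \<ge> \<gamma> / 2) \<and> (\<forall>j\<in>D - D. w \<in> faces F j)}"
    by simp
  then have "(\<gamma> / 2) ^ 4 * (d\<^sub>0 ^ 6 / 2 * \<theta> ^ 4 * card \<Omega>)
      \<le> (\<gamma> / 2) ^ card D * card {w\<in>\<Omega>. (\<forall>j\<in>D. h j w \<ge> \<gamma> / 2) \<and> (\<forall>j\<in>D - D. w \<in> faces F j)}"
    using \<gamma> unfolding cD by (intro mult_left_mono) auto
  also have "\<dots> \<le> card {w\<in>\<Omega>. \<forall>k\<in>D. w \<in> faces F k} + card D * \<eta> * card \<Omega>"
    using \<gamma> \<eta>0 by (intro card_high_average_le[OF dep_faces v' unif _ _ _ h_def]) auto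
  finally have "8 * (\<eta> * card \<Omega>) \<le> card {w\<in>\<Omega>. \<forall>k\<in>D. w \<in> faces F k} + 4 * (\<eta> * card \<Omega>)"
    unfolding cD \<eta> by (simp add: mult_ac)
  moreover have "0 \<le> \<eta> * card \<Omega>" using \<eta>0 by simp
  ultimately show ?thesis by linarith
qed

end

text \<open>The case of the hypergraph removal lemma for tetrahedra in which the given tetrahedra do not share
  faces: a positive proportion of \<open>n\<^sup>3\<close> such tetrahedra forces a positive proportion of all \<open>n\<^sup>4\<close>.\<close>

theorem tetrahedron_lemma:
  fixes D :: "nat set" and c :: real
  assumes D: "finite D" "card D = 4" and c: "c > 0"
  shows "\<exists>\<delta>::real. \<delta> > 0 \<and> (\<forall>(X :: 'a set) F. finite X \<and> cube.determined D X F \<and>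
       real (card F) * card X \<ge> c * card (cube.\<Omega> D X) \<longrightarrow>
     card {w \<in> cube.\<Omega> D X. \<forall>k\<in>D. w \<in> cube.faces D X F k} \<ge> \<delta> * card (cube.\<Omega> D X))"
proof -
  define \<gamma> where "\<gamma> = min 1 (c / 25)"
  have \<gamma>: "0 < \<gamma>" "\<gamma> \<le> 1" "25 * \<gamma> \<le> c" using c by (auto simp: \<gamma>_def)
  define d\<^sub>0 where "d\<^sub>0 m = \<gamma> / 2 ^ m" for m :: nat
  define \<eta> where "\<eta> m M = (\<gamma> / 2) ^ 4 * (d\<^sub>0 m ^ 6 * (\<gamma> / 2 ^ M) ^ 4) / 16" for m M :: nat
  have d0: "d\<^sub>0 m > 0" for m using \<gamma> by (simp add: d\<^sub>0_def)
  have \<eta>0: "\<eta> m M > 0" for m M using \<gamma> d0[of m] by (simp add: \<eta>_def)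
  have gap: "\<gamma> ^ 3 / 64 > 0" using \<gamma> by simp
  have \<epsilon>: "d\<^sub>0 m ^ 6 / 200 > 0" for m using d0[of m] by simp
  from strong_regularity[where \<epsilon>\<^sub>1 = "\<lambda>m. d\<^sub>0 m ^ 6 / 200" and \<eta> = \<eta>, OF D \<gamma>(1) gap \<epsilon> \<eta>0]
  obtain N R where reg: "\<forall>(X :: 'a set) E. finite X \<longrightarrow> (\<exists>m\<le>N. \<exists>\<A> \<A>'.
      strongly_regular D X E \<gamma> (\<gamma> ^ 3 / 64) (\<lambda>m. d\<^sub>0 m ^ 6 / 200) \<eta> R m \<A> \<A>')"
    by (elim exE) (rule that)
  define \<delta> where "\<delta> = Min ((\<lambda>m. \<eta> m (R m)) ` {..N})"
  have pos: "\<delta> > 0" unfolding \<delta>_def using \<eta>0 by (subst Min_gr_iff) auto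
  have main: "card {w \<in> cube.\<Omega> D X. \<forall>k\<in>D. w \<in> cube.faces D X F k} \<ge> \<delta> * card (cube.\<Omega> D X)"
    if X: "finite X" and F: "cube.determined D X F" and dense: "real (card F) * card X \<ge> c * card (cube.\<Omega> D X)"
    for X :: "'a set" and F
  proof -
    interpret cube D X using D X by unfold_locales
    obtain m \<A> \<A>' where m: "m \<le> N" and A: "valid \<A>" "valid \<A>'" "\<A> \<subseteq> \<A>'" "card \<A> \<le> R m"
      "\<And>e. card e = 2 \<Longrightarrow> card (pairs \<A> e) \<le> m"
      "\<And>e. e \<subseteq> D \<Longrightarrow> card e = 2 \<Longrightarrow> card (bad_pair e (d\<^sub>0 m ^ 6 / 200) \<A>) \<le> \<gamma> * card \<Omega>"
      "\<And>k. k \<in> D \<Longrightarrow> uniform_on \<A>' (faces F) k (\<eta> m (R m))"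
      "face_energy D X (faces F) \<A>' \<le> face_energy D X (faces F) \<A> + \<gamma> ^ 3 / 64 * card \<Omega>"
      using reg[THEN spec, THEN spec, THEN mp, OF X, of "faces F"] unfolding strongly_regular_def by blast
    have "25 * \<gamma> * card \<Omega> \<le> c * card \<Omega>" using \<gamma>(3) by (intro mult_right_mono) auto
    then have "real (card F) * card X \<ge> 25 * \<gamma> * card \<Omega>" using dense by linarith
    from count_tetrahedra[OF D(2) F this \<gamma>(1,2) A(1-5) d\<^sub>0_def refl refl \<eta>_def A(6) A(8) A(7)]
    have "\<eta> m (R m) * card \<Omega> \<le> card {w\<in>\<Omega>. \<forall>k\<in>D. w \<in> faces F k}" .
    moreover have "\<delta> * card \<Omega> \<le> \<eta> m (R m) * card \<Omega>"
      unfolding \<delta>_def using m by (intro mult_right_mono Min_le) auto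
    ultimately show ?thesis by linarith
  qed
  show ?thesis
    by (intro exI[of _ \<delta>] conjI pos allI impI, elim conjE, rule main)
qed

section \<open>Systems of quadruples and of triples\<close>

definition determined4 :: "('a \<times> 'a \<times> 'a \<times> 'a) set \<Rightarrow> bool" where
  "determined4 F \<longleftrightarrow> (\<forall>x y z t u. (x, y, z, t) \<in> F \<longrightarrow>
     ((u, y, z, t) \<in> F \<longrightarrow> u = x) \<and> ((x, u, z, t) \<in> F \<longrightarrow> u = y) \<and>
     ((x, y, u, t) \<in> F \<longrightarrow> u = z) \<and> ((x, y, z, u) \<in> F \<longrightarrow> u = t))"

definition tetrahedra :: "('a \<times> 'a \<times> 'a \<times> 'a) set \<Rightarrow> ('a \<times> 'a \<times> 'a \<times> 'a) set" where
  "tetrahedra F = {(x, y, z, t). (\<exists>u. (u, y, z, t) \<in> F) \<and> (\<exists>u. (x, u, z, t) \<in> F) \<and>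
                                 (\<exists>u. (x, y, u, t) \<in> F) \<and> (\<exists>u. (x, y, z, u) \<in> F)}"

definition determined3 :: "('a \<times> 'a \<times> 'a) set \<Rightarrow> bool" where
  "determined3 T \<longleftrightarrow> (\<forall>x y z u. (x, y, z) \<in> T \<longrightarrow>
     ((u, y, z) \<in> T \<longrightarrow> u = x) \<and> ((x, u, z) \<in> T \<longrightarrow> u = y) \<and> ((x, y, u) \<in> T \<longrightarrow> u = z))"

definition triangles :: "('a \<times> 'a \<times> 'a) set \<Rightarrow> ('a \<times> 'a \<times> 'a) set" where
  "triangles T = {(x, y, z). (\<exists>u. (u, y, z) \<in> T) \<and> (\<exists>u. (x, u, z) \<in> T) \<and> (\<exists>u. (x, y, u) \<in> T)}"

lemma card_tetrahedra:
  fixes c :: real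
  assumes c: "c > 0"
  shows "\<exists>\<delta>::real. \<delta> > 0 \<and> (\<forall>(X :: 'a set) F. finite X \<and> F \<subseteq> X \<times> X \<times> X \<times> X \<and> determined4 F \<and>
           card F \<ge> c * card X ^ 3 \<longrightarrow> card (tetrahedra F) \<ge> \<delta> * card X ^ 4)"
proof -
  define D :: "nat set" where "D = {..<4}"
  have D: "finite D" "card D = 4" "D = {0, 1, 2, 3}" by (auto simp: D_def)
  obtain \<delta> :: real where \<delta>: "\<delta> > 0" and tet: "\<And>(X :: 'a set) F. finite X \<and> cube.determined D X F \<and>
       real (card F) * card X \<ge> c * card (cube.\<Omega> D X) \<Longrightarrow>
     card {w \<in> cube.\<Omega> D X. \<forall>k\<in>D. w \<in> cube.faces D X F k} \<ge> \<delta> * card (cube.\<Omega> D X)"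
    using tetrahedron_lemma[where 'a = 'a, OF D(1,2) c] by blast
  have "card (tetrahedra F) \<ge> \<delta> * card X ^ 4"
    if X: "finite X" and F: "F \<subseteq> X \<times> X \<times> X \<times> X" and det: "determined4 F" and dense: "card F \<ge> c * card X ^ 3"
    for X :: "'a set" and F
  proof -
    interpret cube D X using D X by unfold_locales
    define \<phi> where "\<phi> w = (w 0, w 1, w 2, w 3)" for w :: "nat \<Rightarrow> 'a"
    define \<psi> where "\<psi> = (\<lambda>(x, y, z, t). (\<lambda>_ :: nat. undefined :: 'a)(0 := x, 1 := y, 2 := z, 3 := t))"
    have \<psi>\<Omega>: "\<psi> f \<in> \<Omega>" if "f \<in> X \<times> X \<times> X \<times> X" for f
      using that unfolding \<Omega>_def \<psi>_def by (auto simp: D(3) PiE_iff extensional_def)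
    have \<phi>\<psi>: "\<phi> (\<psi> f) = f" for f by (auto simp: \<phi>_def \<psi>_def split: prod.splits)
    have \<phi>X: "\<phi> w \<in> X \<times> X \<times> X \<times> X" if "w \<in> \<Omega>" for w
      using that unfolding \<Omega>_def \<phi>_def by (auto simp: D(3))
    have inj: "w = w'" if "w \<in> \<Omega>" "w' \<in> \<Omega>" "\<phi> w = \<phi> w'" for w w'
    proof (rule PiE_ext[of _ D "\<lambda>_. X"])
      show "w \<in> D \<rightarrow>\<^sub>E X" "w' \<in> D \<rightarrow>\<^sub>E X" using that by (simp_all add: \<Omega>_def)
      show "w i = w' i" if "i \<in> D" for i using \<open>\<phi> w = \<phi> w'\<close> that by (auto simp: \<phi>_def D(3))
    qed
    define F' where "F' = {w\<in>\<Omega>. \<phi> w \<in> F}"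
    have "bij_betw \<phi> F' F"
      by (rule bij_betw_byWitness[of _ \<psi>]) (use F \<phi>\<psi> inj \<psi>\<Omega> in \<open>auto simp: F'_def\<close>)
    then have cardF: "card F' = card F" by (rule bij_betw_same_card)
    have n4: "real (card \<Omega>) = card X ^ 3 * card X" by (simp add: card_\<Omega> D(2) power_eq_if)
    have "c * card \<Omega> \<le> real (card F') * card X"
    proof -
      have "c * card X ^ 3 * card X \<le> card F * real (card X)" using dense by (intro mult_right_mono) auto
      then show ?thesis unfolding n4 cardF by (simp add: mult.assoc)
    qed
    moreover have "determined F'"
      unfolding determined_def
    proof (intro conjI ballI impI)
      fix k w w' assume k: "k \<in> D" and w: "w \<in> F'" "w' \<in> F'" and eq: "\<forall>i\<in>D - {k}. w i = w' i"
      have "\<phi> w = \<phi> w'"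
        using k eq w det unfolding D(3) determined4_def by (auto simp: F'_def \<phi>_def)
      then show "w = w'" using inj w by (auto simp: F'_def)
    qed (auto simp: F'_def)
    ultimately have "\<delta> * card \<Omega> \<le> card {w \<in> \<Omega>. \<forall>k\<in>D. w \<in> faces F' k}"
      using tet X by blast
    also have "card {w \<in> \<Omega>. \<forall>k\<in>D. w \<in> faces F' k} \<le> card (tetrahedra F)"
    proof (rule card_inj_on_le[of \<phi>])
      show "inj_on \<phi> {w \<in> \<Omega>. \<forall>k\<in>D. w \<in> faces F' k}" using inj by (auto intro!: inj_onI)
      have "tetrahedra F \<subseteq> X \<times> X \<times> X \<times> X" using F unfolding tetrahedra_def by blast
      from finite_subset[OF this] show "finite (tetrahedra F)" using X by simp
      show "\<phi> ` {w \<in> \<Omega>. \<forall>k\<in>D. w \<in> faces F' k} \<subseteq> tetrahedra F"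
      proof (rule image_subsetI)
        fix w assume w: "w \<in> {w \<in> \<Omega>. \<forall>k\<in>D. w \<in> faces F' k}"
        have fc: "\<exists>w'. \<phi> w' \<in> F \<and> (\<forall>i\<in>D - {k}. w' i = w i)" if "k \<in> D" for k
          using w that by (auto simp: faces_def F'_def)
        show "\<phi> w \<in> tetrahedra F"
          using fc[of 0] fc[of 1] fc[of 2] fc[of 3] unfolding tetrahedra_def D(3) \<phi>_def by auto
      qed
    qed
    finally show ?thesis by (simp add: card_\<Omega> D(2))
  qed
  then show ?thesis using \<delta> by blast
qed

lemma latin_square:
  assumes "finite X" "X \<noteq> {}"
  shows "\<exists>s. (\<forall>z\<in>X. \<forall>w\<in>X. s z w \<in> X) \<and> (\<forall>w\<in>X. inj_on (\<lambda>z. s z w) X) \<and> (\<forall>z\<in>X. inj_on (s z) X)"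
proof -
  let ?n = "card X"
  have n: "?n > 0" using assms by (simp add: card_gt_0_iff)
  obtain b where b: "bij_betw b X {..<?n}"
    using ex_bij_betw_finite_nat[OF assms(1)] by (auto simp: atLeast0LessThan)
  define s where "s z w = inv_into X b ((b z + b w) mod ?n)" for z w
  have cancel: "i = j" if "(i + k) mod ?n = (j + k) mod ?n" "i < ?n" "j < ?n" for i j k :: nat
    using that
  proof (induction i j rule: linorder_wlog)
    case (le i j)
    then have "?n dvd (j + k) - (i + k)" using mod_eq_dvd_iff_nat[of "i + k" "j + k" ?n] by simp
    then have "?n dvd j - i" by simp
    then show ?case using le by (metis diff_is_0_eq dvd_imp_le le_antisym less_imp_diff_less not_less zero_less_iff_neq_zero)
  qed auto
  have bX: "b z < ?n" if "z \<in> X" for z using b that by (auto simp: bij_betw_def)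
  have sX: "s z w \<in> X" for z w
    unfolding s_def using b n by (auto simp: bij_betw_def intro!: inv_into_into)
  have bs: "b (s z w) = (b z + b w) mod ?n" for z w
    unfolding s_def using b n by (intro f_inv_into_f) (auto simp: bij_betw_def)
  have inj: "z = z'" if "b z = b z'" "z \<in> X" "z' \<in> X" for z z'
    using b that by (auto simp: bij_betw_def dest: inj_onD)
  have "inj_on (\<lambda>z. s z w) X" for w
    by (rule inj_onI) (metis bs cancel bX inj)
  moreover have "inj_on (s z) X" for z
  proof (rule inj_onI)
    fix w w' assume w: "w \<in> X" "w' \<in> X" and "s z w = s z w'"
    then have "(b w + b z) mod ?n = (b w' + b z) mod ?n" using bs[of z w] bs[of z w'] by (simp add: add.commute)
    then show "w = w'" using cancel bX w inj by blast
  qed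
  ultimately show ?thesis using sX by blast
qed

text \<open>Twisting a system of triples by a Latin square \<open>s\<close> gives a system of quadruples: the tetrahedra
  of the latter are the triangles of the former together with a free parameter.\<close>

lemma card_triangles:
  fixes c :: real
  assumes c: "c > 0"
  shows "\<exists>\<delta>::real. \<delta> > 0 \<and> (\<forall>(X :: 'a set) T. finite X \<and> T \<subseteq> X \<times> X \<times> X \<and> determined3 T \<and>
           card T \<ge> c * card X ^ 2 \<longrightarrow> card (triangles T) \<ge> \<delta> * card X ^ 3)"
proof -
  obtain \<delta> :: real where \<delta>: "\<delta> > 0" and tet: "\<And>(X :: 'a set) F. finite X \<and> F \<subseteq> X \<times> X \<times> X \<times> X \<and> determined4 F \<and>
           card F \<ge> c * card X ^ 3 \<Longrightarrow> card (tetrahedra F) \<ge> \<delta> * card X ^ 4"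
    using card_tetrahedra[where 'a = 'a, OF c] by blast
  have "card (triangles T) \<ge> \<delta> * card X ^ 3"
    if X: "finite X" and T: "T \<subseteq> X \<times> X \<times> X" and det: "determined3 T" and dense: "card T \<ge> c * card X ^ 2"
    for X :: "'a set" and T
  proof (cases "X = {}")
    case True
    then show ?thesis by simp
  next
    case False
    obtain s where sX: "\<And>z w. z \<in> X \<Longrightarrow> w \<in> X \<Longrightarrow> s z w \<in> X" and s1: "\<And>w. w \<in> X \<Longrightarrow> inj_on (\<lambda>z. s z w) X"
      and s2: "\<And>z. z \<in> X \<Longrightarrow> inj_on (s z) X"
      using latin_square[OF X False] by blast
    define F where "F = {(x, y, w, t). \<exists>z. (x, y, z) \<in> T \<and> w \<in> X \<and> t = s z w}"
    have FX: "F \<subseteq> X \<times> X \<times> X \<times> X" using T sX unfolding F_def by blast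
    have d1: "x = u" if "(x, y, z) \<in> T" "(u, y, z) \<in> T" for x y z u using det that by (auto simp: determined3_def)
    have d2: "y = u" if "(x, y, z) \<in> T" "(x, u, z) \<in> T" for x y z u using det that by (auto simp: determined3_def)
    have d3: "z = u" if "(x, y, z) \<in> T" "(x, y, u) \<in> T" for x y z u using det that by (auto simp: determined3_def)
    have TX: "z \<in> X" if "(x, y, z) \<in> T" for x y z using T that by blast
    have i1: "z = z'" if "s z w = s z' w" "w \<in> X" "z \<in> X" "z' \<in> X" for z z' w
      using s1[OF that(2)] that by (auto dest: inj_onD)
    have i2: "w = w'" if "s z w = s z w'" "w \<in> X" "z \<in> X" "w' \<in> X" for z w w'
      using s2[OF that(3)] that by (auto dest: inj_onD)
    have mem: "(x, y, w, t) \<in> F \<longleftrightarrow> (\<exists>z. (x, y, z) \<in> T \<and> w \<in> X \<and> t = s z w)" for x y w t by (simp add: F_def)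
    have "determined4 F"
      unfolding determined4_def mem

    proof (intro allI impI conjI)
      fix x y w t u assume "\<exists>z. (x, y, z) \<in> T \<and> w \<in> X \<and> t = s z w"
      then obtain z where z: "(x, y, z) \<in> T" "w \<in> X" "t = s z w" by blast
      show "u = x" if "\<exists>z. (u, y, z) \<in> T \<and> w \<in> X \<and> t = s z w"
      proof -
        from that obtain z' where z': "(u, y, z') \<in> T" "t = s z' w" by blast
        then have "z' = z" using z by (intro i1[of z' w z] TX[OF z'(1)] TX[OF z(1)]) simp_all
        then show ?thesis using z z' by (auto intro: d1)
      qed
      show "u = y" if "\<exists>z. (x, u, z) \<in> T \<and> w \<in> X \<and> t = s z w"
      proof -
        from that obtain z' where z': "(x, u, z') \<in> T" "t = s z' w" by blast
        then have "z' = z" using z by (intro i1[of z' w z] TX[OF z'(1)] TX[OF z(1)]) simp_all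
        then show ?thesis using z z' by (auto intro: d2)
      qed
      show "u = w" if "\<exists>z. (x, y, z) \<in> T \<and> u \<in> X \<and> t = s z u"
      proof -
        from that obtain z' where z': "(x, y, z') \<in> T" "u \<in> X" "t = s z' u" by blast
        then have "z' = z" using z by (auto intro: d3)
        then show ?thesis using z z' by (intro i2[of z u w] TX[OF z(1)]) simp_all
      qed
      show "u = t" if "\<exists>z. (x, y, z) \<in> T \<and> w \<in> X \<and> u = s z w"
        using that z d3 by blast
    qed
    moreover have "c * card X ^ 3 \<le> card F"
    proof -
      have "inj_on (\<lambda>((x, y, z), w). (x, y, w, s z w)) (T \<times> X)"
        by (rule inj_onI) (auto dest: d3)
      moreover have "(\<lambda>((x, y, z), w). (x, y, w, s z w)) ` (T \<times> X) \<subseteq> F" unfolding F_def by auto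
      moreover have "finite F" using finite_subset[OF FX] X by simp
      ultimately have "card (T \<times> X) \<le> card F" by (rule card_inj_on_le)
      then have le: "real (card T) * card X \<le> card F"
        by (simp add: card_cartesian_product flip: of_nat_mult)
      have "c * card X ^ 2 * card X \<le> card T * real (card X)" using dense by (intro mult_right_mono) auto
      with le show ?thesis by (simp add: power2_eq_square power3_eq_cube mult.assoc)
    qed
    ultimately have "\<delta> * card X ^ 4 \<le> card (tetrahedra F)" using tet X FX by blast
    also have "card (tetrahedra F) \<le> card (triangles T \<times> X)"
    proof -
      have "tetrahedra F \<subseteq> (\<lambda>((x, y, z), w). (x, y, w, s z w)) ` (triangles T \<times> X)"
      proof
        fix f assume f: "f \<in> tetrahedra F"
        obtain x y w t where fe: "f = (x, y, w, t)" by (cases f)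
        obtain x' z where 1: "(x', y, z) \<in> T" "w \<in> X" "t = s z w"
          using f unfolding fe tetrahedra_def F_def by auto
        obtain y' z' where 2: "(x, y', z') \<in> T" "t = s z' w"
          using f unfolding fe tetrahedra_def F_def by auto
        obtain z'' where 3: "(x, y, z'') \<in> T"
          using f unfolding fe tetrahedra_def F_def by auto
        have "z' = z" using 1 2 by (intro i1[of z' w z] TX[OF 1(1)] TX[OF 2(1)]) simp_all
        then have "(x, y, z) \<in> triangles T" using 1 2 3 unfolding triangles_def by auto
        then show "f \<in> (\<lambda>((x, y, z), w). (x, y, w, s z w)) ` (triangles T \<times> X)"
          using 1(2,3) fe by (intro image_eqI[of _ _ "((x, y, z), w)"]) auto
      qed
      moreover have "triangles T \<subseteq> X \<times> X \<times> X" using T unfolding triangles_def by blast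
      from finite_subset[OF this] have "finite (triangles T \<times> X)" using X by simp
      ultimately show ?thesis by (rule surj_card_le[rotated])
    qed
    finally have "\<delta> * card X ^ 4 \<le> real (card (triangles T)) * card X"
      by (simp add: card_cartesian_product)
    moreover have "card X > 0" using X False by (simp add: card_gt_0_iff)
    ultimately show ?thesis by (simp add: power_eq_if mult.assoc[symmetric])
  qed
  then show ?thesis using \<delta> by blast
qed

section \<open>Rainbow colourings\<close>

text \<open>Each tuple is rainbow for a proportion of at least \<open>1 / k ^ k\<close> of all colourings: every colouring is
  recovered from the rainbow one obtained by recolouring the tuple and from the \<open>k\<close> old colours.\<close>

lemma rainbow_colouring:
  fixes r :: "'i \<Rightarrow> nat \<Rightarrow> 'v"
  assumes V: "finite V" and I: "finite I" and k: "k > 0"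
    and r: "\<And>i. i \<in> I \<Longrightarrow> inj_on (r i) {..<k}" "\<And>i j. i \<in> I \<Longrightarrow> j < k \<Longrightarrow> r i j \<in> V"
  shows "\<exists>\<chi> :: 'v \<Rightarrow> nat. card I \<le> k ^ k * card {i\<in>I. \<forall>j<k. \<chi> (r i j) = j}"
proof (rule ccontr)
  assume neg: "\<not> ?thesis"
  let ?H = "V \<rightarrow>\<^sub>E {..<k}"
  let ?g = "\<lambda>\<chi> i. \<forall>j<k. \<chi> (r i j) = j"
  have finH: "finite ?H" using V by (simp add: finite_PiE)
  have neH: "?H \<noteq> {}" using k by (auto simp: PiE_eq_empty_iff lessThan_empty_iff)
  have each: "card ?H \<le> k ^ k * card {\<chi>\<in>?H. ?g \<chi> i}" if i: "i \<in> I" for i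
  proof -
    \<comment> \<open>Recolour the tuple \<open>i\<close> so that it becomes rainbow.\<close>
    define upd where "upd \<chi> v = (if v \<in> r i ` {..<k} then inv_into {..<k} (r i) v else \<chi> v)" for \<chi> :: "'v \<Rightarrow> nat" and v
    let ?h = "\<lambda>\<chi>. (upd \<chi>, restrict (\<lambda>j. \<chi> (r i j)) {..<k})"
    have inj: "inj_on ?h ?H"
    proof (rule inj_onI)
      fix \<chi> \<chi>' assume \<chi>: "\<chi> \<in> ?H" "\<chi>' \<in> ?H" and eq: "?h \<chi> = ?h \<chi>'"
      have "\<chi> v = \<chi>' v" for v
      proof (cases "v \<in> r i ` {..<k}")
        case True
        then obtain j where j: "j < k" "v = r i j" by auto
        have "restrict (\<lambda>j. \<chi> (r i j)) {..<k} j = restrict (\<lambda>j. \<chi>' (r i j)) {..<k} j" using eq by simp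
        then show ?thesis using j by simp
      next
        case False
        have "upd \<chi> v = upd \<chi>' v" using eq by simp
        then show ?thesis using False by (simp add: upd_def)
      qed
      then show "\<chi> = \<chi>'" by blast
    qed
    moreover have "?h ` ?H \<subseteq> {\<chi>\<in>?H. ?g \<chi> i} \<times> ({..<k} \<rightarrow>\<^sub>E {..<k})"
    proof (rule image_subsetI)
      fix \<chi> assume \<chi>: "\<chi> \<in> ?H"
      have "upd \<chi> \<in> ?H"
        using \<chi> r[OF i] by (auto simp: upd_def PiE_iff extensional_def inv_into_f_f)
      moreover have "?g (upd \<chi>) i" using r(1)[OF i] by (auto simp: upd_def inv_into_f_f)
      moreover have "restrict (\<lambda>j. \<chi> (r i j)) {..<k} \<in> {..<k} \<rightarrow>\<^sub>E {..<k}"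
        using \<chi> r(2)[OF i] by (auto simp: PiE_iff)
      ultimately show "?h \<chi> \<in> {\<chi>\<in>?H. ?g \<chi> i} \<times> ({..<k} \<rightarrow>\<^sub>E {..<k})" by blast
    qed
    moreover have "finite ({\<chi>\<in>?H. ?g \<chi> i} \<times> ({..<k} \<rightarrow>\<^sub>E {..<k}))" using finH by (simp add: finite_PiE)
    ultimately have "card ?H \<le> card ({\<chi>\<in>?H. ?g \<chi> i} \<times> ({..<k} \<rightarrow>\<^sub>E {..<k}))" by (rule card_inj_on_le)
    then show ?thesis by (simp add: card_cartesian_product card_PiE mult.commute)
  qed
  have "card I * card ?H = (\<Sum>i\<in>I. card ?H)" by simp
  also have "\<dots> \<le> (\<Sum>i\<in>I. k ^ k * card {\<chi>\<in>?H. ?g \<chi> i})" by (intro sum_mono each)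
  also have "\<dots> = k ^ k * (\<Sum>i\<in>I. \<Sum>\<chi>\<in>?H. of_bool (?g \<chi> i))"
    using finH by (simp add: sum_distrib_left of_bool_def sum.If_cases Int_def)
  also have "\<dots> = k ^ k * (\<Sum>\<chi>\<in>?H. \<Sum>i\<in>I. of_bool (?g \<chi> i))" by (subst sum.swap) simp
  also have "\<dots> = (\<Sum>\<chi>\<in>?H. k ^ k * card {i\<in>I. ?g \<chi> i})"
    using I by (simp add: sum_distrib_left of_bool_def sum.If_cases Int_def)
  also have "\<dots> < (\<Sum>\<chi>\<in>?H. card I)"
    using neg finH neH by (intro sum_strict_mono) (auto simp: not_le)
  finally show False by (simp add: mult.commute)
qed

section \<open>Embedding the two hypergraphs\<close>

lemma containsI:
  assumes "inj_on f (verts F)" "f ` verts F \<subseteq> verts G" "\<And>e. e \<in> edges F \<Longrightarrow> f ` e \<in> edges G"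
  shows "contains G F"
  unfolding contains_def
proof (intro exI conjI)
  show "subgraph \<lparr>verts = f ` verts F, edges = (`) f ` edges F\<rparr> G"
    using assms by (auto simp: subgraph_def)
  show "isomorphic F \<lparr>verts = f ` verts F, edges = (`) f ` edges F\<rparr>"
    unfolding isomorphic_def using assms(1) by (intro exI[of _ f]) (simp add: bij_betw_def)
qed

locale linear_system =
  fixes G :: "'a hypergraph"
  assumes lin: "linear3 G"
begin

definition line :: "'a \<Rightarrow> 'a \<Rightarrow> 'a \<Rightarrow> bool" where
  "line a b c \<longleftrightarrow> {a, b, c} \<in> edges G"

lemma line_perm: "line a b c \<longleftrightarrow> line b a c" "line a b c \<longleftrightarrow> line a c b"
  by (simp_all add: line_def insert_commute)

lemma line_distinct: "line a b c \<Longrightarrow> a \<noteq> b \<and> a \<noteq> c \<and> b \<noteq> c"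
  using lin by (auto simp: line_def linear3_def uniform3_def card_insert_if split: if_splits)

lemma line_verts: "line a b c \<Longrightarrow> a \<in> verts G \<and> b \<in> verts G \<and> c \<in> verts G"
  using lin by (auto simp: line_def linear3_def uniform3_def)

lemma finV: "finite (verts G)"
  using lin by (simp add: linear3_def uniform3_def)

lemma line_unique: assumes "line a b x" "line a b y" shows "x = y"
proof -
  have "{a, b, x} = {a, b, y}"
  proof (rule ccontr)
    assume ne: "{a, b, x} \<noteq> {a, b, y}"
    have "e \<noteq> f \<Longrightarrow> card (e \<inter> f) \<le> 1" if "e \<in> edges G" "f \<in> edges G" for e f
      using lin that unfolding linear3_def by simp
    from this[OF assms[unfolded line_def] ne] have "card ({a, b, x} \<inter> {a, b, y}) \<le> 1" .
    moreover have "card {a, b} \<le> card ({a, b, x} \<inter> {a, b, y})" by (intro card_mono) auto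
    ultimately show False using line_distinct[OF assms(1)] by simp
  qed
  then show ?thesis using line_distinct[OF assms(1)] line_distinct[OF assms(2)] by auto
qed

lemma line_uniques:
  "line a b x \<Longrightarrow> line a b y \<Longrightarrow> y = x" "line a x b \<Longrightarrow> line a y b \<Longrightarrow> y = x" "line x a b \<Longrightarrow> line y a b \<Longrightarrow> y = x"
  using line_unique line_perm by metis+

definition apex :: "'a \<Rightarrow> 'a \<Rightarrow> 'a set" where
  "apex v\<^sub>1 v\<^sub>3 = {x. (\<exists>a. line v\<^sub>1 a x) \<and> (\<exists>a. line a v\<^sub>3 x) \<and> \<not> line v\<^sub>1 v\<^sub>3 x}"

text \<open>A triangle of pairwise collinear points \<open>v\<^sub>1\<close>, \<open>v\<^sub>3\<close>, \<open>x\<close> with the third points on its sides.  The colouring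
  keeps vertices in different roles distinct, also across several cells.\<close>

definition cell :: "('a \<Rightarrow> nat) \<Rightarrow> 'a \<Rightarrow> 'a \<Rightarrow> 'a \<Rightarrow> 'a \<Rightarrow> 'a \<Rightarrow> 'a \<Rightarrow> bool" where
  "cell \<chi> v\<^sub>1 v\<^sub>3 a\<^sub>1 a\<^sub>3 x y \<longleftrightarrow> line v\<^sub>1 a\<^sub>3 x \<and> line a\<^sub>1 v\<^sub>3 x \<and> line v\<^sub>1 v\<^sub>3 y \<and> 40 \<le> card (apex v\<^sub>1 v\<^sub>3) \<and>
     \<chi> v\<^sub>1 = 0 \<and> \<chi> v\<^sub>3 = 1 \<and> \<chi> a\<^sub>1 = 2 \<and> \<chi> a\<^sub>3 = 3 \<and> \<chi> x = 4 \<and> \<chi> y = 5"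

definition cells :: "('a \<Rightarrow> nat) \<Rightarrow> ('a \<times> 'a \<times> 'a \<times> 'a) set" where
  "cells \<chi> = {(v\<^sub>1, v\<^sub>3, a\<^sub>1, a\<^sub>3). \<exists>x y. cell \<chi> v\<^sub>1 v\<^sub>3 a\<^sub>1 a\<^sub>3 x y}"

lemma cellsI: "cell \<chi> v\<^sub>1 v\<^sub>3 a\<^sub>1 a\<^sub>3 x y \<Longrightarrow> (v\<^sub>1, v\<^sub>3, a\<^sub>1, a\<^sub>3) \<in> cells \<chi>"
  by (auto simp: cells_def)

text \<open>Among \<open>a\<^sub>1\<close>, \<open>v\<^sub>3\<close> and among \<open>v\<^sub>1\<close>, \<open>a\<^sub>3\<close> at least one pair is complete when a single corner is missing; it
  gives \<open>x\<close>, and \<open>x\<close> gives the missing corner on the other line.\<close>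

lemma determined_cells: "determined4 (cells \<chi>)"
  unfolding determined4_def
proof (intro allI impI conjI)
  fix v\<^sub>1 v\<^sub>3 a\<^sub>1 a\<^sub>3 u assume "(v\<^sub>1, v\<^sub>3, a\<^sub>1, a\<^sub>3) \<in> cells \<chi>"
  then obtain x y where c: "cell \<chi> v\<^sub>1 v\<^sub>3 a\<^sub>1 a\<^sub>3 x y" by (auto simp: cells_def)
  show "u = v\<^sub>1" if u: "(u, v\<^sub>3, a\<^sub>1, a\<^sub>3) \<in> cells \<chi>"
  proof -
    obtain x' y' where c': "cell \<chi> u v\<^sub>3 a\<^sub>1 a\<^sub>3 x' y'" using u by (auto simp: cells_def)
    have "x' = x" using c c' unfolding cell_def by (blast intro: line_uniques)
    then show ?thesis using c c' unfolding cell_def by (blast intro: line_uniques)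
  qed
  show "u = v\<^sub>3" if u: "(v\<^sub>1, u, a\<^sub>1, a\<^sub>3) \<in> cells \<chi>"
  proof -
    obtain x' y' where c': "cell \<chi> v\<^sub>1 u a\<^sub>1 a\<^sub>3 x' y'" using u by (auto simp: cells_def)
    have "x' = x" using c c' unfolding cell_def by (blast intro: line_uniques)
    then show ?thesis using c c' unfolding cell_def by (blast intro: line_uniques)
  qed
  show "u = a\<^sub>1" if u: "(v\<^sub>1, v\<^sub>3, u, a\<^sub>3) \<in> cells \<chi>"
  proof -
    obtain x' y' where c': "cell \<chi> v\<^sub>1 v\<^sub>3 u a\<^sub>3 x' y'" using u by (auto simp: cells_def)
    have "x' = x" using c c' unfolding cell_def by (blast intro: line_uniques)
    then show ?thesis using c c' unfolding cell_def by (blast intro: line_uniques)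
  qed
  show "u = a\<^sub>3" if u: "(v\<^sub>1, v\<^sub>3, a\<^sub>1, u) \<in> cells \<chi>"
  proof -
    obtain x' y' where c': "cell \<chi> v\<^sub>1 v\<^sub>3 a\<^sub>1 u x' y'" using u by (auto simp: cells_def)
    have "x' = x" using c c' unfolding cell_def by (blast intro: line_uniques)
    then show ?thesis using c c' unfolding cell_def by (blast intro: line_uniques)
  qed
qed

text \<open>Four cells on the four faces \<open>(q, p, r)\<close>, \<open>(s, p, r)\<close>, \<open>(q, s, r)\<close>, \<open>(q, s, p)\<close>.  They share the points \<open>x\<^sub>1\<close>
  on the line through \<open>q\<close> and \<open>r\<close>, \<open>x\<^sub>2\<close> on the line through \<open>p\<close> and \<open>s\<close>, and \<open>y\<^sub>1\<close> on the line through \<open>q\<close>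
  and \<open>s\<close>.  Any further coincidence within a role would make \<open>(q, s, p, r)\<close> a cell, with the possible
  exception of \<open>y\<^sub>2 = y\<^sub>3\<close>.\<close>

lemma nontrivial_tetrahedron:
  assumes t: "(q, s, p, r) \<in> tetrahedra (cells \<chi>)" and nt: "(q, s, p, r) \<notin> cells \<chi>"
  obtains a b c d x\<^sub>1 x\<^sub>2 y\<^sub>1 y\<^sub>2 y\<^sub>3 where
    "cell \<chi> q d p r x\<^sub>1 y\<^sub>3" "cell \<chi> b s p r x\<^sub>2 y\<^sub>2" "cell \<chi> q s a r x\<^sub>1 y\<^sub>1" "cell \<chi> q s p c x\<^sub>2 y\<^sub>1"
    "a \<noteq> p" "b \<noteq> q" "c \<noteq> r" "d \<noteq> s" "x\<^sub>1 \<noteq> x\<^sub>2" "y\<^sub>1 \<noteq> y\<^sub>2" "y\<^sub>1 \<noteq> y\<^sub>3"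
proof -
  obtain b x\<^sub>2 y\<^sub>2 where O2: "cell \<chi> b s p r x\<^sub>2 y\<^sub>2" using t by (auto simp: tetrahedra_def cells_def)
  obtain d x\<^sub>1 y\<^sub>3 where O1: "cell \<chi> q d p r x\<^sub>1 y\<^sub>3" using t by (auto simp: tetrahedra_def cells_def)
  obtain a x\<^sub>1' y\<^sub>1 where O3: "cell \<chi> q s a r x\<^sub>1' y\<^sub>1" using t by (auto simp: tetrahedra_def cells_def)
  obtain c x\<^sub>2' y\<^sub>1' where O4: "cell \<chi> q s p c x\<^sub>2' y\<^sub>1'" using t by (auto simp: tetrahedra_def cells_def)
  have [simp]: "x\<^sub>1' = x\<^sub>1" using O1 O3 unfolding cell_def by (blast intro: line_uniques)
  have [simp]: "x\<^sub>2' = x\<^sub>2" using O2 O4 unfolding cell_def by (blast intro: line_uniques)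
  have [simp]: "y\<^sub>1' = y\<^sub>1" using O3 O4 unfolding cell_def by (blast intro: line_uniques)
  have ne: "a \<noteq> p" "b \<noteq> q" "c \<noteq> r" "d \<noteq> s" using O1 O2 O3 O4 nt cellsI by blast+
  have "x\<^sub>1 \<noteq> x\<^sub>2" using O1 O2 ne(4) line_uniques(2) unfolding cell_def by blast
  moreover have "y\<^sub>1 \<noteq> y\<^sub>2" using O2 O3 ne(2) line_uniques(3) unfolding cell_def by blast
  moreover have "y\<^sub>1 \<noteq> y\<^sub>3" using O1 O3 ne(4) line_uniques(2) unfolding cell_def by blast
  ultimately show ?thesis using that O1 O2 O3 O4 ne by simp
qed

text \<open>The nine lines of the four cells are the nine edges of the second hypergraph, and the case \<open>y\<^sub>2 = y\<^sub>3\<close>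
  is the one with two vertices identified.\<close>

lemma contains_B:
  assumes t: "(q, s, p, r) \<in> tetrahedra (cells \<chi>)" and nt: "(q, s, p, r) \<notin> cells \<chi>"
  shows "contains G hyp_B \<or> contains G hyp_B0"
proof -
  obtain a b c d x\<^sub>1 x\<^sub>2 y\<^sub>1 y\<^sub>2 y\<^sub>3 where
    O: "cell \<chi> q d p r x\<^sub>1 y\<^sub>3" "cell \<chi> b s p r x\<^sub>2 y\<^sub>2" "cell \<chi> q s a r x\<^sub>1 y\<^sub>1" "cell \<chi> q s p c x\<^sub>2 y\<^sub>1"
    and ne: "a \<noteq> p" "b \<noteq> q" "c \<noteq> r" "d \<noteq> s" "x\<^sub>1 \<noteq> x\<^sub>2" "y\<^sub>1 \<noteq> y\<^sub>2" "y\<^sub>1 \<noteq> y\<^sub>3"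
    using nontrivial_tetrahedron[OF t nt] .
  define f where "f v = (case v of B_w1' \<Rightarrow> p | B_w1'' \<Rightarrow> q | B_w3' \<Rightarrow> r | B_w3'' \<Rightarrow> s | B_v1' \<Rightarrow> a | B_v1'' \<Rightarrow> b
      | B_v3' \<Rightarrow> c | B_v3'' \<Rightarrow> d | B_x1 \<Rightarrow> x\<^sub>1 | B_x2 \<Rightarrow> x\<^sub>2 | B_y1 \<Rightarrow> y\<^sub>1 | B_y2 \<Rightarrow> y\<^sub>2 | B_y3 \<Rightarrow> y\<^sub>3)" for v
  note lines = O[unfolded cell_def line_def]
  have V: "f v \<in> verts G" for v
    using O line_verts unfolding cell_def f_def by (cases v) auto
  have edges: "f ` e \<in> edges G" if "e \<in> edges hyp_B" for e
    using that lines by (auto simp: hyp_B_def f_def insert_commute)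
  have col: "\<chi> p = 2" "\<chi> q = 0" "\<chi> r = 3" "\<chi> s = 1" "\<chi> a = 2" "\<chi> b = 0" "\<chi> c = 3" "\<chi> d = 1"
    "\<chi> x\<^sub>1 = 4" "\<chi> x\<^sub>2 = 4" "\<chi> y\<^sub>1 = 5" "\<chi> y\<^sub>2 = 5" "\<chi> y\<^sub>3 = 5"
    using O by (simp_all add: cell_def)
  have dist: "distinct (map f [B_w1', B_w1'', B_w3', B_w3'', B_v1', B_v1'', B_v3', B_v3'', B_x1, B_x2, B_y1, B_y2])"
    using col ne by (auto simp: f_def)
  show ?thesis
  proof (cases "y\<^sub>2 = y\<^sub>3")
    case True
    have "UNIV - {B_y3} = set [B_w1', B_w1'', B_w3', B_w3'', B_v1', B_v1'', B_v3', B_v3'', B_x1, B_x2, B_y1, B_y2]"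
      by (auto simp: B_UNIV)
    then have "inj_on f (verts hyp_B0)" using dist unfolding verts_B0 by (simp only: distinct_map)
    moreover have "f ` e \<in> edges G" if e: "e \<in> edges hyp_B0" for e
    proof -
      obtain e' where e': "e' \<in> edges hyp_B" "e = (\<lambda>u. if u = B_y3 then B_y2 else u) ` e'"
        using e by (auto simp: hyp_B0_def identify_def)
      have "f ` e = f ` e'" unfolding e'(2) image_image using True by (intro image_cong) (auto simp: f_def)
      then show ?thesis using edges e'(1) by simp
    qed
    ultimately have "contains G hyp_B0" using V by (intro containsI[of f]) auto
    then show ?thesis ..
  next
    case False
    have "(UNIV :: B_vertex set) = set [B_w1', B_w1'', B_w3', B_w3'', B_v1', B_v1'', B_v3', B_v3'', B_x1, B_x2, B_y1, B_y2, B_y3]"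
      by (auto simp: B_UNIV)
    moreover have "distinct (map f [B_w1', B_w1'', B_w3', B_w3'', B_v1', B_v1'', B_v3', B_v3'', B_x1, B_x2, B_y1, B_y2, B_y3])"
      using dist col ne False by (auto simp: f_def)
    ultimately have "inj_on f (verts hyp_B)" unfolding hyp_B_def by (simp only: distinct_map hypergraph.simps)
    then have "contains G hyp_B" using V edges by (intro containsI[of f]) auto
    then show ?thesis ..
  qed
qed

text \<open>A point \<open>u\<close> to be avoided excludes at most three apices: \<open>u\<close> itself, and the third points on the lines
  through \<open>u\<close> and \<open>s\<close> and through \<open>q\<close> and \<open>u\<close>.  Eleven points exclude \<open>33 < 40\<close>.\<close>

lemma fresh_apex:
  assumes pop: "40 \<le> card (apex q s)" and qs: "line q s z" and S: "finite S" "card S \<le> 11"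
  obtains x b\<^sub>1 b\<^sub>3 where "line b\<^sub>1 s x" "line q b\<^sub>3 x" "x \<notin> S" "b\<^sub>1 \<notin> S" "b\<^sub>3 \<notin> S" "b\<^sub>1 \<noteq> b\<^sub>3" "x \<noteq> b\<^sub>1" "x \<noteq> b\<^sub>3"
proof -
  define B where "B = S \<union> (\<Union>u\<in>S. {x. line u s x}) \<union> (\<Union>u\<in>S. {x. line q u x})"
  have le1: "finite {x. line u v x}" "card {x. line u v x} \<le> 1" for u v
  proof -
    have "{x. line u v x} = {} \<or> (\<exists>x. {x. line u v x} = {x})"
    proof (cases "\<exists>x. line u v x")
      case True
      then obtain x where "line u v x" by blast
      then have "{x. line u v x} = {x}" using line_unique by blast
      then show ?thesis by blast
    qed simp
    then show "finite {x. line u v x}" "card {x. line u v x} \<le> 1" by auto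
  qed
  have U: "card (\<Union>u\<in>S. A u) \<le> 11" if "\<And>u. card (A u) \<le> 1" for A :: "'a \<Rightarrow> 'a set"
  proof -
    have "card (\<Union>u\<in>S. A u) \<le> (\<Sum>u\<in>S. card (A u))" by (rule card_UN_le[OF S(1)])
    also have "\<dots> \<le> (\<Sum>u\<in>S. 1)" by (intro sum_mono that)
    also have "\<dots> \<le> 11" using S by simp
    finally show ?thesis .
  qed
  have finB: "finite B" unfolding B_def using S le1 by auto
  have "card B \<le> card (S \<union> (\<Union>u\<in>S. {x. line u s x})) + card (\<Union>u\<in>S. {x. line q u x})"
    unfolding B_def by (rule card_Un_le)
  also have "\<dots> \<le> (card S + card (\<Union>u\<in>S. {x. line u s x})) + card (\<Union>u\<in>S. {x. line q u x})"
    by (intro add_right_mono card_Un_le)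
  also have "\<dots> \<le> (11 + 11) + 11" by (intro add_mono S U le1)
  finally have "card B < card (apex q s)" using pop by simp
  then have "\<not> apex q s \<subseteq> B" using card_mono[OF finB] by (meson not_le)
  then obtain x where x: "x \<in> apex q s" "x \<notin> B" by blast
  then obtain b\<^sub>1 b\<^sub>3 where b: "line b\<^sub>1 s x" "line q b\<^sub>3 x" by (auto simp: apex_def)
  have "b\<^sub>1 \<notin> S" "b\<^sub>3 \<notin> S" "x \<notin> S" using x(2) b by (auto simp: B_def)
  moreover have "b\<^sub>1 \<noteq> b\<^sub>3"
  proof
    assume "b\<^sub>1 = b\<^sub>3"
    then have "line b\<^sub>1 x s" "line b\<^sub>1 x q" using b line_perm by metis+
    then have "s = q" by (rule line_unique)
    then show False using line_distinct[OF qs] by simp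
  qed
  ultimately show ?thesis using that[OF b] line_distinct[OF b(1)] line_distinct[OF b(2)] by auto
qed

text \<open>The first two cells and the line through \<open>q\<close> and \<open>s\<close> form seven of the nine edges; a further triangle
  over \<open>q\<close> and \<open>s\<close> supplies the other two.\<close>

lemma contains_A:
  assumes t: "(q, s, p, r) \<in> tetrahedra (cells \<chi>)" and nt: "(q, s, p, r) \<notin> cells \<chi>"
  shows "contains G hyp_A \<or> contains G hyp_A0"
proof -
  obtain a b c d x\<^sub>1 x\<^sub>2 y\<^sub>1 y\<^sub>2 y\<^sub>3 where
    O: "cell \<chi> q d p r x\<^sub>1 y\<^sub>3" "cell \<chi> b s p r x\<^sub>2 y\<^sub>2" "cell \<chi> q s a r x\<^sub>1 y\<^sub>1" "cell \<chi> q s p c x\<^sub>2 y\<^sub>1"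
    and ne: "a \<noteq> p" "b \<noteq> q" "c \<noteq> r" "d \<noteq> s" "x\<^sub>1 \<noteq> x\<^sub>2" "y\<^sub>1 \<noteq> y\<^sub>2" "y\<^sub>1 \<noteq> y\<^sub>3"
    using nontrivial_tetrahedron[OF t nt] .
  let ?S = "{p, q, r, s, b, d, x\<^sub>1, x\<^sub>2, y\<^sub>1, y\<^sub>2, y\<^sub>3}"
  have pop: "40 \<le> card (apex q s)" "line q s y\<^sub>1" using O(3) by (simp_all add: cell_def)
  have "card ?S = card (set [p, q, r, s, b, d, x\<^sub>1, x\<^sub>2, y\<^sub>1, y\<^sub>2, y\<^sub>3])" by (simp only: list.set)
  also have "\<dots> \<le> length [p, q, r, s, b, d, x\<^sub>1, x\<^sub>2, y\<^sub>1, y\<^sub>2, y\<^sub>3]" by (rule card_length)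
  also have "\<dots> = 11" by simp
  finally have S: "card ?S \<le> 11" .
  have fS: "finite ?S" by simp
  obtain x b\<^sub>1 b\<^sub>3 where new: "line b\<^sub>1 s x" "line q b\<^sub>3 x" "x \<notin> ?S" "b\<^sub>1 \<notin> ?S" "b\<^sub>3 \<notin> ?S"
    "b\<^sub>1 \<noteq> b\<^sub>3" "x \<noteq> b\<^sub>1" "x \<noteq> b\<^sub>3"
    by (rule fresh_apex[OF pop fS S])
  define f where "f v = (case v of A_a1 \<Rightarrow> p | A_a3 \<Rightarrow> r | A_b1 \<Rightarrow> b\<^sub>1 | A_b3 \<Rightarrow> b\<^sub>3 | A_u1 \<Rightarrow> b | A_u3 \<Rightarrow> s
      | A_v1 \<Rightarrow> q | A_v3 \<Rightarrow> d | A_x \<Rightarrow> x\<^sub>1 | A_x' \<Rightarrow> x\<^sub>2 | A_x'' \<Rightarrow> x | A_y \<Rightarrow> y\<^sub>3 | A_y' \<Rightarrow> y\<^sub>2 | A_z \<Rightarrow> y\<^sub>1)" for v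
  note lines = O[unfolded cell_def line_def] new(1,2)[unfolded line_def]
  have V: "f v \<in> verts G" for v
    using O new(1,2) line_verts unfolding cell_def f_def by (cases v) auto
  have edges: "f ` e \<in> edges G" if "e \<in> edges hyp_A" for e
    using that lines by (auto simp: hyp_A_def f_def insert_commute)
  have col: "\<chi> p = 2" "\<chi> q = 0" "\<chi> r = 3" "\<chi> s = 1" "\<chi> b = 0" "\<chi> d = 1"
    "\<chi> x\<^sub>1 = 4" "\<chi> x\<^sub>2 = 4" "\<chi> y\<^sub>1 = 5" "\<chi> y\<^sub>2 = 5" "\<chi> y\<^sub>3 = 5"
    using O by (simp_all add: cell_def)
  have dist: "distinct (map f [A_a1, A_a3, A_b1, A_b3, A_u1, A_u3, A_v1, A_v3, A_x, A_x', A_x'', A_y, A_z])"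
    using col ne new(3-) by (auto simp: f_def)
  show ?thesis
  proof (cases "y\<^sub>2 = y\<^sub>3")
    case True
    have "UNIV - {A_y'} = set [A_a1, A_a3, A_b1, A_b3, A_u1, A_u3, A_v1, A_v3, A_x, A_x', A_x'', A_y, A_z]"
      by (auto simp: A_UNIV)
    then have "inj_on f (verts hyp_A0)" using dist unfolding verts_A0 by (simp only: distinct_map)
    moreover have "f ` e \<in> edges G" if e: "e \<in> edges hyp_A0" for e
    proof -
      obtain e' where e': "e' \<in> edges hyp_A" "e = (\<lambda>u. if u = A_y' then A_y else u) ` e'"
        using e by (auto simp: hyp_A0_def identify_def)
      have "f ` e = f ` e'" unfolding e'(2) image_image using True by (intro image_cong) (auto simp: f_def)
      then show ?thesis using edges e'(1) by simp
    qed
    ultimately have "contains G hyp_A0" using V by (intro containsI[of f]) auto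
    then show ?thesis ..
  next
    case False
    have "(UNIV :: A_vertex set) = set [A_a1, A_a3, A_b1, A_b3, A_u1, A_u3, A_v1, A_v3, A_x, A_x', A_x'', A_y, A_z, A_y']"
      by (auto simp: A_UNIV)
    moreover have "distinct (map f [A_a1, A_a3, A_b1, A_b3, A_u1, A_u3, A_v1, A_v3, A_x, A_x', A_x'', A_y, A_z, A_y'])"
      using dist col ne False new(3-) by (auto simp: f_def)
    ultimately have "inj_on f (verts hyp_A)" unfolding hyp_A_def by (simp only: distinct_map hypergraph.simps)
    then have "contains G hyp_A" using V edges by (intro containsI[of f]) auto
    then show ?thesis ..
  qed
qed


section \<open>Counting cells\<close>

definition third :: "'a \<Rightarrow> 'a \<Rightarrow> 'a" where
  "third a b = (SOME c. line a b c)"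

lemma third: "line a b c \<Longrightarrow> line a b (third a b)"
  unfolding third_def by (rule someI)

definition lines :: "('a \<times> 'a \<times> 'a) set" where
  "lines = {(a, b, c). line a b c}"

lemma lines_subset: "lines \<subseteq> verts G \<times> verts G \<times> verts G"
  using line_verts by (auto simp: lines_def)

lemma determined_lines: "determined3 lines"
  unfolding determined3_def lines_def using line_uniques by blast

lemma card_lines: "card lines \<le> card (verts G) ^ 2" "card (edges G) \<le> card lines"
proof -
  have fin: "finite lines" using finite_subset[OF lines_subset] finV by simp
  have "inj_on (\<lambda>(a, b, c). (a, b)) lines"
    by (rule inj_onI) (auto simp: lines_def intro: line_unique)
  moreover have "(\<lambda>(a, b, c). (a, b)) ` lines \<subseteq> verts G \<times> verts G" using lines_subset by auto
  ultimately have "card lines \<le> card (verts G \<times> verts G)" using finV by (intro card_inj_on_le) auto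
  then show "card lines \<le> card (verts G) ^ 2" by (simp add: card_cartesian_product power2_eq_square)
  have "edges G \<subseteq> (\<lambda>(a, b, c). {a, b, c}) ` lines"
  proof
    fix e assume e: "e \<in> edges G"
    then have "card e = 3" using lin by (simp add: linear3_def uniform3_def)
    then obtain a b c where "e = {a, b, c}" by (auto simp: card_3_iff)
    then show "e \<in> (\<lambda>(a, b, c). {a, b, c}) ` lines"
      using e by (intro image_eqI[of _ _ "(a, b, c)"]) (auto simp: lines_def line_def)
  qed
  then show "card (edges G) \<le> card lines" by (rule surj_card_le[OF fin])
qed

text \<open>The lower bound \<open>40\<close> on the number of apices serves to find a further triangle over the same two points
  that avoids finitely many given points.  It costs only \<open>O(n\<^sup>2)\<close> triangles.\<close>

definition rich :: "('a \<times> 'a \<times> 'a) set" where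
  "rich = {(v\<^sub>1, v\<^sub>3, x). (\<exists>y. line v\<^sub>1 v\<^sub>3 y) \<and> x \<in> apex v\<^sub>1 v\<^sub>3 \<and> 40 \<le> card (apex v\<^sub>1 v\<^sub>3)}"

lemma finite_apex: "finite (apex v\<^sub>1 v\<^sub>3)"
  using line_verts by (intro finite_subset[OF _ finV]) (auto simp: apex_def)

lemma rich_subset: "rich \<subseteq> verts G \<times> verts G \<times> verts G"
  using line_verts by (auto simp: rich_def apex_def)

lemma card_triangles_le: "card (triangles lines) \<le> card rich + 40 * card (verts G) ^ 2"
proof -
  let ?V = "verts G"
  define P where "P = {p \<in> ?V \<times> ?V. card (apex (fst p) (snd p)) < 40}"
  define W where "W = (SIGMA p:P. apex (fst p) (snd p))"
  have finP: "finite P" unfolding P_def using finV by simp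
  have finW: "finite W" unfolding W_def using finP finite_apex by simp
  have "card W = (\<Sum>p\<in>P. card (apex (fst p) (snd p)))"
    unfolding W_def using finP finite_apex by (intro card_SigmaI) auto
  also have "\<dots> \<le> (\<Sum>p\<in>P. 39)" by (intro sum_mono) (auto simp: P_def)
  also have "\<dots> \<le> 39 * card (?V \<times> ?V)"
    using card_mono[of "?V \<times> ?V" P] finV by (simp add: P_def subset_iff)
  finally have cardW: "card W \<le> 39 * card ?V ^ 2" by (simp add: card_cartesian_product power2_eq_square)
  have fin: "finite rich" "finite lines"
    using finite_subset[OF rich_subset] finite_subset[OF lines_subset] finV by auto
  have "triangles lines \<subseteq> (rich \<union> lines) \<union> (\<lambda>((a, b), c). (a, b, c)) ` W"
  proof
    fix f assume f: "f \<in> triangles lines"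
    obtain v\<^sub>1 v\<^sub>3 x where fe: "f = (v\<^sub>1, v\<^sub>3, x)" by (cases f)
    obtain a\<^sub>1 a\<^sub>3 y where l: "line a\<^sub>1 v\<^sub>3 x" "line v\<^sub>1 a\<^sub>3 x" "line v\<^sub>1 v\<^sub>3 y"
      using f unfolding fe triangles_def lines_def by auto
    show "f \<in> (rich \<union> lines) \<union> (\<lambda>((a, b), c). (a, b, c)) ` W"
    proof (cases "line v\<^sub>1 v\<^sub>3 x")
      case True then show ?thesis by (simp add: fe lines_def)
    next
      case False
      then have ap: "x \<in> apex v\<^sub>1 v\<^sub>3" using l by (auto simp: apex_def)
      show ?thesis
      proof (cases "40 \<le> card (apex v\<^sub>1 v\<^sub>3)")
        case True then show ?thesis using l ap by (auto simp: fe rich_def)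
      next
        case False
        then have "((v\<^sub>1, v\<^sub>3), x) \<in> W" using ap line_verts[OF l(3)] by (auto simp: W_def P_def)
        then show ?thesis unfolding fe by (auto intro!: image_eqI[of _ _ "((v\<^sub>1, v\<^sub>3), x)"])
      qed
    qed
  qed
  then have "card (triangles lines) \<le> card ((rich \<union> lines) \<union> (\<lambda>((a, b), c). (a, b, c)) ` W)"
    using fin finW by (intro card_mono) auto
  also have "\<dots> \<le> card (rich \<union> lines) + card ((\<lambda>((a, b), c). (a, b, c)) ` W)" by (rule card_Un_le)
  also have "\<dots> \<le> (card rich + card lines) + card W" by (intro add_mono card_Un_le card_image_le finW)
  finally show ?thesis using cardW card_lines(1) by linarith
qed

text \<open>A coincidence among the six points would put \<open>v\<^sub>1\<close>, \<open>v\<^sub>3\<close>, \<open>x\<close> on one line.\<close>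

lemma rich_cell_distinct:
  assumes "(v\<^sub>1, v\<^sub>3, x) \<in> rich"
  shows "line v\<^sub>1 (third v\<^sub>1 x) x" "line (third v\<^sub>3 x) v\<^sub>3 x" "line v\<^sub>1 v\<^sub>3 (third v\<^sub>1 v\<^sub>3)"
    "distinct [v\<^sub>1, v\<^sub>3, third v\<^sub>3 x, third v\<^sub>1 x, x, third v\<^sub>1 v\<^sub>3]"
proof -
  obtain a\<^sub>1 a\<^sub>3 y where l: "line a\<^sub>1 v\<^sub>3 x" "line v\<^sub>1 a\<^sub>3 x" "line v\<^sub>1 v\<^sub>3 y" and nl: "\<not> line v\<^sub>1 v\<^sub>3 x"
    using assms by (auto simp: rich_def apex_def)
  have "line v\<^sub>3 x a\<^sub>1" "line v\<^sub>1 x a\<^sub>3" using l line_perm by metis+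
  then have "line v\<^sub>3 x (third v\<^sub>3 x)" "line v\<^sub>1 x (third v\<^sub>1 x)" using third by blast+
  then show L: "line v\<^sub>1 (third v\<^sub>1 x) x" "line (third v\<^sub>3 x) v\<^sub>3 x" "line v\<^sub>1 v\<^sub>3 (third v\<^sub>1 v\<^sub>3)"
    using line_perm third[OF l(3)] by metis+
  note d = L[THEN line_distinct]
  have "third v\<^sub>1 x \<noteq> v\<^sub>3" "third v\<^sub>3 x \<noteq> v\<^sub>1" "third v\<^sub>1 v\<^sub>3 \<noteq> x" using L nl by metis+
  moreover have "third v\<^sub>3 x \<noteq> third v\<^sub>1 x"
    using L d line_uniques line_perm by metis
  moreover have "third v\<^sub>3 x \<noteq> third v\<^sub>1 v\<^sub>3" "third v\<^sub>1 x \<noteq> third v\<^sub>1 v\<^sub>3"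
    using L d line_uniques line_perm by metis+
  ultimately show "distinct [v\<^sub>1, v\<^sub>3, third v\<^sub>3 x, third v\<^sub>1 x, x, third v\<^sub>1 v\<^sub>3]" using d by auto
qed

lemma cells_subset: "cells \<chi> \<subseteq> verts G \<times> verts G \<times> verts G \<times> verts G"
  using line_verts unfolding cells_def cell_def by blast

lemma many_cells: "\<exists>\<chi>. card rich \<le> 6 ^ 6 * card (cells \<chi>)"
proof -
  define r where "r i = (case i of (v\<^sub>1, v\<^sub>3, x) \<Rightarrow> \<lambda>j. [v\<^sub>1, v\<^sub>3, third v\<^sub>3 x, third v\<^sub>1 x, x, third v\<^sub>1 v\<^sub>3] ! j)" for i
  have finR: "finite rich" using finite_subset[OF rich_subset] finV by simp
  have inj: "inj_on (r i) {..<6}" if i: "i \<in> rich" for i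
  proof -
    obtain v\<^sub>1 v\<^sub>3 x where ie: "i = (v\<^sub>1, v\<^sub>3, x)" by (cases i)
    show ?thesis unfolding r_def ie prod.case
      by (rule inj_on_nth) (use rich_cell_distinct(4)[OF i[unfolded ie]] in auto)
  qed
  have mem: "r i j \<in> verts G" if i: "i \<in> rich" and j: "j < 6" for i j
  proof -
    obtain v\<^sub>1 v\<^sub>3 x where ie: "i = (v\<^sub>1, v\<^sub>3, x)" by (cases i)
    have "set [v\<^sub>1, v\<^sub>3, third v\<^sub>3 x, third v\<^sub>1 x, x, third v\<^sub>1 v\<^sub>3] \<subseteq> verts G"
      using rich_cell_distinct(1-3)[OF i[unfolded ie], THEN line_verts] by auto
    moreover have "r i j \<in> set [v\<^sub>1, v\<^sub>3, third v\<^sub>3 x, third v\<^sub>1 x, x, third v\<^sub>1 v\<^sub>3]"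
      unfolding r_def ie prod.case by (rule nth_mem) (use j in simp)
    ultimately show ?thesis by blast
  qed
  obtain \<chi> :: "'a \<Rightarrow> nat" where \<chi>: "card rich \<le> 6 ^ 6 * card {i\<in>rich. \<forall>j<6. \<chi> (r i j) = j}"
    using rainbow_colouring[where k = 6 and r = r, OF finV finR zero_less_numeral inj mem] by blast
  let ?h = "\<lambda>(v\<^sub>1, v\<^sub>3, x). (v\<^sub>1, v\<^sub>3, third v\<^sub>3 x, third v\<^sub>1 x)"
  have "card {i\<in>rich. \<forall>j<6. \<chi> (r i j) = j} \<le> card (cells \<chi>)"
  proof (rule card_inj_on_le[of ?h])
    show "inj_on ?h {i\<in>rich. \<forall>j<6. \<chi> (r i j) = j}"
    proof (rule inj_onI)
      fix i i' assume i: "i \<in> {i\<in>rich. \<forall>j<6. \<chi> (r i j) = j}" "i' \<in> {i\<in>rich. \<forall>j<6. \<chi> (r i j) = j}" and eq: "?h i = ?h i'"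
      obtain v\<^sub>1 v\<^sub>3 x v\<^sub>1' v\<^sub>3' x' where ie: "i = (v\<^sub>1, v\<^sub>3, x)" "i' = (v\<^sub>1', v\<^sub>3', x')" by (cases i, cases i')
      have "line v\<^sub>1 (third v\<^sub>1 x) x" "line v\<^sub>1' (third v\<^sub>1' x') x'"
        using i rich_cell_distinct(1) unfolding ie by blast+
      then show "i = i'" using eq unfolding ie by (auto intro: line_unique)
    qed
    show "?h ` {i\<in>rich. \<forall>j<6. \<chi> (r i j) = j} \<subseteq> cells \<chi>"
    proof (rule image_subsetI)
      fix i assume i: "i \<in> {i\<in>rich. \<forall>j<6. \<chi> (r i j) = j}"
      obtain v\<^sub>1 v\<^sub>3 x where ie: "i = (v\<^sub>1, v\<^sub>3, x)" by (cases i)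
      have R: "(v\<^sub>1, v\<^sub>3, x) \<in> rich" and col: "\<And>j. j < 6 \<Longrightarrow> \<chi> (r i j) = j" using i unfolding ie by auto
      have "\<chi> v\<^sub>1 = 0" "\<chi> v\<^sub>3 = 1" "\<chi> (third v\<^sub>3 x) = 2" "\<chi> (third v\<^sub>1 x) = 3" "\<chi> x = 4" "\<chi> (third v\<^sub>1 v\<^sub>3) = 5"
        using col[of 0] col[of 1] col[of 2] col[of 3] col[of 4] col[of 5] by (simp_all add: r_def ie)
      moreover have "40 \<le> card (apex v\<^sub>1 v\<^sub>3)" using R by (simp add: rich_def)
      ultimately have "cell \<chi> v\<^sub>1 v\<^sub>3 (third v\<^sub>3 x) (third v\<^sub>1 x) x (third v\<^sub>1 v\<^sub>3)"
        using rich_cell_distinct(1-3)[OF R] by (simp add: cell_def)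
      then show "?h i \<in> cells \<chi>" unfolding ie by (auto intro: cellsI)
    qed
    show "finite (cells \<chi>)" using finite_subset[OF cells_subset] finV by simp
  qed
  then have "6 ^ 6 * card {i\<in>rich. \<forall>j<6. \<chi> (r i j) = j} \<le> 6 ^ 6 * card (cells \<chi>)" by simp
  with \<chi> show ?thesis by (meson order_trans)
qed

lemma card_cells_le: "card (cells \<chi>) \<le> card (verts G) ^ 3"
proof -
  have "inj_on (\<lambda>(a, b, c, d). (a, b, c)) (cells \<chi>)"
    by (rule inj_onI) (use determined_cells[of \<chi>] in \<open>auto simp: determined4_def\<close>)
  moreover have "(\<lambda>(a, b, c, d). (a, b, c)) ` cells \<chi> \<subseteq> verts G \<times> verts G \<times> verts G"
    using cells_subset[of \<chi>] by auto
  ultimately have "card (cells \<chi>) \<le> card (verts G \<times> verts G \<times> verts G)"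
    using finV by (intro card_inj_on_le) auto
  then show ?thesis by (simp add: card_cartesian_product power3_eq_cube mult.assoc)
qed

end

text \<open>There are at least of the order of \<open>n\<^sup>3\<close> rainbow cells, hence of the order of \<open>n\<^sup>4\<close> tetrahedra, but at
  most \<open>n\<^sup>3\<close> of these are cells.\<close>

lemma dense_has_tetrahedron:
  fixes c :: real
  assumes c: "c > 0"
  shows "\<exists>n0::nat. \<forall>n\<ge>n0. \<forall>G :: 'a hypergraph.
      linear3 G \<and> card (verts G) = n \<and> real (card (edges G)) \<ge> c * (real n)\<^sup>2 \<longrightarrow>
      (\<exists>\<chi> q s p r. (q, s, p, r) \<in> tetrahedra (linear_system.cells G \<chi>) \<and> (q, s, p, r) \<notin> linear_system.cells G \<chi>)"
proof -
  obtain \<delta>\<^sub>1 :: real where \<delta>\<^sub>1: "\<delta>\<^sub>1 > 0" and tri: "\<And>(X :: 'a set) T. finite X \<and> T \<subseteq> X \<times> X \<times> X \<and> determined3 T \<and>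
           card T \<ge> c * card X ^ 2 \<Longrightarrow> card (triangles T) \<ge> \<delta>\<^sub>1 * card X ^ 3"
    using card_triangles[where 'a = 'a, OF c] by blast
  have c2: "\<delta>\<^sub>1 / (2 * 6 ^ 6) > 0" using \<delta>\<^sub>1 by simp
  obtain \<delta>\<^sub>2 :: real where \<delta>\<^sub>2: "\<delta>\<^sub>2 > 0" and tet: "\<And>(X :: 'a set) F. finite X \<and> F \<subseteq> X \<times> X \<times> X \<times> X \<and> determined4 F \<and>
           card F \<ge> \<delta>\<^sub>1 / (2 * 6 ^ 6) * card X ^ 3 \<Longrightarrow> card (tetrahedra F) \<ge> \<delta>\<^sub>2 * card X ^ 4"
    using card_tetrahedra[where 'a = 'a, OF c2] by blast
  \<comment> \<open>The first bound makes the \<open>40 * n\<^sup>2\<close> poor triangles at most half of all; the second makes the tetrahedra outnumber the cells.\<close>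
  define n0 where "n0 = Suc (nat \<lceil>max (80 / \<delta>\<^sub>1) (1 / \<delta>\<^sub>2)\<rceil>)"
  have "\<exists>\<chi> q s p r. (q, s, p, r) \<in> tetrahedra (linear_system.cells G \<chi>) \<and> (q, s, p, r) \<notin> linear_system.cells G \<chi>"
    if n: "n \<ge> n0" and G: "linear3 G" "card (verts G) = n" and dense: "real (card (edges G)) \<ge> c * (real n)\<^sup>2" for n and G :: "'a hypergraph"
  proof -
    interpret linear_system G using G(1) by unfold_locales
    have "real n > max (80 / \<delta>\<^sub>1) (1 / \<delta>\<^sub>2)" using n unfolding n0_def by linarith
    then have n1: "80 < \<delta>\<^sub>1 * n" and n2: "1 < \<delta>\<^sub>2 * n" using \<delta>\<^sub>1 \<delta>\<^sub>2 by (simp_all add: field_simps)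
    have npos: "real n > 0" using n n0_def by simp
    have "c * card (verts G) ^ 2 \<le> card lines" using dense card_lines(2) G(2) by simp
    then have "\<delta>\<^sub>1 * n ^ 3 \<le> card (triangles lines)"
      using tri[of "verts G" lines] finV lines_subset determined_lines G(2) by simp
    also have "real (card (triangles lines)) \<le> real (card rich + 40 * n ^ 2)"
      using card_triangles_le G(2) by (simp only: of_nat_le_iff)
    finally have "\<delta>\<^sub>1 * n ^ 3 \<le> card rich + 40 * real n ^ 2" by simp
    moreover have "80 * real n ^ 2 \<le> (\<delta>\<^sub>1 * n) * real n ^ 2" using n1 by (intro mult_right_mono) auto
    ultimately have rich: "\<delta>\<^sub>1 / 2 * real n ^ 3 \<le> card rich" by (simp add: power2_eq_square power3_eq_cube)
    obtain \<chi> where "card rich \<le> 6 ^ 6 * card (cells \<chi>)" using many_cells by blast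
    then have "real (card rich) \<le> real (6 ^ 6 * card (cells \<chi>))" by (simp only: of_nat_le_iff)
    then have "\<delta>\<^sub>1 / 2 * real n ^ 3 \<le> 6 ^ 6 * real (card (cells \<chi>))" using rich by simp
    then have "\<delta>\<^sub>1 / (2 * 6 ^ 6) * card (verts G) ^ 3 \<le> card (cells \<chi>)" using G(2) by simp
    then have t: "\<delta>\<^sub>2 * real n ^ 4 \<le> card (tetrahedra (cells \<chi>))"
      using tet[of "verts G" "cells \<chi>"] finV cells_subset determined_cells G(2) by simp
    have "real (card (cells \<chi>)) \<le> 1 * real n ^ 3" using card_cells_le[of \<chi>] G(2) by (simp flip: of_nat_power)
    also have "\<dots> < (\<delta>\<^sub>2 * n) * real n ^ 3" using n2 npos by (intro mult_strict_right_mono) auto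
    also have "\<dots> = \<delta>\<^sub>2 * real n ^ 4" by (simp add: power_eq_if)
    finally have "card (cells \<chi>) < card (tetrahedra (cells \<chi>))" using t by linarith
    moreover have "finite (cells \<chi>)" using finite_subset[OF cells_subset] finV by simp
    ultimately have "\<not> tetrahedra (cells \<chi>) \<subseteq> cells \<chi>" by (meson card_mono not_le)
    then show ?thesis by auto
  qed
  then show ?thesis by blast
qed

section \<open>The theorem\<close>

lemma contains_wicketI:
  fixes f :: "nat \<Rightarrow> nat \<Rightarrow> 'a"
  assumes "distinct [f 1 1, f 1 2, f 1 3, f 2 1, f 2 2, f 2 3, f 3 1, f 3 2, f 3 3]"
    and "{f 1 1, f 1 2, f 1 3, f 2 1, f 2 2, f 2 3, f 3 1, f 3 2, f 3 3} \<subseteq> verts G"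
    and "{{f 1 1, f 1 2, f 1 3}, {f 2 1, f 2 2, f 2 3}, {f 3 1, f 3 2, f 3 3},
          {f 1 1, f 2 1, f 3 1}, {f 1 2, f 2 2, f 3 2}} \<subseteq> edges G"
  shows "contains G wicket"
proof -
  have V: "verts wicket = set [(1, 1), (1, 2), (1, 3), (2, 1), (2, 2), (2, 3), (3, 1), (3, 2), (3, 3)]"
  proof -
    have "{1..3} = {1, 2, 3 :: nat}" by auto
    then show ?thesis by (auto simp: wicket_def)
  qed
  show ?thesis
  proof (rule containsI[of "case_prod f"])
    have "distinct (map (case_prod f) [(1, 1), (1, 2), (1, 3), (2, 1), (2, 2), (2, 3), (3, 1), (3, 2), (3, 3)])"
      using assms(1) by (simp only: list.map prod.case)
    then show "inj_on (case_prod f) (verts wicket)" unfolding V by (simp only: distinct_map)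
    show "case_prod f ` verts wicket \<subseteq> verts G" using assms(2) by (simp add: V)
    show "case_prod f ` e \<in> edges G" if "e \<in> edges wicket" for e
      using that assms(3) by (auto simp: edges_wicket)
  qed
qed

lemma contains_wicket:
  "contains hyp_A wicket" "contains hyp_A0 wicket" "contains hyp_B wicket" "contains hyp_B0 wicket"
proof -
  let ?f = "\<lambda>M i j. M ! (i - 1) ! (j - 1)"
  let ?A = "[[A_x, A_a1, A_v3], [A_a3, A_x', A_u1], [A_v1, A_u3, A_z]]"
  let ?B = "[[B_x1, B_w1', B_v3''], [B_w3', B_x2, B_v1''], [B_w1'', B_w3'', B_y1]]"
  show "contains hyp_A wicket"
    by (rule contains_wicketI[of "?f ?A"]) (simp_all add: hyp_A_def insert_commute)
  show "contains hyp_A0 wicket"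
    by (rule contains_wicketI[of "?f ?A"]) (simp_all add: hyp_A0_def hyp_A_def identify_def insert_commute)
  show "contains hyp_B wicket"
    by (rule contains_wicketI[of "?f ?B"]) (simp_all add: hyp_B_def insert_commute)
  show "contains hyp_B0 wicket"
    by (rule contains_wicketI[of "?f ?B"]) (simp_all add: hyp_B0_def hyp_B_def identify_def insert_commute)
qed

theorem mainTheorem2:
  shows "(contains hyp_A wicket \<and> contains hyp_A0 wicket \<and>
          contains hyp_B wicket \<and> contains hyp_B0 wicket) \<and>
         (\<forall>c::real. c > 0 \<longrightarrow> (\<exists>n0::nat. \<forall>n\<ge>n0. \<forall>G :: 'a hypergraph.
            linear3 G \<and> card (verts G) = n \<and> real (card (edges G)) \<ge> c * (real n)\<^sup>2 \<longrightarrow>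
            contains G hyp_A \<or> contains G hyp_A0)) \<and>
         (\<forall>c::real. c > 0 \<longrightarrow> (\<exists>n0::nat. \<forall>n\<ge>n0. \<forall>G :: 'a hypergraph.
            linear3 G \<and> card (verts G) = n \<and> real (card (edges G)) \<ge> c * (real n)\<^sup>2 \<longrightarrow>
            contains G hyp_B \<or> contains G hyp_B0))"
proof -
  have A: "contains G hyp_A \<or> contains G hyp_A0" and B: "contains G hyp_B \<or> contains G hyp_B0"
    if G: "linear3 G" and ex: "\<exists>\<chi> q s p r. (q, s, p, r) \<in> tetrahedra (linear_system.cells G \<chi>) \<and> (q, s, p, r) \<notin> linear_system.cells G \<chi>"
    for G :: "'a hypergraph"
  proof -
    interpret linear_system G using G by unfold_locales
    obtain \<chi> q s p r where t: "(q, s, p, r) \<in> tetrahedra (cells \<chi>)" "(q, s, p, r) \<notin> cells \<chi>"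
      using ex by blast
    show "contains G hyp_A \<or> contains G hyp_A0" by (rule contains_A[OF t])
    show "contains G hyp_B \<or> contains G hyp_B0" by (rule contains_B[OF t])
  qed
  have main: "\<exists>n0::nat. \<forall>n\<ge>n0. \<forall>G :: 'a hypergraph.
      linear3 G \<and> card (verts G) = n \<and> real (card (edges G)) \<ge> c * (real n)\<^sup>2 \<longrightarrow> Q G"
    if c: "c > 0" and Q: "\<And>G. linear3 G \<Longrightarrow> \<exists>\<chi> q s p r. (q, s, p, r) \<in> tetrahedra (linear_system.cells G \<chi>) \<and>
        (q, s, p, r) \<notin> linear_system.cells G \<chi> \<Longrightarrow> Q G" for c :: real and Q
  proof -
    from dense_has_tetrahedron[where 'a = 'a, OF c]
    obtain n0 :: nat where n0: "\<forall>n\<ge>n0. \<forall>G :: 'a hypergraph.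
        linear3 G \<and> card (verts G) = n \<and> real (card (edges G)) \<ge> c * (real n)\<^sup>2 \<longrightarrow>
        (\<exists>\<chi> q s p r. (q, s, p, r) \<in> tetrahedra (linear_system.cells G \<chi>) \<and> (q, s, p, r) \<notin> linear_system.cells G \<chi>)"
      by (rule exE)
    show ?thesis
    proof (rule exI[of _ n0], intro allI impI)
      fix n and G :: "'a hypergraph"
      assume n: "n0 \<le> n" and G: "linear3 G \<and> card (verts G) = n \<and> real (card (edges G)) \<ge> c * (real n)\<^sup>2"
      show "Q G" by (rule Q[OF conjunct1[OF G] n0[THEN spec, THEN mp, OF n, THEN spec, THEN mp, OF G]])
    qed
  qed
  show ?thesis
    by (intro conjI contains_wicket allI impI main A B)
qed

end
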